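(* Let $\mathfrak S_{\mathcal X}=\{\mathcal X=\mathcal X_0\leftarrow\cdots\leftarrow\mathcal X_n\leftarrow\cdots\}$ be a topological finite covering sequence, and let $\mathfrak S_{C_0(\mathcal X)}=\{C_0(\mathcal X)=C_0(\mathcal X_0)\to\cdots\to C_0(\mathcal X_n)\to\cdots\}$ be the corresponding sequence of $C^*$-algebras. Then there is a natural isomorphism $$\varprojlim\mathfrak S_{C_0(\mathcal X)}\;\approx\; C_0\left(\varprojlim\mathfrak S_{\mathcal X}\right).$$
   Context: Covering projections. A continuous map $p:\widetilde{\mathcal X}\to\mathcal X$ is a covering projection if each point of $\mathcal X$ has an open neighborhood $\mathcal U$ that is evenly covered ($p^{-1}(\mathcal U)$ is a disjoint union of open sets each mapped homeomorphically onto $\mathcal U$). It is regular if for every closed path $\omega$ in $\mathcal X$ either every lifting of $\omega$ is closed or none is closed; finitely listed means finite-fold. $G(\widetilde{\mathcal X}|\mathcal X)$ is the group of homeomorphisms $f$ of $\widetilde{\mathcal X}$ with $p\circ f=p$. A topological finite covering sequence ($\mathfrak S\in\mathfrak{FinTop}$) is a sequence of finitely listed covering projections $\mathcal X=\mathcal X_0\leftarrow\mathcal X_1\leftarrow\cdots$ such that: every $\mathcal X_n$ is a second-countable locally compact connected Hausdorff space; every map $\mathcal X_n\to\mathcal X_m$ ($m<n$) is a regular finitely listed covering projection; for $k<l<m$ there is the natural exact sequence $\{e\}\to G(\mathcal X_m|\mathcal X_l)\to G(\mathcal X_m|\mathcal X_k)\to G(\mathcal X_l|\mathcal X_k)\to\{e\}$.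 Topological inverse limits. $\widehat{\mathcal X}=\varprojlim\mathcal X_n$ is the inverse limit in topological spaces, with maps $\widehat\pi^n:\widehat{\mathcal X}\to\mathcal X_n$; $\widehat G=G(\widehat{\mathcal X}|\mathcal X)$ is the group of homeomorphisms $g$ of $\widehat{\mathcal X}$ with $\widehat\pi^0\circ g=\widehat\pi^0$. A covering projection of $\mathfrak S$ is a topological space $\mathcal Y$ with surjective regular covering projections $\pi^{\mathcal Y}_n:\mathcal Y\to\mathcal X_n$ compatible with the maps $\mathcal X_n\to\mathcal X_{n-1}$; a morphism $\mathcal Y'\to\mathcal Y''$ is a covering projection $f$ with $\pi_n^{\mathcal Y''}\circ f=\pi_n^{\mathcal Y'}$ for all $n$. The inverse limit $\widetilde{\mathcal X}=\varprojlim\mathfrak S_{\mathcal X}$ is the final object of this category; it is the set $\widehat{\mathcal X}$ with the topology generated by special sets, where $\mathcal V\subset\widehat{\mathcal X}$ is special if $\widehat\pi^0(\mathcal V)$ is evenly covered by $\mathcal X_1\to\mathcal X_0$ and for every $n\ge0$ the set $\widehat\pi^n(\mathcal V)$ is open and connected in $\mathcal X_n$ and $\widehat\pi^n|_{\mathcal V}$ is a bijection onto it. The group $\widehat G$ acts on $\widetilde{\mathcal X}$ by homeomorphisms, and $\widehat G\cong G(\widetilde{\mathcal X}|\mathcal X)$. Algebraic inverse limit. Let $h_n:\widehat G\to G(\mathcal X_n|\mathcal X)$ be the natural homomorphism and $J_n=\ker h_n$. Each $C_0(\mathcal X_n)$ is regarded by pullback as a subalgebra of $C_b(\widetilde{\mathcal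 X})\subset L^\infty(\widetilde{\mathcal X})$. Here $L^\infty(\widetilde{\mathcal X})$ is the algebra of classes of essentially bounded measurable functions on $\widetilde{\mathcal X}$ acting by multiplication on $L^2(\widetilde{\mathcal X},\mu)$, where $\mu$ is the Radon measure on $\widetilde{\mathcal X}$ lifted locally from a Radon measure of full support on $\mathcal X$ (so $\mu$ is $\widehat G$-invariant, and $\widehat G$ acts on $L^\infty(\widetilde{\mathcal X})$). A positive element $\overline a\in L^\infty(\widetilde{\mathcal X})$ is special if: (a) for every $n\ge0$ the series $a_n=\sum_{g\in J_n}g\overline a$ and $b_n=\sum_{g\in J_n}g\overline a^2$ are strongly convergent with sums in $C_0(\mathcal X_n)$; (b) for every $\varepsilon>0$ there is $M$ such that $\|a_n^2-b_n\|<\varepsilon$ for all $n\ge M$. The inverse noncommutative limit $\varprojlim\mathfrak S_{C_0(\mathcal X)}$ is the $C^*$-norm completion of the algebra generated by the $\mathbb C$-linear span of special elements. *)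

theory Defs
  imports
    "HOL-Analysis.Analysis"
    "HOL-Probability.Essential_Supremum"
    "HOL-Algebra.Bij"
    "HOL-Algebra.Exact_Sequence"
begin

section \<open>Covering projections and deck groups\<close>

definition evenly_covered :: "'e topology \<Rightarrow> 'b topology \<Rightarrow> ('e \<Rightarrow> 'b) \<Rightarrow> 'b set \<Rightarrow> bool" where
  "evenly_covered E B p U \<longleftrightarrow>
     (\<exists>\<V>. (\<forall>V\<in>\<V>. openin E V) \<and> pairwise disjnt \<V> \<and> \<Union>\<V> = {x \<in> topspace E. p x \<in> U} \<and>
          (\<forall>V\<in>\<V>. homeomorphic_map (subtopology E V) (subtopology B U) p))"

text \<open>Unlike the library's \<open>covering_space\<close>, which lives on type classes, a covering projection is
  not required to be surjective: the family of sheets over a neighbourhood may be empty.\<close>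

definition covering_projection :: "'e topology \<Rightarrow> 'b topology \<Rightarrow> ('e \<Rightarrow> 'b) \<Rightarrow> bool" where
  "covering_projection E B p \<longleftrightarrow>
     continuous_map E B p \<and>
     (\<forall>x\<in>topspace B. \<exists>U. openin B U \<and> x \<in> U \<and> evenly_covered E B p U)"

definition path_lifting :: "'e topology \<Rightarrow> ('e \<Rightarrow> 'b) \<Rightarrow> (real \<Rightarrow> 'b) \<Rightarrow> (real \<Rightarrow> 'e) \<Rightarrow> bool" where
  "path_lifting E p w v \<longleftrightarrow> pathin E v \<and> (\<forall>t\<in>{0..1}. p (v t) = w t)"

definition regular_covering :: "'e topology \<Rightarrow> 'b topology \<Rightarrow> ('e \<Rightarrow> 'b) \<Rightarrow> bool" where
  "regular_covering E B p \<longleftrightarrow>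
     covering_projection E B p \<and>
     (\<forall>w. pathin B w \<and> w 0 = w 1 \<longrightarrow>
        (\<forall>v. path_lifting E p w v \<longrightarrow> v 0 = v 1) \<or>
        (\<forall>v. path_lifting E p w v \<longrightarrow> v 0 \<noteq> v 1))"

definition finite_fold :: "'e topology \<Rightarrow> 'b topology \<Rightarrow> ('e \<Rightarrow> 'b) \<Rightarrow> bool" where
  "finite_fold E B p \<longleftrightarrow> (\<forall>x\<in>topspace B. finite {y \<in> topspace E. p y = x})"

text \<open>Elements of \<open>G(E|B)\<close> are extensional functions, as in \<^const>\<open>BijGroup\<close>.\<close>

definition deck_group :: "'e topology \<Rightarrow> ('e \<Rightarrow> 'b) \<Rightarrow> ('e \<Rightarrow> 'e) monoid" where
  "deck_group E p = (BijGroup (topspace E))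
     \<lparr>carrier := {f \<in> Bij (topspace E). homeomorphic_map E E f \<and> (\<forall>x\<in>topspace E. p (f x) = p x)}\<rparr>"

text \<open>For \<open>q : E \<rightarrow> F\<close> over a common base, with \<open>r : F \<rightarrow> B\<close>, the natural map
  \<open>G(E|B) \<rightarrow> G(F|B)\<close> sends \<open>g\<close> to the \<open>f\<close> with \<open>f \<circ> q = q \<circ> g\<close>.\<close>

definition deck_descent ::
  "'e topology \<Rightarrow> ('e \<Rightarrow> 'f) \<Rightarrow> 'f topology \<Rightarrow> ('f \<Rightarrow> 'b) \<Rightarrow> ('e \<Rightarrow> 'e) \<Rightarrow> ('f \<Rightarrow> 'f)" where
  "deck_descent E q F r g =
     (THE f. f \<in> carrier (deck_group F r) \<and> (\<forall>x\<in>topspace E. f (q x) = q (g x)))"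


section \<open>Topological finite covering sequences\<close>

text \<open>The spaces \<open>X n\<close> are realised on one common type, with \<open>p n : X (n + 1) \<rightarrow> X n\<close>;
  \<open>bond p m n : X n \<rightarrow> X m\<close> is the composite for \<open>m \<le> n\<close>.\<close>

primrec bond :: "(nat \<Rightarrow> 'a \<Rightarrow> 'a) \<Rightarrow> nat \<Rightarrow> nat \<Rightarrow> 'a \<Rightarrow> 'a" where
  "bond p m 0 x = x"
| "bond p m (Suc n) x = (if m \<le> n then bond p m n (p n x) else x)"

text \<open>In \<^const>\<open>short_exact_sequence\<close> the arrows run from right to left.\<close>

definition FinTop :: "(nat \<Rightarrow> 'a topology) \<Rightarrow> (nat \<Rightarrow> 'a \<Rightarrow> 'a) \<Rightarrow> bool" where
  "FinTop X p \<longleftrightarrow>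
     (\<forall>n. second_countable (X n) \<and> locally_compact_space (X n) \<and>
          connected_space (X n) \<and> Hausdorff_space (X n)) \<and>
     (\<forall>m n. m < n \<longrightarrow> regular_covering (X n) (X m) (bond p m n) \<and>
                       finite_fold (X n) (X m) (bond p m n)) \<and>
     (\<forall>k l m. k < l \<and> l < m \<longrightarrow>
        (\<forall>g\<in>carrier (deck_group (X m) (bond p k m)).
           \<exists>!f. f \<in> carrier (deck_group (X l) (bond p k l)) \<and>
                (\<forall>x\<in>topspace (X m). f (bond p l m x) = bond p l m (g x))) \<and>
        short_exact_sequence
          (deck_group (X l) (bond p k l))
          (deck_group (X m) (bond p k m))
          (deck_group (X m) (bond p l m))
          (deck_descent (X m) (bond p l m) (X l) (bond p k l))
          (\<lambda>g. g))"

definition inverse_limit :: "(nat \<Rightarrow> 'a topology) \<Rightarrow> (nat \<Rightarrow> 'a \<Rightarrow> 'a) \<Rightarrow> (nat \<Rightarrow> 'a) topology" where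
  "inverse_limit X p =
     subtopology (product_topology X UNIV) {x. \<forall>n. p n (x (Suc n)) = x n}"

abbreviation (input) coord :: "nat \<Rightarrow> (nat \<Rightarrow> 'a) \<Rightarrow> 'a" where
  "coord n x \<equiv> x n"

definition covering_of_seq ::
  "(nat \<Rightarrow> 'a topology) \<Rightarrow> (nat \<Rightarrow> 'a \<Rightarrow> 'a) \<Rightarrow> 'y topology \<Rightarrow> (nat \<Rightarrow> 'y \<Rightarrow> 'a) \<Rightarrow> bool" where
  "covering_of_seq X p Y q \<longleftrightarrow>
     (\<forall>n. regular_covering Y (X n) (q n) \<and> q n ` topspace Y = topspace (X n) \<and>
          (\<forall>y\<in>topspace Y. p n (q (Suc n) y) = q n y))"

definition covering_morphism ::
  "'y topology \<Rightarrow> (nat \<Rightarrow> 'y \<Rightarrow> 'a) \<Rightarrow> 'z topology \<Rightarrow> (nat \<Rightarrow> 'z \<Rightarrow> 'a) \<Rightarrow> ('y \<Rightarrow> 'z) \<Rightarrow> bool" where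
  "covering_morphism Y q Z r f \<longleftrightarrow>
     covering_projection Y Z f \<and> (\<forall>n. \<forall>y\<in>topspace Y. r n (f y) = q n y)"

definition special_set :: "(nat \<Rightarrow> 'a topology) \<Rightarrow> (nat \<Rightarrow> 'a \<Rightarrow> 'a) \<Rightarrow> (nat \<Rightarrow> 'a) set \<Rightarrow> bool" where
  "special_set X p V \<longleftrightarrow>
     V \<subseteq> topspace (inverse_limit X p) \<and>
     evenly_covered (X 1) (X 0) (p 0) (coord 0 ` V) \<and>
     (\<forall>n. openin (X n) (coord n ` V) \<and> connectedin (X n) (coord n ` V) \<and> inj_on (coord n) V)"

text \<open>\<open>Xt\<close> is the limit of the covering sequence: the set \<open>inverse_limit X p\<close> with the topology
  that has the special sets as a base, and with its projections a final object among the coverings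
  of the sequence. Nothing here is automatic for an arbitrary finite covering sequence: for a tower
  over the Hawaiian earring the special sets need not even cover.

  The special sets are required to form a base and not just a subbase. On a locally connected base
  space the two readings agree; in general they differ. Finality is tested against spaces on the
  carrier type of \<open>Xt\<close> itself, since a formula cannot quantify over types.\<close>

definition top_inverse_limit ::
  "(nat \<Rightarrow> 'a topology) \<Rightarrow> (nat \<Rightarrow> 'a \<Rightarrow> 'a) \<Rightarrow> (nat \<Rightarrow> 'a) topology \<Rightarrow> bool" where
  "top_inverse_limit X p Xt \<longleftrightarrow>
     topspace Xt = topspace (inverse_limit X p) \<and>
     openin Xt = arbitrary union_of (special_set X p) \<and>
     covering_of_seq X p Xt coord \<and>
     (\<forall>(Y :: (nat \<Rightarrow> 'a) topology) q. covering_of_seq X p Y q \<longrightarrow>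
        (\<exists>f. covering_morphism Y q Xt coord f \<and>
             (\<forall>f'. covering_morphism Y q Xt coord f' \<longrightarrow> (\<forall>y\<in>topspace Y. f' y = f y))))"

definition limit_group :: "(nat \<Rightarrow> 'a topology) \<Rightarrow> (nat \<Rightarrow> 'a \<Rightarrow> 'a) \<Rightarrow> ((nat \<Rightarrow> 'a) \<Rightarrow> (nat \<Rightarrow> 'a)) monoid" where
  "limit_group X p = deck_group (inverse_limit X p) (coord 0)"

text \<open>\<open>limit_kernel X p n\<close> is \<open>J\<^sub>n\<close>, the kernel of the natural map
  \<open>h\<^sub>n : limit_group X p \<rightarrow> G(X n | X 0)\<close>.\<close>

definition limit_kernel :: "(nat \<Rightarrow> 'a topology) \<Rightarrow> (nat \<Rightarrow> 'a \<Rightarrow> 'a) \<Rightarrow> nat \<Rightarrow> ((nat \<Rightarrow> 'a) \<Rightarrow> (nat \<Rightarrow> 'a)) set" where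
  "limit_kernel X p n =
     kernel (limit_group X p) (deck_group (X n) (bond p 0 n))
       (deck_descent (inverse_limit X p) (coord n) (X n) (bond p 0 n))"


section \<open>Radon measures\<close>

text \<open>Inner regularity is imposed on every Borel set, so that the null sets are exactly the locally
  null sets and \<open>L\<^sup>\<infinity>\<close> acts faithfully on \<open>L\<^sup>2\<close> even when the space is not \<open>\<sigma>\<close>-compact.\<close>

definition radon_measure :: "'b topology \<Rightarrow> 'b measure \<Rightarrow> bool" where
  "radon_measure X \<mu> \<longleftrightarrow>
     space \<mu> = topspace X \<and> sets \<mu> = sigma_sets (topspace X) {U. openin X U} \<and>
     (\<forall>K. compactin X K \<longrightarrow> emeasure \<mu> K < \<infinity>) \<and>
     (\<forall>B\<in>sets \<mu>. emeasure \<mu> B = (SUP K \<in> {K. compactin X K \<and> K \<subseteq> B}. emeasure \<mu> K))"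

definition full_support :: "'b topology \<Rightarrow> 'b measure \<Rightarrow> bool" where
  "full_support X \<mu> \<longleftrightarrow> (\<forall>U. openin X U \<and> U \<noteq> {} \<longrightarrow> emeasure \<mu> U > 0)"

definition locally_lifted :: "'e topology \<Rightarrow> 'b topology \<Rightarrow> ('e \<Rightarrow> 'b) \<Rightarrow> 'b measure \<Rightarrow> 'e measure \<Rightarrow> bool" where
  "locally_lifted E B q \<nu> \<mu> \<longleftrightarrow>
     (\<forall>V. openin E V \<and> openin B (q ` V) \<and>
          homeomorphic_map (subtopology E V) (subtopology B (q ` V)) q \<longrightarrow>
        (\<forall>A\<in>sets \<mu>. A \<subseteq> V \<longrightarrow> emeasure \<mu> A = emeasure \<nu> (q ` A)))"


section \<open>Commutative C*-algebras of functions\<close>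

text \<open>The record of operations is non-unital, unlike the \<open>ring\<close> record of HOL-Algebra.\<close>

record 'b star_algebra = "'b partial_object" +
  plus_of :: "'b \<Rightarrow> 'b \<Rightarrow> 'b"
  times_of :: "'b \<Rightarrow> 'b \<Rightarrow> 'b"
  scale_of :: "complex \<Rightarrow> 'b \<Rightarrow> 'b"
  star_of :: "'b \<Rightarrow> 'b"
  norm_of :: "'b \<Rightarrow> real"

definition cstar_isomorphism :: "'b star_algebra \<Rightarrow> 'c star_algebra \<Rightarrow> ('b \<Rightarrow> 'c) \<Rightarrow> bool" where
  "cstar_isomorphism A B \<Phi> \<longleftrightarrow>
     bij_betw \<Phi> (carrier A) (carrier B) \<and>
     (\<forall>x\<in>carrier A. \<forall>y\<in>carrier A. \<Phi> (plus_of A x y) = plus_of B (\<Phi> x) (\<Phi> y)) \<and>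
     (\<forall>x\<in>carrier A. \<forall>y\<in>carrier A. \<Phi> (times_of A x y) = times_of B (\<Phi> x) (\<Phi> y)) \<and>
     (\<forall>c. \<forall>x\<in>carrier A. \<Phi> (scale_of A c x) = scale_of B c (\<Phi> x)) \<and>
     (\<forall>x\<in>carrier A. \<Phi> (star_of A x) = star_of B (\<Phi> x)) \<and>
     (\<forall>x\<in>carrier A. norm_of B (\<Phi> x) = norm_of A x)"

definition is_linear_subspace :: "'b star_algebra \<Rightarrow> 'b set \<Rightarrow> bool" where
  "is_linear_subspace A S \<longleftrightarrow>
     S \<subseteq> carrier A \<and> S \<noteq> {} \<and>
     (\<forall>x\<in>S. \<forall>y\<in>S. plus_of A x y \<in> S) \<and> (\<forall>c. \<forall>x\<in>S. scale_of A c x \<in> S)"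

definition is_subalgebra :: "'b star_algebra \<Rightarrow> 'b set \<Rightarrow> bool" where
  "is_subalgebra A S \<longleftrightarrow> is_linear_subspace A S \<and> (\<forall>x\<in>S. \<forall>y\<in>S. times_of A x y \<in> S)"

definition norm_closure :: "'b star_algebra \<Rightarrow> 'b set \<Rightarrow> 'b set" where
  "norm_closure A S =
     {x \<in> carrier A. \<forall>\<epsilon>>0. \<exists>y\<in>S. norm_of A (plus_of A x (scale_of A (-1) y)) < \<epsilon>}"

text \<open>Adding \<open>0\<close> only matters on the empty space.\<close>

definition sup_norm :: "'b topology \<Rightarrow> ('b \<Rightarrow> complex) \<Rightarrow> real" where
  "sup_norm X f = Sup (insert 0 ((\<lambda>x. norm (f x)) ` topspace X))"

definition C0 :: "'b topology \<Rightarrow> ('b \<Rightarrow> complex) star_algebra" where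
  "C0 X =
     \<lparr>carrier = {f \<in> extensional (topspace X). continuous_map X euclidean f \<and>
                   (\<forall>\<epsilon>>0. compactin X {x \<in> topspace X. \<epsilon> \<le> norm (f x)})},
      plus_of = \<lambda>f g. \<lambda>x\<in>topspace X. f x + g x,
      times_of = \<lambda>f g. \<lambda>x\<in>topspace X. f x * g x,
      scale_of = \<lambda>c f. \<lambda>x\<in>topspace X. c * f x,
      star_of = \<lambda>f. \<lambda>x\<in>topspace X. cnj (f x),
      norm_of = sup_norm X\<rparr>"

definition ess_bounded :: "'b measure \<Rightarrow> ('b \<Rightarrow> complex) set" where
  "ess_bounded M = {f \<in> borel_measurable M. \<exists>C. AE x in M. norm (f x) \<le> C}"

definition Linf_class :: "'b measure \<Rightarrow> ('b \<Rightarrow> complex) \<Rightarrow> ('b \<Rightarrow> complex) set" where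
  "Linf_class M f = {g \<in> ess_bounded M. AE x in M. g x = f x}"

definition Linf :: "'b measure \<Rightarrow> ('b \<Rightarrow> complex) set star_algebra" where
  "Linf M =
     \<lparr>carrier = Linf_class M ` ess_bounded M,
      plus_of = \<lambda>A B. \<Union>f\<in>A. \<Union>g\<in>B. Linf_class M (\<lambda>x. f x + g x),
      times_of = \<lambda>A B. \<Union>f\<in>A. \<Union>g\<in>B. Linf_class M (\<lambda>x. f x * g x),
      scale_of = \<lambda>c A. \<Union>f\<in>A. Linf_class M (\<lambda>x. c * f x),
      star_of = \<lambda>A. \<Union>f\<in>A. Linf_class M (\<lambda>x. cnj (f x)),
      norm_of = \<lambda>A. enn2real (esssup M (\<lambda>x. ennreal (norm ((SOME f. f \<in> A) x))))\<rparr>"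

text \<open>Convergence of \<open>\<Sum>g\<in>J. u g\<close> to \<open>s\<close>, as an unordered sum, in the strong operator topology
  of the multiplication operators on \<open>L\<^sup>2(M)\<close>. The index set is in general uncountable.\<close>

definition strongly_sums ::
  "'b measure \<Rightarrow> ('i \<Rightarrow> 'b \<Rightarrow> complex) \<Rightarrow> 'i set \<Rightarrow> ('b \<Rightarrow> complex) \<Rightarrow> bool" where
  "strongly_sums M u J s \<longleftrightarrow>
     (\<forall>\<xi> :: 'b \<Rightarrow> complex. \<xi> \<in> borel_measurable M \<and> integrable M (\<lambda>x. (norm (\<xi> x))\<^sup>2) \<longrightarrow>
        tendsto (\<lambda>F. \<integral>x. (norm ((\<Sum>g\<in>F. u g x) * \<xi> x - s x * \<xi> x))\<^sup>2 \<partial>M) 0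
          (finite_subsets_at_top J))"


section \<open>The inverse noncommutative limit\<close>

definition group_act ::
  "(nat \<Rightarrow> 'a topology) \<Rightarrow> (nat \<Rightarrow> 'a \<Rightarrow> 'a) \<Rightarrow> ((nat \<Rightarrow> 'a) \<Rightarrow> (nat \<Rightarrow> 'a)) \<Rightarrow>
     ((nat \<Rightarrow> 'a) \<Rightarrow> complex) \<Rightarrow> (nat \<Rightarrow> 'a) \<Rightarrow> complex" where
  "group_act X p g a x = a ((inv\<^bsub>limit_group X p\<^esub> g) x)"

text \<open>\<open>\<alpha> n\<close> and \<open>\<beta> n\<close> are the sums \<open>a\<^sub>n\<close> and \<open>b\<^sub>n\<close>; as elements of \<open>C\<^sub>0(X n)\<close> they are
  compared with functions on the limit space by pullback.\<close>

definition special_function ::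
  "(nat \<Rightarrow> 'a topology) \<Rightarrow> (nat \<Rightarrow> 'a \<Rightarrow> 'a) \<Rightarrow> (nat \<Rightarrow> 'a) measure \<Rightarrow> ((nat \<Rightarrow> 'a) \<Rightarrow> complex) \<Rightarrow> bool" where
  "special_function X p M a \<longleftrightarrow>
     a \<in> ess_bounded M \<and> (AE x in M. a x \<in> \<real>\<^sub>\<ge>\<^sub>0) \<and>
     (\<exists>\<alpha> \<beta>.
        (\<forall>n. \<alpha> n \<in> carrier (C0 (X n)) \<and> \<beta> n \<in> carrier (C0 (X n)) \<and>
             strongly_sums M (\<lambda>g. group_act X p g a) (limit_kernel X p n) (\<alpha> n \<circ> coord n) \<and>
             strongly_sums M (\<lambda>g. group_act X p g (\<lambda>x. (a x)\<^sup>2)) (limit_kernel X p n) (\<beta> n \<circ> coord n)) \<and>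
        (\<forall>\<epsilon>>0. \<exists>N. \<forall>n\<ge>N. sup_norm (X n) (\<lambda>x. (\<alpha> n x)\<^sup>2 - \<beta> n x) < \<epsilon>))"

definition special_elements ::
  "(nat \<Rightarrow> 'a topology) \<Rightarrow> (nat \<Rightarrow> 'a \<Rightarrow> 'a) \<Rightarrow> (nat \<Rightarrow> 'a) measure \<Rightarrow> ((nat \<Rightarrow> 'a) \<Rightarrow> complex) set set" where
  "special_elements X p M = Linf_class M ` {a. special_function X p M a}"

text \<open>Since \<open>L\<^sup>\<infinity>\<close> is complete, the completion of a subalgebra is its closure there.\<close>

definition nc_inverse_limit ::
  "(nat \<Rightarrow> 'a topology) \<Rightarrow> (nat \<Rightarrow> 'a \<Rightarrow> 'a) \<Rightarrow> (nat \<Rightarrow> 'a) measure \<Rightarrow> ((nat \<Rightarrow> 'a) \<Rightarrow> complex) set star_algebra" where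
  "nc_inverse_limit X p M = (Linf M)
     \<lparr>carrier := norm_closure (Linf M)
        (is_subalgebra (Linf M) hull (is_linear_subspace (Linf M) hull special_elements X p M))\<rparr>"

end

theory Submission
  imports Defs
begin

text \<open>
  Write \<open>G\<close> for the limit group and \<open>J n\<close> for the kernel of its action on \<open>X n\<close>.

  \<^bold>\<open>The group.\<close> Everything rests on \<open>J n\<close> acting freely and transitively on the fibres of \<open>Xt \<rightarrow> X n\<close>.
  Transitivity needs that a regular covering has a transitive deck group, while regularity is a statement
  about paths. The special sets make all the spaces locally connected, and a connected, locally connected,
  completely metrizable space is path-connected (\<open>connected_imp_path_connected\<close>). Applied to a component of
  the fibre product of a covering with itself, this shows that regularity makes the component the graph of a
  deck transformation (\<open>regular_covering_deck_transitive\<close>). By uniqueness of lifts the deck transformations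
  of the stages that match two given points of the limit are compatible and define an element of \<open>G\<close>.
  Conversely an element of \<open>G\<close> descends to every \<open>X n\<close>, since the inverse limit with the product topology is
  connected: each component of the finer space \<open>Xt\<close> is dense in it.

  \<^bold>\<open>Continuous functions are limits of special ones.\<close> Let \<open>r \<ge> 0\<close> be continuous with compact support in a
  special set \<open>V\<close>. The translates of \<open>V\<close> under \<open>J n\<close> are disjoint, so the sum of the translates of \<open>r\<close> is the
  function on \<open>X n\<close> corresponding to \<open>r\<close> on the image of \<open>V\<close>, and \<open>a\<^sub>n\<^sup>2 = b\<^sub>n\<close>. Hence \<open>r\<close> is special, and
  a partition of unity approximates every element of \<open>C\<^sub>0(Xt)\<close> by linear combinations of such functions
  (\<open>special_span_dense\<close>).

  \<^bold>\<open>Special elements are continuous.\<close> Let \<open>a\<close> be special, with sums \<open>a\<^sub>n\<close>. Near each point the strong sums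
  are almost everywhere sums over one countable set of group elements, so \<open>a\<^sub>n\<close> decreases to \<open>a\<close> almost
  everywhere. The cross terms in \<open>a\<^sub>n\<^sup>2 - b\<^sub>n\<close> give \<open>2 a\<^sub>m (a\<^sub>n - a\<^sub>m) \<le> \<parallel>a\<^sub>n\<^sup>2 - b\<^sub>n\<parallel>\<close> for \<open>m \<ge> n\<close>. As the
  measure has full support, this holds everywhere, and it says that \<open>a\<^sub>m\<close> is either close to \<open>0\<close> or close to
  \<open>a\<^sub>n\<close>. On a connected set on which \<open>a\<^sub>n\<close> is bounded away from \<open>0\<close>, one alternative holds throughout. Therefore the
  pointwise limit \<open>L\<close> of the \<open>a\<^sub>n\<close> is continuous. The same dichotomy on the sheets of \<open>Xt \<rightarrow> X n\<close>, together
  with \<open>L(x) + L(g x) \<le> a\<^sub>n(x)\<close> for \<open>g \<noteq> 1\<close> in \<open>J n\<close>, shows that \<open>{x. L(x) \<ge> \<eta>}\<close> meets at most one sheet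
  over a small open set, and so is compact because \<open>a\<^sub>n\<close> vanishes at infinity.

  Finally \<open>C\<^sub>0(Xt) \<rightarrow> L\<^sup>\<infinity>\<close> is isometric by full support, so its image is a closed subalgebra; it contains the
  special elements, and their span is dense in it (\<open>C0_isomorphism\<close>).
\<close>

section \<open>Metrizability and path-connectedness\<close>

text \<open>Urysohn's metrization theorem. For each pair of base sets \<open>U, V\<close> for which there is one, a function
  separating \<open>U\<close> from the complement of \<open>V\<close> is chosen; these countably many functions embed the space in
  a product of real lines.\<close>

lemma second_countable_imp_metrizable_space:
  assumes sc: "second_countable X" and cr: "completely_regular_space X" and H: "Hausdorff_space X"
  shows "metrizable_space X"
proof -
  obtain \<B> where "countable \<B>" and oB: "\<And>V. V \<in> \<B> \<Longrightarrow> openin X V"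
    and base: "\<And>U x. openin X U \<Longrightarrow> x \<in> U \<Longrightarrow> \<exists>V\<in>\<B>. x \<in> V \<and> V \<subseteq> U"
    using sc unfolding second_countable_def by metis
  define I where "I = {(U,V). U \<in> \<B> \<and> V \<in> \<B> \<and>
      (\<exists>f. continuous_map X euclideanreal f \<and> f ` U \<subseteq> {0} \<and> f ` (topspace X - V) \<subseteq> {1})}"
  have "countable I"
    by (rule countable_subset[of _ "\<B> \<times> \<B>"]) (auto simp: I_def \<open>countable \<B>\<close>)
  have "\<forall>i\<in>I. \<exists>f. continuous_map X euclideanreal f \<and> f ` fst i \<subseteq> {0} \<and> f ` (topspace X - snd i) \<subseteq> {1}"
    by (auto simp: I_def)
  then obtain h where h: "\<And>i. i \<in> I \<Longrightarrow> continuous_map X euclideanreal (h i)"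
    "\<And>i. i \<in> I \<Longrightarrow> h i ` fst i \<subseteq> {0}" "\<And>i. i \<in> I \<Longrightarrow> h i ` (topspace X - snd i) \<subseteq> {1}"
    by metis
  have sep: "\<exists>i\<in>I. h i x = 0 \<and> (\<forall>y\<in>topspace X - W. h i y = 1)"
    if W: "openin X W" "x \<in> W" for W x
  proof -
    obtain V where V: "V \<in> \<B>" "x \<in> V" "V \<subseteq> W"
      using base W by metis
    have "closedin X (topspace X - V)" "x \<in> topspace X - (topspace X - V)"
      using V oB openin_subset by blast+
    then obtain f where f: "continuous_map X (top_of_set {0..1}) f" "f x = 0" "f ` (topspace X - V) \<subseteq> {1::real}"
      using cr unfolding completely_regular_space_def by metis
    then have fc: "continuous_map X euclideanreal f"
      by (simp add: continuous_map_in_subtopology)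
    have "openin X {y \<in> topspace X. f y \<in> {..<1/2}}"
      using openin_continuous_map_preimage[OF fc, of "{..<1/2}"] by simp
    moreover have "x \<in> topspace X"
      using V oB openin_subset by blast
    ultimately obtain U where U: "U \<in> \<B>" "x \<in> U" "U \<subseteq> {y \<in> topspace X. f y \<in> {..<1/2}}"
      using base f(2) by (metis (mono_tags, lifting) mem_Collect_eq lessThan_iff half_gt_zero zero_less_one)
    have "continuous_map X euclideanreal (\<lambda>y. max 0 (2 * f y - 1))"
      using fc by (intro continuous_intros)
    moreover have "(\<lambda>y. max 0 (2 * f y - 1)) ` U \<subseteq> {0}"
      using U(3) by (auto simp: max_def subset_iff)
    moreover have "(\<lambda>y. max 0 (2 * f y - 1)) ` (topspace X - V) \<subseteq> {1}"
      using f(3) by auto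
    ultimately have "(U, V) \<in> I"
      using U V by (auto simp: I_def)
    then show ?thesis
      using h(2,3)[of "(U,V)"] U V by (intro bexI[of _ "(U,V)"]) (auto simp: image_subset_iff)
  qed
  define e where "e = (\<lambda>x. \<lambda>i\<in>I. h i x)"
  let ?P = "product_topology (\<lambda>i. euclideanreal) I"
  have "inj_on e (topspace X)"
  proof (rule inj_onI, rule ccontr)
    fix x y assume xy: "x \<in> topspace X" "y \<in> topspace X" "e x = e y" "x \<noteq> y"
    then have "openin X (topspace X - {y})"
      by (simp add: H closedin_Hausdorff_singleton openin_diff)
    then obtain i where "i \<in> I" "h i x = 0" "h i y = 1"
      using sep[of "topspace X - {y}" x] xy by auto
    with xy(3) show False
      unfolding e_def by (metis restrict_apply' zero_neq_one)
  qed
  then obtain e' where e': "\<And>x. x \<in> topspace X \<Longrightarrow> e' (e x) = x"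
    by (metis inv_into_f_f)
  have "continuous_map (subtopology ?P (e ` topspace X)) X e'"
  proof (clarsimp simp add: continuous_map_atin limitin_atin openin_subtopology_alt e')
    fix x U
    assume x: "x \<in> topspace X" and U: "openin X U" "x \<in> U"
    then obtain i where i: "i \<in> I" "h i x = 0" "\<forall>y\<in>topspace X - U. h i y = 1"
      using sep by blast
    let ?W = "PiE I (\<lambda>j. if j = i then {..<1} else UNIV) :: _ set"
    have "openin ?P ?W"
      by (auto simp: openin_PiE_gen)
    moreover have "e x \<in> ?W"
      using i(2) by (simp add: e_def PiE_iff)
    moreover have "e' ` (e ` topspace X \<inter> ?W - {e x}) \<subseteq> U"
    proof (rule image_subsetI)
      fix z assume "z \<in> e ` topspace X \<inter> ?W - {e x}"
      then obtain y where y: "y \<in> topspace X" "e y \<in> ?W" and z: "z = e y"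
        by blast
      have "e y i \<in> {..<1}"
        using PiE_mem[OF y(2) i(1)] by simp
      then have "h i y < 1"
        using i(1) by (simp add: e_def)
      then show "e' z \<in> U"
        using i(3) y(1) z by (metis DiffI e' less_irrefl)
    qed
    ultimately show "\<exists>W. openin ?P W \<and> e x \<in> W \<and> e' ` (e ` topspace X \<inter> W - {e x}) \<subseteq> U"
      by blast
  qed
  moreover have "continuous_map X ?P e"
    using h(1) by (auto simp: e_def continuous_map_componentwise)
  ultimately have "homeomorphic_maps X (subtopology ?P (e ` topspace X)) e e'"
    using e' by (auto simp add: homeomorphic_maps_def continuous_map_in_subtopology)
  then have "embedding_map X ?P e"
    unfolding embedding_map_def homeomorphic_map_maps by blast
  moreover have "countable {i \<in> I. \<not> (\<exists>a. topspace euclideanreal \<subseteq> {a})}"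
    by (rule countable_subset[OF _ \<open>countable I\<close>]) auto
  then have "metrizable_space ?P"
    unfolding metrizable_space_product_topology using metrizable_space_euclidean by blast
  ultimately show ?thesis
    by (meson embedding_map_imp_homeomorphic_space homeomorphic_metrizable_space metrizable_space_subtopology)
qed

corollary locally_compact_second_countable_imp_completely_metrizable_space:
  assumes "second_countable X" "locally_compact_space X" "Hausdorff_space X"
  shows "completely_metrizable_space X"
  using assms second_countable_imp_metrizable_space locally_compact_imp_completely_metrizable_space
    locally_compact_regular_imp_completely_regular_space by blast

text \<open>In a connected open subset of a locally connected metric space any two points are joined by a
  chain of points, consecutive ones lying in a common connected open set of small diameter.\<close>

lemma (in Metric_space) connected_chain:
  assumes lc: "locally_connected_space mtopology"
    and U: "openin mtopology U" "connectedin mtopology U" "a \<in> U" "b \<in> U" and "\<epsilon> > 0"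
  defines "link \<equiv> \<lambda>x y. \<exists>W. openin mtopology W \<and> connectedin mtopology W \<and> W \<subseteq> U \<and> x \<in> W \<and> y \<in> W \<and>
                (\<forall>u\<in>W. \<forall>v\<in>W. d u v \<le> \<epsilon>)"
  shows "link\<^sup>*\<^sup>* a b"
proof -
  have lk: "\<exists>W. openin mtopology W \<and> x \<in> W \<and> W \<subseteq> U \<and> (\<forall>y\<in>W. \<forall>z\<in>W. link y z)" if "x \<in> U" for x
  proof -
    have xM: "x \<in> M" using that U(1) openin_mtopology by blast
    have "openin mtopology (U \<inter> mball x (\<epsilon>/2))" "x \<in> U \<inter> mball x (\<epsilon>/2)"
      using U \<open>\<epsilon> > 0\<close> that xM by auto
    then obtain W where W: "openin mtopology W" "connectedin mtopology W" "x \<in> W" "W \<subseteq> U \<inter> mball x (\<epsilon>/2)"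
      using lc unfolding locally_connected_space by meson
    have "d u v \<le> \<epsilon>" if "u \<in> W" "v \<in> W" for u v
    proof -
      have "u \<in> M" "v \<in> M" "d x u < \<epsilon>/2" "d x v < \<epsilon>/2"
        using that W(4) by (auto simp: in_mball)
      then show ?thesis
        using triangle'[of u x v] xM by (smt (verit) commute field_sum_of_halves)
    qed
    then show ?thesis
      using W unfolding link_def by blast
  qed
  define A where "A = {x \<in> U. link\<^sup>*\<^sup>* a x}"
  have "openin mtopology A"
    unfolding openin_subopen[of mtopology A]
  proof (intro ballI)
    fix x assume "x \<in> A"
    then have "x \<in> U" "link\<^sup>*\<^sup>* a x" by (auto simp: A_def)
    then obtain W where W: "openin mtopology W" "x \<in> W" "W \<subseteq> U" "\<forall>y\<in>W. \<forall>z\<in>W. link y z"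
      using lk[OF \<open>x \<in> U\<close>] by blast
    then have "W \<subseteq> A"
      using \<open>link\<^sup>*\<^sup>* a x\<close> unfolding A_def
      by (metis (mono_tags, lifting) mem_Collect_eq rtranclp.rtrancl_into_rtrancl subset_iff)
    then show "\<exists>T. openin mtopology T \<and> x \<in> T \<and> T \<subseteq> A" using W by blast
  qed
  moreover have "openin mtopology (U - A)"
    unfolding openin_subopen[of mtopology "U - A"]
  proof (intro ballI)
    fix x assume x: "x \<in> U - A"
    then obtain W where W: "openin mtopology W" "x \<in> W" "W \<subseteq> U" "\<forall>y\<in>W. \<forall>z\<in>W. link y z"
      using lk[of x] by blast
    have "W \<inter> A = {}"
    proof (rule ccontr)
      assume "W \<inter> A \<noteq> {}"
      then obtain y where "y \<in> W" "link\<^sup>*\<^sup>* a y" by (auto simp: A_def)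
      then have "link\<^sup>*\<^sup>* a x" using W by (meson rtranclp.rtrancl_into_rtrancl)
      then show False using x by (auto simp: A_def)
    qed
    then show "\<exists>T. openin mtopology T \<and> x \<in> T \<and> T \<subseteq> U - A" using W by blast
  qed
  moreover have "a \<in> A" using U by (auto simp: A_def)
  moreover have "A \<subseteq> U" by (auto simp: A_def)
  ultimately have "\<exists>E1 E2. openin mtopology E1 \<and> openin mtopology E2 \<and> U \<subseteq> E1 \<union> E2 \<and>
      E1 \<inter> E2 \<inter> U = {} \<and> E1 \<inter> U \<noteq> {} \<and> E2 \<inter> U \<noteq> {}" if "U - A \<noteq> {}"
    using that U(3) by (intro exI[of _ A] exI[of _ "U - A"] conjI) auto
  then have "U - A = {}"
    using U(2) unfolding connectedin by blast
  then show ?thesis using U(4) by (auto simp: A_def)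
qed

lemma rtranclp_imp_chain:
  assumes "R\<^sup>*\<^sup>* x y" and "\<And>z. z = y \<Longrightarrow> R z z"
  obtains n e where "e 0 = x" "\<And>j. j \<ge> n \<Longrightarrow> e j = y" "\<And>j::nat. R (e j) (e (Suc j))"
proof -
  obtain n where "(R ^^ n) x y"
    using assms(1) rtranclp_imp_relpowp by fast
  then obtain f where f: "f 0 = x" "f n = y" "\<And>i. i < n \<Longrightarrow> R (f i) (f (Suc i))"
    unfolding relpowp_fun_conv by blast
  show thesis
    by (rule that[of "\<lambda>j. if j \<ge> n then y else f j" n]) (use f assms(2) in \<open>auto simp: not_less_eq_eq le_Suc_eq\<close>)
qed

text \<open>The path is the uniform limit of step functions \<open>t \<mapsto> c (\<lfloor>N t\<rfloor>)\<close>; consecutive values of \<open>c\<close> lie in a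
  common connected open set of small diameter, and the next step function is obtained by joining
  them by a finer chain inside that set. Padding makes all chains of one stage equally long.\<close>

theorem (in Metric_space) connected_imp_path_connected:
  assumes mc: "mcomplete" and lc: "locally_connected_space mtopology" and con: "connected_space mtopology"
  shows "path_connected_space mtopology"
  unfolding path_connected_space_def
proof (intro ballI)
  fix a b assume "a \<in> topspace mtopology" "b \<in> topspace mtopology"
  then have ab: "a \<in> M" "b \<in> M" by auto
  define link where "link = (\<lambda>k x y. \<exists>W. openin mtopology W \<and> connectedin mtopology W \<and> x \<in> W \<and> y \<in> W \<and>
                (\<forall>u\<in>W. \<forall>v\<in>W. d u v \<le> (1/2)^k))"
  have linkM: "x \<in> M" "y \<in> M" "d x y \<le> (1/2)^k" if "link k x y" for k x y
    using that openin_mtopology unfolding link_def by blast+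
  define P where "P = (\<lambda>k (N, c). N > (0::nat) \<and> c 0 = a \<and> (\<forall>j\<ge>N. c j = b) \<and> (\<forall>j. link k (c j) (c (Suc j))))"
  define Q where "Q = (\<lambda>k (N, c) (N', c'). \<exists>L>0::nat. N' = N * L \<and> (\<forall>m. d (c (m div L)) (c' m) \<le> (1/2)^k))"
  have ch: "\<exists>n e. e 0 = x \<and> (\<forall>j\<ge>n. e j = y) \<and> (\<forall>j::nat. link k (e j) (e (Suc j)) \<and> e j \<in> U)"
    if U: "openin mtopology U" "connectedin mtopology U" "x \<in> U" "y \<in> U" for U x y k
  proof -
    let ?R = "\<lambda>x y. \<exists>W. openin mtopology W \<and> connectedin mtopology W \<and> W \<subseteq> U \<and> x \<in> W \<and> y \<in> W \<and>
                (\<forall>u\<in>W. \<forall>v\<in>W. d u v \<le> (1/2)^k)"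
    have star: "?R\<^sup>*\<^sup>* u v" if "u \<in> U" "v \<in> U" for u v
      using connected_chain[OF lc U(1,2) that, of "(1/2)^k"] by simp
    have "?R y y"
    proof -
      have "y \<in> M" using U openin_mtopology by blast
      then have "openin mtopology (U \<inter> mball y ((1/2)^k/2))" "y \<in> U \<inter> mball y ((1/2)^k/2)"
        using U by auto
      then obtain W where W: "openin mtopology W" "connectedin mtopology W" "y \<in> W" "W \<subseteq> U \<inter> mball y ((1/2)^k/2)"
        using lc unfolding locally_connected_space by meson
      have "d u v \<le> (1/2)^k" if "u \<in> W" "v \<in> W" for u v
      proof -
        have "u \<in> M" "v \<in> M" "d y u < (1/2)^k/2" "d y v < (1/2)^k/2"
          using that W(4) by (auto simp: in_mball)
        then show ?thesis
          using triangle'[of u y v] \<open>y \<in> M\<close> by (smt (verit) commute field_sum_of_halves)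
      qed
      then show ?thesis using W by blast
    qed
    then obtain n e where e: "e 0 = x" "\<And>j. j \<ge> n \<Longrightarrow> e j = y" "\<And>j::nat. ?R (e j) (e (Suc j))"
      using rtranclp_imp_chain[OF star[OF U(3,4)]] by metis
    have "link k (e j) (e (Suc j))" "e j \<in> U" for j
      using e(3)[of j] unfolding link_def by blast+
    with e(1,2) show ?thesis by blast
  qed
  have "\<exists>g. \<forall>k. P k (g k) \<and> Q k (g k) (g (Suc k))"
  proof (rule dependent_nat_choice)
    have "openin mtopology M" "connectedin mtopology M"
      using con connectedin_topspace[of mtopology] openin_topspace[of mtopology] by simp_all
    then obtain n e where e: "e 0 = a" "\<forall>j\<ge>n. e j = b" "\<forall>j::nat. link 0 (e j) (e (Suc j)) \<and> e j \<in> M"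
      using ch[of M a b 0] ab by blast
    then have "P 0 (Suc n, e)"
      by (auto simp: P_def)
    then show "\<exists>x. P 0 x" ..
  next
    fix x k assume "P k x"
    obtain N c where x: "x = (N, c)" by force
    have N: "N > 0" "c 0 = a" "\<And>j. j \<ge> N \<Longrightarrow> c j = b" and lk: "\<And>j. link k (c j) (c (Suc j))"
      using \<open>P k x\<close> by (auto simp: P_def x)
    have "\<forall>j. \<exists>n e. e 0 = c j \<and> (\<forall>i\<ge>n. e i = c (Suc j)) \<and> 
        (\<forall>i::nat. link (Suc k) (e i) (e (Suc i)) \<and> d (c j) (e i) \<le> (1/2)^k)"
    proof
      fix j
      obtain W where W: "openin mtopology W" "connectedin mtopology W" "c j \<in> W" "c (Suc j) \<in> W"
        "\<forall>u\<in>W. \<forall>v\<in>W. d u v \<le> (1/2)^k"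
        using lk[of j] unfolding link_def by blast
      obtain n e where e: "e 0 = c j" "\<forall>i\<ge>n. e i = c (Suc j)"
        "\<forall>i::nat. link (Suc k) (e i) (e (Suc i)) \<and> e i \<in> W"
        using ch[OF W(1-4), of "Suc k"] by blast
      have "d (c j) (e i) \<le> (1/2)^k" for i
        using W(3,5) e(3) by blast
      then show "\<exists>n e. e 0 = c j \<and> (\<forall>i\<ge>n. e i = c (Suc j)) \<and> 
        (\<forall>i::nat. link (Suc k) (e i) (e (Suc i)) \<and> d (c j) (e i) \<le> (1/2)^k)"
        using e by blast
    qed
    then obtain n e where e: "\<And>j. e j 0 = c j" "\<And>j i. i \<ge> n j \<Longrightarrow> e j i = c (Suc j)"
       "\<And>j i::nat. link (Suc k) (e j i) (e j (Suc i))" "\<And>j i. d (c j) (e j i) \<le> (1/2)^k"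
      by metis
    define L where "L = Suc (Max (n ` {..N}))"
    have L: "n j \<le> L" if "j \<le> N" for j
      using that unfolding L_def by (simp add: le_SucI)
    have "L > 0" by (simp add: L_def)
    define c' where "c' = (\<lambda>m. if m \<ge> N * L then b else e (m div L) (m mod L))"
    have far: "c' m = e (m div L) (m mod L) \<or> (m div L \<ge> N \<and> c' m = b)" for m
      using \<open>L > 0\<close> by (auto simp: c'_def less_eq_div_iff_mult_less_eq)
    have bM: "link (Suc k) b b"
      using e(2)[of N "n N"] e(2)[of N "Suc (n N)"] e(3)[of N "n N"] N(3)[of "Suc N"] by simp
    have step: "link (Suc k) (c' m) (c' (Suc m))" for m
    proof (cases "m \<ge> N * L")
      case True
      then show ?thesis using bM by (simp add: c'_def)
    next
      case False
      then have m: "m div L < N"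
        using \<open>L > 0\<close> by (simp add: div_less_iff_less_mult)
      have "e (m div L) (Suc (m mod L)) = c' (Suc m)"
      proof (cases "Suc (m mod L) = L")
        case True
        then have *: "Suc m div L = Suc (m div L)" "Suc m mod L = 0"
          by (simp_all add: div_Suc mod_Suc)
        have 1: "e (m div L) (Suc (m mod L)) = c (Suc (m div L))"
          using e(2) L[of "m div L"] m True by simp
        show ?thesis
        proof (cases "Suc m \<ge> N * L")
          case True
          then have "Suc (m div L) \<ge> N"
            using *(1) \<open>L > 0\<close> by (metis less_eq_div_iff_mult_less_eq)
          then show ?thesis using 1 N(3) True by (simp add: c'_def)
        next
          case False
          then show ?thesis using 1 * e(1) by (simp add: c'_def)
        qed
      next
        case nL: False
        then have *: "Suc m div L = m div L" "Suc m mod L = Suc (m mod L)"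
          by (simp_all add: div_Suc mod_Suc)
        then have "Suc m < N * L"
          using m \<open>L > 0\<close> by (metis div_less_iff_less_mult)
        then show ?thesis using * by (simp add: c'_def)
      qed
      then show ?thesis
        using False e(3)[of "m div L" "m mod L"] by (simp add: c'_def)
    qed
    have "P (Suc k) (N * L, c')"
      using N(1,2) \<open>L > 0\<close> step e(1) by (auto simp: P_def c'_def)
    moreover have "d (c (m div L)) (c' m) \<le> (1/2)^k" for m
      using far[of m] e(4) N(3) linkM(1)[OF bM] by auto
    then have "Q k x (N * L, c')"
      using \<open>L > 0\<close> by (auto simp: Q_def x)
    ultimately show "\<exists>y. P (Suc k) y \<and> Q k x y" by blast
  qed
  then obtain g where g: "\<And>k. P k (g k)" "\<And>k. Q k (g k) (g (Suc k))" by blast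
  define N where "N k = fst (g k)" for k
  define c where "c k = snd (g k)" for k
  have N: "N k > 0" "c k 0 = a" "\<And>j. j \<ge> N k \<Longrightarrow> c k j = b" and lk: "\<And>j. link k (c k j) (c k (Suc j))" for k
    using g(1)[of k] by (auto simp: P_def N_def c_def split: prod.splits)
  define f where "f k t = c k (nat \<lfloor>real (N k) * t\<rfloor>)" for k t
  have fM: "f k t \<in> M" for k t
    using linkM(1)[OF lk] by (simp add: f_def)
  have fstep: "d (f k t) (f (Suc k) t) \<le> (1/2)^k" if "t \<ge> 0" for k t
  proof -
    obtain L where L: "L > 0" "N (Suc k) = N k * L" "\<And>m. d (c k (m div L)) (c (Suc k) m) \<le> (1/2)^k"
      using g(2)[of k] by (auto simp: Q_def N_def c_def split: prod.splits)
    have "nat \<lfloor>real (N k) * t\<rfloor> = nat \<lfloor>real (N (Suc k)) * t\<rfloor> div L"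
    proof -
      have "\<lfloor>real (N k) * t\<rfloor> = \<lfloor>real (N (Suc k)) * t / real L\<rfloor>"
        using L by simp
      also have "\<dots> = \<lfloor>real (N (Suc k)) * t\<rfloor> div int L"
        using floor_divide_real_eq_div[of "int L" "real (N (Suc k)) * t"] by simp
      finally show ?thesis
        using that by (simp add: nat_div_distrib)
    qed
    then show ?thesis
      using L(3) by (simp add: f_def)
  qed
  have ftail: "d (f k t) (f (k + n) t) \<le> 2 * (1/2)^k - 2 * (1/2)^(k+n)" if "t \<ge> 0" for k n t
  proof (induction n)
    case (Suc n)
    have "d (f k t) (f (k + Suc n) t) \<le> d (f k t) (f (k + n) t) + d (f (k + n) t) (f (Suc (k + n)) t)"
      using triangle fM by simp
    also have "\<dots> \<le> 2 * (1/2)^k - 2 * (1/2)^(k+n) + (1/2)^(k+n)"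
      using Suc fstep[OF that, of "k+n"] by linarith
    finally show ?case by simp
  qed (simp add: fM)
  have ftail': "d (f k t) (f m t) \<le> 2 * (1/2)^k" if "t \<ge> 0" "k \<le> m" for k m t
    using ftail[OF that(1), of k "m - k"] that(2) by (smt (verit) le_add_diff_inverse zero_le_power zero_le_divide_1_iff)
  have "\<exists>l. limitin mtopology (\<lambda>k. f k t) l sequentially" if "t \<ge> 0" for t
  proof -
    have "MCauchy (\<lambda>k. f k t)"
      unfolding MCauchy_def
    proof (intro conjI allI impI)
      fix \<epsilon> :: real assume "\<epsilon> > 0"
      then obtain K where K: "(1/2)^K < \<epsilon>/4"
        using real_arch_pow_inv[of "\<epsilon>/4" "1/2"] by auto
      have "d (f n t) (f n' t) < \<epsilon>" if "K \<le> n" "K \<le> n'" for n n'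
      proof -
        have "d (f n t) (f n' t) \<le> d (f K t) (f n t) + d (f K t) (f n' t)"
          using triangle''[of "f n t" "f K t" "f n' t"] fM commute by simp
        then show ?thesis
          using ftail'[OF \<open>t \<ge> 0\<close> that(1)] ftail'[OF \<open>t \<ge> 0\<close> that(2)] K by linarith
      qed
      then show "\<exists>K. \<forall>n n'. K \<le> n \<longrightarrow> K \<le> n' \<longrightarrow> d (f n t) (f n' t) < \<epsilon>" by blast
    qed (use fM in auto)
    then show ?thesis using mc unfolding mcomplete_def by blast
  qed
  then obtain \<gamma> where \<gamma>: "\<And>t. t \<ge> 0 \<Longrightarrow> limitin mtopology (\<lambda>k. f k t) (\<gamma> t) sequentially" by metis
  have \<gamma>M: "\<gamma> t \<in> M" if "t \<ge> 0" for t
    using \<gamma>[OF that] by (simp add: limitin_metric)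
  have near: "d (f k t) (\<gamma> t) \<le> 3 * (1/2)^k" if "t \<ge> 0" for k t
  proof -
    have "\<forall>\<^sub>F m in sequentially. f m t \<in> M \<and> d (f m t) (\<gamma> t) < (1/2)^k"
      using \<gamma>[OF that] unfolding limitin_metric by simp
    then obtain m where "m \<ge> k" "d (f m t) (\<gamma> t) < (1/2)^k"
      unfolding eventually_sequentially by (meson nle_le)
    then show ?thesis
      using ftail'[OF that, of k m] triangle[of "f k t" "f m t" "\<gamma> t"] fM \<gamma>M[OF that] by simp
  qed
  have lim_const: "\<gamma> t = z" if "t \<ge> 0" "\<And>k. f k t = z" for t z
  proof (rule limitin_metric_unique[OF \<gamma>[OF that(1)]])
    show "limitin mtopology (\<lambda>k. f k t) z sequentially"
      using that(2) fM[of 0 t] by simp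
  qed simp
  have "pathin mtopology \<gamma>"
    unfolding pathin_def
  proof -
    show "continuous_map (top_of_set {0..1}) mtopology \<gamma>"
      unfolding continuous_map_to_metric
    proof (intro ballI allI impI)
      fix s \<epsilon> :: real assume s: "s \<in> topspace (top_of_set {0..1::real})" and "\<epsilon> > 0"
      then obtain K where K: "(1/2)^K < \<epsilon>/8"
        using real_arch_pow_inv[of "\<epsilon>/8" "1/2"] by auto
      have *: "d (\<gamma> s) (\<gamma> t) < \<epsilon>" if t: "t \<ge> 0" "\<bar>t - s\<bar> < 1 / real (N K)" for t
      proof -
        have s0: "s \<ge> 0" using s by simp
        let ?i = "nat \<lfloor>real (N K) * s\<rfloor>" and ?j = "nat \<lfloor>real (N K) * t\<rfloor>"
        have "\<bar>real (N K) * t - real (N K) * s\<bar> < 1"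
        proof -
          have "\<bar>real (N K) * t - real (N K) * s\<bar> = real (N K) * \<bar>t - s\<bar>"
            by (simp add: right_diff_distrib[symmetric] abs_mult)
          then show ?thesis
            using t(2) N(1)[of K] by (simp add: field_simps)
        qed
        then have "\<bar>\<lfloor>real (N K) * s\<rfloor> - \<lfloor>real (N K) * t\<rfloor>\<bar> \<le> 1" by linarith
        then have "?j = ?i \<or> ?j = Suc ?i \<or> ?i = Suc ?j" by linarith
        then have "d (f K s) (f K t) \<le> (1/2)^K"
          using linkM(3)[OF lk] fM unfolding f_def by (metis commute linkM(1) lk mdist_zero zero_le_power zero_le_divide_1_iff zero_le_numeral)
        then have "d (\<gamma> s) (\<gamma> t) \<le> 7 * (1/2)^K"
          using near[OF s0, of K] near[OF t(1), of K] triangle''[of "\<gamma> s" "f K s" "\<gamma> t"]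
            triangle[of "f K s" "f K t" "\<gamma> t"] fM \<gamma>M[OF s0] \<gamma>M[OF t(1)] commute by simp
        then show ?thesis using K \<open>\<epsilon> > 0\<close> by linarith
      qed
      let ?V = "{0..1} \<inter> {s - 1 / real (N K) <..< s + 1 / real (N K)}"
      have "openin (top_of_set {0..1}) ?V" "s \<in> ?V"
        using s N(1)[of K] by (auto intro: openin_open_Int)
      moreover have "\<forall>y\<in>?V. \<gamma> y \<in> mball (\<gamma> s) \<epsilon>"
        using * s \<gamma>M by (auto simp: in_mball abs_less_iff)
      ultimately show "\<exists>U. openin (top_of_set {0..1}) U \<and> s \<in> U \<and> (\<forall>y\<in>U. \<gamma> y \<in> mball (\<gamma> s) \<epsilon>)" by blast
    qed
  qed
  moreover have "\<gamma> 0 = a" by (rule lim_const) (simp_all add: f_def N)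
  moreover have "\<gamma> 1 = b" by (rule lim_const) (simp_all add: f_def N)
  ultimately show "\<exists>g. pathin mtopology g \<and> g 0 = a \<and> g 1 = b" by blast
qed

corollary connected_locally_connected_imp_path_connected_space:
  assumes "completely_metrizable_space X" "locally_connected_space X" "connected_space X"
  shows "path_connected_space X"
  using assms Metric_space.connected_imp_path_connected unfolding completely_metrizable_space_def by metis

section \<open>Covering projections\<close>

lemma homeomorphic_map_open_subsets_iff:
  assumes "continuous_map E B p" "open_map E B p" "openin E V" "U \<subseteq> topspace B"
  shows "homeomorphic_map (subtopology E V) (subtopology B U) p \<longleftrightarrow> p ` V = U \<and> inj_on p V"
proof -
  have V: "topspace E \<inter> V = V" using openin_subset[OF assms(3)] by blast
  have U: "topspace B \<inter> U = U" using assms(4) by blast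
  show ?thesis
  proof
    assume "homeomorphic_map (subtopology E V) (subtopology B U) p"
    then show "p ` V = U \<and> inj_on p V"
      by (simp add: homeomorphic_eq_everything_map V U)
  next
    assume *: "p ` V = U \<and> inj_on p V"
    show "homeomorphic_map (subtopology E V) (subtopology B U) p"
    proof (rule bijective_open_imp_homeomorphic_map)
      show "continuous_map (subtopology E V) (subtopology B U) p"
        using assms(1) * by (auto simp: continuous_map_in_subtopology continuous_map_from_subtopology V)
      show "open_map (subtopology E V) (subtopology B U) p"
        using assms(2,3) * by (intro open_map_into_subtopology open_map_from_subtopology) (auto simp: V)
    qed (use * in \<open>simp_all add: V U\<close>)
  qed
qed

lemma covering_projection_continuous: "covering_projection E B p \<Longrightarrow> continuous_map E B p"
  by (simp add: covering_projection_def)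

lemma covering_projection_maps_to: "covering_projection E B p \<Longrightarrow> x \<in> topspace E \<Longrightarrow> p x \<in> topspace B"
  using continuous_map_image_subset_topspace covering_projection_continuous by blast

lemma covering_projection_open_map:
  assumes c: "covering_projection E B p"
  shows "open_map E B p"
  unfolding open_map_def
proof (intro allI impI)
  fix O' assume O': "openin E O'"
  show "openin B (p ` O')"
    unfolding openin_subopen[of B "p ` O'"]
  proof (rule ballI)
    fix y assume "y \<in> p ` O'"
    then obtain x where x: "x \<in> O'" "y = p x" by blast
    then have xE: "x \<in> topspace E" using openin_subset[OF O'] by blast
    obtain U where U: "openin B U" "y \<in> U" "evenly_covered E B p U"
      using c covering_projection_maps_to[OF c xE] x(2) unfolding covering_projection_def by meson
    then obtain V where V: "openin E V" "x \<in> V" "homeomorphic_map (subtopology E V) (subtopology B U) p"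
      using xE x(2) unfolding evenly_covered_def by blast
    have "openin (subtopology E V) (O' \<inter> V)"
      using O' V(1) by (simp add: openin_subtopology_Int)
    then have "openin (subtopology B U) (p ` (O' \<inter> V))"
      using homeomorphic_imp_open_map[OF V(3)] unfolding open_map_def by blast
    then have "openin B (p ` (O' \<inter> V))"
      using U(1) openin_trans_full by blast
    then show "\<exists>T. openin B T \<and> y \<in> T \<and> T \<subseteq> p ` O'"
      using x V(2) by (intro exI[of _ "p ` (O' \<inter> V)"]) auto
  qed
qed

text \<open>For an open set of the base, being evenly covered is a statement about sets only.\<close>

lemma evenly_covered_iff:
  assumes c: "continuous_map E B p" "open_map E B p" and U: "openin B U"
  shows "evenly_covered E B p U \<longleftrightarrow>
     (\<exists>\<V>. (\<forall>V\<in>\<V>. openin E V \<and> inj_on p V \<and> p ` V = U) \<and> pairwise disjnt \<V> \<and> \<Union>\<V> = {x \<in> topspace E. p x \<in> U})"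
  unfolding evenly_covered_def
proof (rule ex_cong1)
  fix \<V>
  have h: "homeomorphic_map (subtopology E V) (subtopology B U) p \<longleftrightarrow> p ` V = U \<and> inj_on p V" if "openin E V" for V
    by (rule homeomorphic_map_open_subsets_iff[OF c that openin_subset[OF U]])
  show "((\<forall>V\<in>\<V>. openin E V) \<and> pairwise disjnt \<V> \<and> \<Union>\<V> = {x \<in> topspace E. p x \<in> U} \<and>
      (\<forall>V\<in>\<V>. homeomorphic_map (subtopology E V) (subtopology B U) p)) \<longleftrightarrow>
      ((\<forall>V\<in>\<V>. openin E V \<and> inj_on p V \<and> p ` V = U) \<and> pairwise disjnt \<V> \<and> \<Union>\<V> = {x \<in> topspace E. p x \<in> U})"
    (is "?o \<and> ?d \<and> ?u \<and> ?h \<longleftrightarrow> ?i \<and> ?d \<and> ?u")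
  proof -
    have "?o \<and> ?h \<longleftrightarrow> ?i" using h by fast
    then show ?thesis by argo
  qed
qed

lemma evenly_covered_mono:
  assumes c: "covering_projection E B p" and U: "openin B U" "evenly_covered E B p U" and U': "openin B U'" "U' \<subseteq> U"
  shows "evenly_covered E B p U'"
proof -
  note co = covering_projection_continuous[OF c] covering_projection_open_map[OF c]
  obtain \<V> where \<V>: "\<And>V. V \<in> \<V> \<Longrightarrow> openin E V" "\<And>V. V \<in> \<V> \<Longrightarrow> inj_on p V" "\<And>V. V \<in> \<V> \<Longrightarrow> p ` V = U"
    "pairwise disjnt \<V>" "\<Union>\<V> = {x \<in> topspace E. p x \<in> U}"
    using U(2) unfolding evenly_covered_iff[OF co U(1)] by metis
  let ?f = "\<lambda>V. {x \<in> V. p x \<in> U'}"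
  have "openin E (?f V) \<and> inj_on p (?f V) \<and> p ` (?f V) = U'" if "V \<in> \<V>" for V
    using openin_continuous_map_preimage_gen[OF co(1) \<V>(1)[OF that] U'(1)] \<V>(2,3)[OF that] U'(2)
    by (auto intro: inj_on_subset)
  moreover have "pairwise disjnt (?f ` \<V>)"
    using \<V>(4) unfolding pairwise_def disjnt_def by blast
  moreover have "\<Union>(?f ` \<V>) = {x \<in> topspace E. p x \<in> U'}"
  proof -
    have "\<Union>(?f ` \<V>) = {x \<in> \<Union>\<V>. p x \<in> U'}" by blast
    then show ?thesis using \<V>(5) U'(2) by auto
  qed
  ultimately show ?thesis
    unfolding evenly_covered_iff[OF co U'(1)] by (intro exI[of _ "?f ` \<V>"]) blast
qed

lemma covering_sheets:
  assumes c: "covering_projection E B p" and lc: "locally_connected_space B" and y: "openin B W" "y \<in> W"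
  obtains U \<V> where "openin B U" "connectedin B U" "y \<in> U" "U \<subseteq> W"
    "\<forall>V\<in>\<V>. openin E V \<and> inj_on p V \<and> p ` V = U \<and> connectedin E V"
    "pairwise disjnt \<V>" "\<Union>\<V> = {x \<in> topspace E. p x \<in> U}"
proof -
  note co = covering_projection_continuous[OF c] covering_projection_open_map[OF c]
  have "y \<in> topspace B" using y openin_subset by blast
  then obtain U0 where U0: "openin B U0" "y \<in> U0" "evenly_covered E B p U0"
    using c unfolding covering_projection_def by meson
  have "openin B (U0 \<inter> W)" "y \<in> U0 \<inter> W" using U0 y by auto
  then obtain U where U: "openin B U" "connectedin B U" "y \<in> U" "U \<subseteq> U0 \<inter> W"
    using lc unfolding locally_connected_space by meson
  have "evenly_covered E B p U"
    using evenly_covered_mono[OF c U0(1,3) U(1)] U(4) by blast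
  then obtain \<V> where \<V>: "\<And>V. V \<in> \<V> \<Longrightarrow> openin E V" "\<And>V. V \<in> \<V> \<Longrightarrow> inj_on p V" "\<And>V. V \<in> \<V> \<Longrightarrow> p ` V = U"
    "pairwise disjnt \<V>" "\<Union>\<V> = {x \<in> topspace E. p x \<in> U}"
    unfolding evenly_covered_iff[OF co U(1)] by metis
  have "connectedin E V" if "V \<in> \<V>" for V
  proof -
    have V: "topspace E \<inter> V = V" and UB: "topspace B \<inter> U = U"
      using openin_subset[OF \<V>(1)[OF that]] openin_subset[OF U(1)] by blast+
    have "homeomorphic_map (subtopology E V) (subtopology B U) p"
      using homeomorphic_map_open_subsets_iff[OF co \<V>(1)[OF that] openin_subset[OF U(1)]] \<V>(2,3)[OF that] by simp
    then have "connected_space (subtopology E V)"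
      using homeomorphic_map_imp_homeomorphic_space homeomorphic_connected_space connectedin_def U(2) by metis
    then show ?thesis
      using V by (auto simp: connectedin_def)
  qed
  then show thesis
    using that[of U \<V>] U \<V> by simp
qed

lemma covering_sheet:
  assumes c: "covering_projection E B p" and lc: "locally_connected_space B" and W: "openin B W" and x: "x \<in> topspace E" "p x \<in> W"
  obtains U V where "openin B U" "connectedin B U" "U \<subseteq> W" "openin E V" "inj_on p V" "p ` V = U" "connectedin E V" "x \<in> V"
proof -
  obtain U \<V> where U: "openin B U" "connectedin B U" "p x \<in> U" "U \<subseteq> W"
    "\<forall>V\<in>\<V>. openin E V \<and> inj_on p V \<and> p ` V = U \<and> connectedin E V"
    "pairwise disjnt \<V>" "\<Union>\<V> = {x \<in> topspace E. p x \<in> U}"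
    by (rule covering_sheets[OF c lc W x(2)])
  have "x \<in> \<Union>\<V>" unfolding U(7) using x(1) U(3) by simp
  then obtain V where "V \<in> \<V>" "x \<in> V" by blast
  then show thesis using that[of U V] U by simp
qed

lemma covering_locally_connected_space:
  assumes c: "covering_projection E B p" and lc: "locally_connected_space B"
  shows "locally_connected_space E"
  unfolding locally_connected_space
proof (intro allI impI)
  fix W x assume W: "openin E W \<and> x \<in> W"
  note co = covering_projection_continuous[OF c] covering_projection_open_map[OF c]
  have xE: "x \<in> topspace E" using W openin_subset by blast
  obtain U V where U: "openin B U" "connectedin B U" "openin E V" "inj_on p V" "p ` V = U" "x \<in> V"
    using covering_sheet[OF c lc openin_topspace xE covering_projection_maps_to[OF c xE]] by metis
  have o: "openin E (V \<inter> W)" "openin B (p ` (V \<inter> W))"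
    using U W co(2) unfolding open_map_def by auto
  have "p x \<in> p ` (V \<inter> W)" using U(6) W by blast
  then obtain U' where U': "openin B U'" "connectedin B U'" "p x \<in> U'" "U' \<subseteq> p ` (V \<inter> W)"
    using lc o(2) unfolding locally_connected_space by meson
  let ?V = "{z \<in> V \<inter> W. p z \<in> U'}"
  have V': "openin E ?V"
    using openin_continuous_map_preimage_gen[OF co(1) o(1) U'(1)] .
  have "p ` ?V = U'" using U'(4) by blast
  moreover have "inj_on p ?V" using U(4) by (rule inj_on_subset) auto
  ultimately have "homeomorphic_map (subtopology E ?V) (subtopology B U') p"
    using homeomorphic_map_open_subsets_iff[OF co V' openin_subset[OF U'(1)]] by simp
  then have "connected_space (subtopology E ?V)"
    using homeomorphic_map_imp_homeomorphic_space homeomorphic_connected_space connectedin_def U'(2) by metis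
  then have "connectedin E ?V"
    using openin_subset[OF V'] by (simp add: connectedin_def)
  then show "\<exists>U. openin E U \<and> connectedin E U \<and> x \<in> U \<and> U \<subseteq> W"
    using V' W U(6) U'(3) by (intro exI[of _ ?V]) auto
qed

lemma covering_lift_unique:
  assumes Z: "connected_space Z" and f: "continuous_map Z E f" and h: "continuous_map Z E h"
    and c: "covering_projection E B p" and eq: "\<And>z. z \<in> topspace Z \<Longrightarrow> p (f z) = p (h z)"
    and z0: "z0 \<in> topspace Z" "f z0 = h z0" and z: "z \<in> topspace Z"
  shows "f z = h z"
proof -
  note co = covering_projection_continuous[OF c] covering_projection_open_map[OF c]
  let ?A = "{z \<in> topspace Z. f z = h z}"
  have key: "\<exists>V V'. openin E V \<and> openin E V' \<and> f z \<in> V \<and> h z \<in> V' \<and> (V = V' \<or> disjnt V V') \<and> inj_on p V"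
    if z: "z \<in> topspace Z" for z
  proof -
    have fh: "f z \<in> topspace E" "h z \<in> topspace E"
      using f h z continuous_map_image_subset_topspace by blast+
    obtain U where U: "openin B U" "p (f z) \<in> U" "evenly_covered E B p U"
      using c covering_projection_maps_to[OF c fh(1)] unfolding covering_projection_def by meson
    obtain \<V> where \<V>: "\<And>V. V \<in> \<V> \<Longrightarrow> openin E V" "\<And>V. V \<in> \<V> \<Longrightarrow> inj_on p V" 
      "pairwise disjnt \<V>" "\<Union>\<V> = {x \<in> topspace E. p x \<in> U}"
      using U(3) unfolding evenly_covered_iff[OF co U(1)] by metis
    have "f z \<in> \<Union>\<V>" "h z \<in> \<Union>\<V>" unfolding \<V>(4) using fh U(2) eq[OF z] by auto
    then obtain V V' where "V \<in> \<V>" "V' \<in> \<V>" "f z \<in> V" "h z \<in> V'" by blast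
    then show ?thesis using \<V>(1,2,3) unfolding pairwise_def by metis
  qed
  have "openin Z ?A"
    unfolding openin_subopen[of Z ?A]
  proof (rule ballI)
    fix z assume z: "z \<in> ?A"
    obtain V V' where V: "openin E V" "openin E V'" "f z \<in> V" "h z \<in> V'" "V = V' \<or> disjnt V V'" "inj_on p V"
      using key[of z] z by blast
    then have "V = V'" using z by (auto simp: disjnt_iff)
    let ?T = "{w \<in> topspace Z. f w \<in> V} \<inter> {w \<in> topspace Z. h w \<in> V}"
    have "openin Z ?T"
      using openin_continuous_map_preimage[OF f V(1)] openin_continuous_map_preimage[OF h V(1)] by blast
    moreover have "?T \<subseteq> ?A" using V(6) eq by (auto simp: inj_on_def)
    ultimately show "\<exists>T. openin Z T \<and> z \<in> T \<and> T \<subseteq> ?A"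
      using z V \<open>V = V'\<close> by (intro exI[of _ ?T]) simp
  qed
  moreover have "openin Z (topspace Z - ?A)"
    unfolding openin_subopen[of Z "topspace Z - ?A"]
  proof (rule ballI)
    fix z assume z: "z \<in> topspace Z - ?A"
    obtain V V' where V: "openin E V" "openin E V'" "f z \<in> V" "h z \<in> V'" "V = V' \<or> disjnt V V'" "inj_on p V"
      using key[of z] z by blast
    then have "disjnt V V'" using z eq[of z] by (auto simp: inj_on_def)
    let ?T = "{w \<in> topspace Z. f w \<in> V} \<inter> {w \<in> topspace Z. h w \<in> V'}"
    have "openin Z ?T"
      using openin_continuous_map_preimage[OF f V(1)] openin_continuous_map_preimage[OF h V(2)] by blast
    moreover have "?T \<subseteq> topspace Z - ?A" using \<open>disjnt V V'\<close> by (auto simp: disjnt_iff)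
    ultimately show "\<exists>T. openin Z T \<and> z \<in> T \<and> T \<subseteq> topspace Z - ?A"
      using z V by (intro exI[of _ ?T]) simp
  qed
  then have "closedin Z ?A" by (simp add: closedin_def)
  ultimately have "?A = {} \<or> ?A = topspace Z"
    using Z unfolding connected_space_clopen_in by blast
  then show ?thesis using z0 z by blast
qed

text \<open>The image of a component is open. Its complement is open too, since a connected sheet that meets the
  component lies in it, and with it the component covers the whole set under the sheet.\<close>

lemma covering_component_surj:
  assumes c: "covering_projection E B p" and lc: "locally_connected_space B" and con: "connected_space B"
    and x: "x \<in> topspace E"
  shows "p ` (connected_component_of_set E x) = topspace B"
proof -
  let ?C = "connected_component_of_set E x"
  have "openin E ?C"
    using openin_connected_component_of_locally_connected_space[OF covering_locally_connected_space[OF c lc]] .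
  then have 1: "openin B (p ` ?C)"
    using covering_projection_open_map[OF c] unfolding open_map_def by blast
  have "openin B (topspace B - p ` ?C)"
    unfolding openin_subopen[of B "topspace B - p ` ?C"]
  proof (rule ballI)
    fix y assume y: "y \<in> topspace B - p ` ?C"
    then have yB: "y \<in> topspace B" by simp
    obtain U \<V> where U: "openin B U" "connectedin B U" "y \<in> U" "U \<subseteq> topspace B"
      "\<forall>V\<in>\<V>. openin E V \<and> inj_on p V \<and> p ` V = U \<and> connectedin E V"
      "pairwise disjnt \<V>" "\<Union>\<V> = {x \<in> topspace E. p x \<in> U}"
      by (rule covering_sheets[OF c lc openin_topspace yB])
    have "U \<inter> p ` ?C = {}"
    proof (rule ccontr)
      assume "U \<inter> p ` ?C \<noteq> {}"
      then obtain z where z: "z \<in> ?C" "p z \<in> U" by blast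
      then have "z \<in> \<Union>\<V>" unfolding U(7) using connected_component_of_subset_topspace by fastforce
      then obtain V where V: "V \<in> \<V>" "z \<in> V" by blast
      have "V \<subseteq> connected_component_of_set E z"
        using connected_component_of_maximal V U(5) by metis
      also have "\<dots> = ?C"
        using z(1) by (metis connected_component_of_equiv mem_Collect_eq)
      finally show False using U(3,5) V(1) y by blast
    qed
    then show "\<exists>T. openin B T \<and> y \<in> T \<and> T \<subseteq> topspace B - p ` ?C"
      using U(1,3,4) by blast
  qed
  then have "closedin B (p ` ?C)"
    using 1 openin_subset by (simp add: closedin_def)
  then have "p ` ?C = {} \<or> p ` ?C = topspace B"
    using 1 con unfolding connected_space_clopen_in by blast
  moreover have "x \<in> ?C" using x by (simp add: connected_component_of_refl)
  ultimately show ?thesis by blast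
qed

text \<open>The pairs on which \<open>f\<close> and \<open>p\<close> agree, with the topology of a subspace of the product.\<close>

definition fibre_product :: "'z topology \<Rightarrow> 'e topology \<Rightarrow> ('z \<Rightarrow> 'b) \<Rightarrow> ('e \<Rightarrow> 'b) \<Rightarrow> ('z \<times> 'e) topology" where
  "fibre_product Z E f p = subtopology (prod_topology Z E) {w. f (fst w) = p (snd w)}"

lemma topspace_fibre_product:
  "topspace (fibre_product Z E f p) = {w \<in> topspace Z \<times> topspace E. f (fst w) = p (snd w)}"
  by (auto simp: fibre_product_def)

lemma continuous_map_fibre_product:
  "continuous_map (fibre_product Z E f p) Z fst" "continuous_map (fibre_product Z E f p) E snd"
  by (auto simp: fibre_product_def continuous_map_from_subtopology continuous_map_fst continuous_map_snd)

lemma covering_projection_fibre_product: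
  assumes c: "covering_projection E B p" and f: "continuous_map Z B f"
  shows "covering_projection (fibre_product Z E f p) Z fst"
proof -
  let ?P = "fibre_product Z E f p"
  note co = covering_projection_continuous[OF c] covering_projection_open_map[OF c]
  note cP = continuous_map_fibre_product[of Z E f p]
  have sh: "homeomorphic_map (subtopology ?P {w \<in> topspace ?P. snd w \<in> V}) (subtopology Z {z \<in> topspace Z. f z \<in> U}) fst"
    if U: "openin B U" and V: "openin E V \<and> inj_on p V \<and> p ` V = U" for U V
  proof -
    let ?U = "{z \<in> topspace Z. f z \<in> U}"
    let ?V = "{w \<in> topspace ?P. snd w \<in> V}"
    have VE: "V \<subseteq> topspace E" using V openin_subset by blast
    define s where "s = inv_into V p"
    have s: "s y \<in> V" "p (s y) = y" if "y \<in> U" for y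
      using V that by (auto simp: s_def inv_into_into f_inv_into_f)
    have s': "s (p v) = v" if "v \<in> V" for v
      using V that by (simp add: s_def)
    have "homeomorphic_map (subtopology E V) (subtopology B U) p"
      using homeomorphic_map_open_subsets_iff[OF co _ openin_subset[OF U]] V by blast
    then obtain r where r: "homeomorphic_maps (subtopology E V) (subtopology B U) p r"
      unfolding homeomorphic_map_maps by blast
    have rs: "r y = s y" if "y \<in> U" for y
    proof -
      have "p (r y) = y" "r y \<in> V"
        using r that openin_subset[OF U] by (auto simp: homeomorphic_maps_def continuous_map_in_subtopology Pi_iff)
      then show ?thesis using s' by metis
    qed
    have "continuous_map (subtopology B U) (subtopology E V) r"
      using r by (simp add: homeomorphic_maps_def)
    then have "continuous_map (subtopology B U) E s"
      by (rule continuous_map_eq[OF continuous_map_into_fulltopology]) (simp add: rs)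
    moreover have "continuous_map (subtopology Z ?U) (subtopology B U) f"
      using f by (auto simp: continuous_map_in_subtopology continuous_map_from_subtopology)
    ultimately have "continuous_map (subtopology Z ?U) E (s \<circ> f)"
      by (rule continuous_map_compose[rotated])
    then have "continuous_map (subtopology Z ?U) (prod_topology Z E) (\<lambda>z. (z, (s \<circ> f) z))"
      by (simp add: continuous_map_pairwise o_def continuous_map_from_subtopology)
    then have "continuous_map (subtopology Z ?U) (subtopology ?P ?V) (\<lambda>z. (z, (s \<circ> f) z))"
      using s VE by (auto simp: continuous_map_in_subtopology fibre_product_def)
    moreover have "continuous_map (subtopology ?P ?V) (subtopology Z ?U) fst"
      using cP V by (auto simp: continuous_map_in_subtopology continuous_map_from_subtopology topspace_fibre_product)
    ultimately have "homeomorphic_maps (subtopology ?P ?V) (subtopology Z ?U) fst (\<lambda>z. (z, (s \<circ> f) z))"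
      by (auto simp: homeomorphic_maps_def topspace_fibre_product s')
    then show "homeomorphic_map (subtopology ?P ?V) (subtopology Z ?U) fst"
      using homeomorphic_map_maps by blast
  qed
  show ?thesis
    unfolding covering_projection_def
  proof (intro conjI ballI cP(1))
    fix z assume z: "z \<in> topspace Z"
    then have "f z \<in> topspace B" using f continuous_map_image_subset_topspace by blast
    then obtain U where U: "openin B U" "f z \<in> U" "evenly_covered E B p U"
      using c unfolding covering_projection_def by meson
    obtain \<V> where \<V>: "\<And>V. V \<in> \<V> \<Longrightarrow> openin E V \<and> inj_on p V \<and> p ` V = U"
      "pairwise disjnt \<V>" "\<Union>\<V> = {x \<in> topspace E. p x \<in> U}"
      using U(3) unfolding evenly_covered_iff[OF co U(1)] by metis
    let ?g = "\<lambda>V. {w \<in> topspace ?P. snd w \<in> V}"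
    have "evenly_covered ?P Z fst {z \<in> topspace Z. f z \<in> U}"
      unfolding evenly_covered_def
    proof (intro exI[of _ "?g ` \<V>"] conjI)
      show "\<forall>V\<in>?g ` \<V>. openin ?P V"
        using openin_continuous_map_preimage[OF cP(2)] \<V>(1) by blast
      show "pairwise disjnt (?g ` \<V>)"
        using \<V>(2) unfolding pairwise_def disjnt_def by blast
      show "\<Union>(?g ` \<V>) = {x \<in> topspace ?P. fst x \<in> {z \<in> topspace Z. f z \<in> U}}"
      proof (rule Set.set_eqI)
        fix w
        have "w \<in> \<Union>(?g ` \<V>) \<longleftrightarrow> w \<in> topspace ?P \<and> snd w \<in> \<Union>\<V>" by blast
        also have "\<dots> \<longleftrightarrow> w \<in> topspace ?P \<and> snd w \<in> topspace E \<and> p (snd w) \<in> U"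
          unfolding \<V>(3) by simp
        also have "\<dots> \<longleftrightarrow> w \<in> {x \<in> topspace ?P. fst x \<in> {z \<in> topspace Z. f z \<in> U}}"
          unfolding topspace_fibre_product by auto
        finally show "w \<in> \<Union>(?g ` \<V>) \<longleftrightarrow> w \<in> {x \<in> topspace ?P. fst x \<in> {z \<in> topspace Z. f z \<in> U}}" .
      qed
      show "\<forall>V\<in>?g ` \<V>. homeomorphic_map (subtopology ?P V) (subtopology Z {z \<in> topspace Z. f z \<in> U}) fst"
        by (intro ballI, elim imageE) (simp only: sh[OF U(1) \<V>(1)])
    qed
    then show "\<exists>U. openin Z U \<and> z \<in> U \<and> evenly_covered ?P Z fst U"
      using openin_continuous_map_preimage[OF f U(1)] z U(2)
      by (intro exI[of _ "{z \<in> topspace Z. f z \<in> U}"]) simp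
  qed
qed

section \<open>Deck transformations\<close>

lemma deck_group_carrier:
  "f \<in> carrier (deck_group E p) \<longleftrightarrow>
     f \<in> Bij (topspace E) \<and> homeomorphic_map E E f \<and> (\<forall>x\<in>topspace E. p (f x) = p x)"
  by (simp add: deck_group_def)

lemma restrict_deck_group:
  assumes "continuous_map E E f" "continuous_map E E g" "\<And>x. x \<in> topspace E \<Longrightarrow> g (f x) = x"
    "\<And>x. x \<in> topspace E \<Longrightarrow> f (g x) = x" "\<And>x. x \<in> topspace E \<Longrightarrow> p (f x) = p x"
  shows "restrict f (topspace E) \<in> carrier (deck_group E p)"
proof -
  have "homeomorphic_maps E E f g"
    using assms by (simp add: homeomorphic_maps_def)
  then have "homeomorphic_map E E f"
    using homeomorphic_map_maps by blast
  then have h: "homeomorphic_map E E (restrict f (topspace E))"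
    by (rule homeomorphic_map_eq) simp
  then have "bij_betw (restrict f (topspace E)) (topspace E) (topspace E)"
    unfolding homeomorphic_eq_everything_map bij_betw_def by blast
  then show ?thesis
    using h assms(5) by (simp add: deck_group_carrier Bij_def)
qed

text \<open>The map is read off the component of \<open>(x, x')\<close> in the fibre product of the covering with itself, which
  is the graph of a function on all of \<open>E\<close>.\<close>

lemma regular_covering_lift:
  assumes reg: "regular_covering E B p" and con: "connected_space E" and lc: "locally_connected_space E"
    and cm: "completely_metrizable_space E" and H: "Hausdorff_space B"
    and x: "x \<in> topspace E" "x' \<in> topspace E" "p x = p x'"
  obtains f where "continuous_map E E f" "\<And>y. y \<in> topspace E \<Longrightarrow> p (f y) = p y" "f x = x'"
proof -
  let ?P = "fibre_product E E p p"
  have c: "covering_projection E B p" using reg by (simp add: regular_covering_def)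
  note pc = covering_projection_continuous[OF c]
  note cP = continuous_map_fibre_product[of E E p p]
  have cov: "covering_projection ?P E fst"
    using covering_projection_fibre_product[OF c pc] .
  let ?C = "connected_component_of_set ?P (x, x')"
  have xP: "(x, x') \<in> topspace ?P" using x by (simp add: topspace_fibre_product)
  have surj: "fst ` ?C = topspace E"
    using covering_component_surj[OF cov lc con xP] .
  have lcP: "locally_connected_space ?P"
    using covering_locally_connected_space[OF cov lc] .
  then have oC: "openin ?P ?C"
    by (rule openin_connected_component_of_locally_connected_space)
  have CP: "?C \<subseteq> topspace ?P" using connected_component_of_subset_topspace by fast
  have closedP: "?P = subtopology (prod_topology E E) {w \<in> topspace (prod_topology E E). p (fst w) = p (snd w)}"
    using subtopology_restrict[of "prod_topology E E" "{w. p (fst w) = p (snd w)}"]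
    by (simp add: fibre_product_def Int_def)
  have pcs: "continuous_map (prod_topology E E) B (\<lambda>w. p (fst w))" "continuous_map (prod_topology E E) B (\<lambda>w. p (snd w))"
    using continuous_map_compose[OF continuous_map_fst pc] continuous_map_compose[OF continuous_map_snd pc] by (auto simp: o_def)
  have "completely_metrizable_space ?P"
    unfolding closedP using cm closedin_continuous_maps_eq[OF H pcs]
    by (intro completely_metrizable_space_closedin) (auto simp: completely_metrizable_space_prod_topology)
  then have "completely_metrizable_space (subtopology ?P ?C)"
    by (rule completely_metrizable_space_closedin[OF _ closedin_connected_component_of])
  moreover have "locally_connected_space (subtopology ?P ?C)"
    using locally_connected_space_open_subset[OF lcP oC] .
  moreover have "connected_space (subtopology ?P ?C)"
    using connectedin_connected_component_of[of ?P "(x, x')"] by (simp add: connectedin_def)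
  ultimately have pathC: "path_connected_space (subtopology ?P ?C)"
    by (rule connected_locally_connected_imp_path_connected_space)
  \<comment> \<open>A path in the component joining two points over the same \<open>y\<close> consists of two liftings of one
    closed path, the first of which is closed.\<close>
  have inj: "z = z'" if yz: "(y, z) \<in> ?C" "(y, z') \<in> ?C" for y z z'
  proof -
    obtain \<gamma> where \<gamma>: "pathin (subtopology ?P ?C) \<gamma>" "\<gamma> 0 = (y, z)" "\<gamma> 1 = (y, z')"
      using pathC[unfolded path_connected_space_def topspace_subtopology_subset[OF CP], rule_format, OF yz] by (elim exE conjE)
    then have \<gamma>P: "pathin ?P \<gamma>" and \<gamma>im: "\<And>t. t \<in> {0..1} \<Longrightarrow> \<gamma> t \<in> topspace ?P"
      using CP by (auto simp: pathin_subtopology)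
    have p1: "pathin E (fst \<circ> \<gamma>)" "pathin E (snd \<circ> \<gamma>)"
      using pathin_compose[OF \<gamma>P] cP by blast+
    then have w: "pathin B (p \<circ> (fst \<circ> \<gamma>))" using pathin_compose pc by blast
    have "path_lifting E p (p \<circ> (fst \<circ> \<gamma>)) (fst \<circ> \<gamma>)" "path_lifting E p (p \<circ> (fst \<circ> \<gamma>)) (snd \<circ> \<gamma>)"
      using p1 \<gamma>im by (auto simp: path_lifting_def topspace_fibre_product)
    moreover have "(p \<circ> (fst \<circ> \<gamma>)) 0 = (p \<circ> (fst \<circ> \<gamma>)) 1" "(fst \<circ> \<gamma>) 0 = (fst \<circ> \<gamma>) 1"
      by (simp_all add: \<gamma>)
    ultimately have "(snd \<circ> \<gamma>) 0 = (snd \<circ> \<gamma>) 1"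
      using reg w unfolding regular_covering_def by blast
    then show ?thesis by (simp add: \<gamma>)
  qed
  have "homeomorphic_map (subtopology ?P ?C) (subtopology E (topspace E)) fst"
    unfolding homeomorphic_map_open_subsets_iff[OF cP(1) covering_projection_open_map[OF cov] oC order_refl]
    using surj inj by (auto simp: inj_on_def)
  then obtain s where s: "homeomorphic_maps (subtopology ?P ?C) E fst s"
    unfolding homeomorphic_map_maps subtopology_topspace by blast
  have sC: "s y \<in> ?C" "fst (s y) = y" if "y \<in> topspace E" for y
    using s that unfolding homeomorphic_maps_def continuous_map_in_subtopology by auto
  have "continuous_map E ?P s"
    using s unfolding homeomorphic_maps_def continuous_map_in_subtopology by blast
  then have "continuous_map E E (snd \<circ> s)"
    using cP(2) by (rule continuous_map_compose)
  moreover have "p ((snd \<circ> s) y) = p y" if "y \<in> topspace E" for y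
    using sC[OF that] CP by (force simp: topspace_fibre_product)
  moreover have "(snd \<circ> s) x = x'"
  proof -
    have "(x, x') \<in> ?C" using xP by (simp add: connected_component_of_refl)
    then show ?thesis using inj[of x "snd (s x)" x'] sC[OF x(1)] by (metis comp_apply prod.collapse)
  qed
  ultimately show thesis using that by blast
qed

theorem regular_covering_deck_transitive:
  assumes reg: "regular_covering E B p" and con: "connected_space E" and lc: "locally_connected_space E"
    and cm: "completely_metrizable_space E" and H: "Hausdorff_space B"
    and x: "x \<in> topspace E" "x' \<in> topspace E" "p x = p x'"
  obtains f where "f \<in> carrier (deck_group E p)" "f x = x'"
proof -
  have c: "covering_projection E B p" using reg by (simp add: regular_covering_def)
  obtain f where f: "continuous_map E E f" "\<And>y. y \<in> topspace E \<Longrightarrow> p (f y) = p y" "f x = x'"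
    using regular_covering_lift[OF reg con lc cm H x] by metis
  obtain g where g: "continuous_map E E g" "\<And>y. y \<in> topspace E \<Longrightarrow> p (g y) = p y" "g x' = x"
    using regular_covering_lift[OF reg con lc cm H x(2,1)] x(3) by metis
  have im: "f y \<in> topspace E" "g y \<in> topspace E" if "y \<in> topspace E" for y
    using that f(1) g(1) continuous_map_image_subset_topspace by blast+
  have id: "continuous_map E E (\<lambda>y. y)" by simp
  have "g (f y) = y" if "y \<in> topspace E" for y
    using covering_lift_unique[OF con continuous_map_compose[OF f(1) g(1)] id c _ x(1) _ that] f g im by simp
  moreover have "f (g y) = y" if "y \<in> topspace E" for y
    using covering_lift_unique[OF con continuous_map_compose[OF g(1) f(1)] id c _ x(2) _ that] f g im by simp
  ultimately have "restrict f (topspace E) \<in> carrier (deck_group E p)"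
    using f g by (intro restrict_deck_group[where g = g]) auto
  then show thesis using that f(3) x(1) by simp
qed

lemma subgroup_deck_group: "subgroup (carrier (deck_group E p)) (BijGroup (topspace E))"
proof (rule group.subgroupI[OF group_BijGroup])
  let ?S = "topspace E"
  show "carrier (deck_group E p) \<subseteq> carrier (BijGroup ?S)"
    by (auto simp: deck_group_carrier BijGroup_def)
  have "restrict (\<lambda>x. x) ?S \<in> carrier (deck_group E p)"
    by (rule restrict_deck_group[where g = "\<lambda>x. x"]) auto
  then show "carrier (deck_group E p) \<noteq> {}" by blast
  fix f assume f: "f \<in> carrier (deck_group E p)"
  then have fB: "f \<in> Bij ?S" "homeomorphic_map E E f" "\<And>x. x \<in> ?S \<Longrightarrow> p (f x) = p x"
    by (auto simp: deck_group_carrier)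
  then have bij: "bij_betw f ?S ?S" by (simp add: Bij_def)
  obtain h where h: "homeomorphic_maps E E f h" using fB(2) homeomorphic_map_maps by blast
  have hE: "continuous_map E E h" "h y \<in> ?S" "f (h y) = y" if "y \<in> ?S" for y
    using h that continuous_map_image_subset_topspace unfolding homeomorphic_maps_def by blast+
  have hi: "inv_into ?S f y = h y" if "y \<in> ?S" for y
    using hE[OF that] bij by (metis bij_betw_def inv_into_f_f)
  have "p (h y) = p y" if "y \<in> ?S" for y
    using fB(3)[of "h y"] hE[OF that] by simp
  then have "restrict h ?S \<in> carrier (deck_group E p)"
    using h unfolding homeomorphic_maps_def by (intro restrict_deck_group[where g = f]) auto
  moreover have "inv\<^bsub>BijGroup ?S\<^esub> f = restrict h ?S"
    using inv_BijGroup[OF fB(1)] hi by (auto simp: restrict_def)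
  ultimately show "inv\<^bsub>BijGroup ?S\<^esub> f \<in> carrier (deck_group E p)" by simp
  fix g assume g: "g \<in> carrier (deck_group E p)"
  then have gB: "g \<in> Bij ?S" "homeomorphic_map E E g" "\<And>x. x \<in> ?S \<Longrightarrow> p (g x) = p x" "\<And>x. x \<in> ?S \<Longrightarrow> g x \<in> ?S"
    by (auto simp: deck_group_carrier Bij_imp_funcset Bij_def bij_betw_def)
  have "homeomorphic_map E E (f \<circ> g)"
    using homeomorphic_map_compose gB(2) fB(2) by blast
  then have "homeomorphic_map E E (compose ?S f g)"
    by (rule homeomorphic_map_eq) (simp add: compose_def)
  then show "f \<otimes>\<^bsub>BijGroup ?S\<^esub> g \<in> carrier (deck_group E p)"
    using fB gB compose_Bij[OF fB(1) gB(1)] by (simp add: deck_group_carrier BijGroup_def compose_def)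
qed

lemma deck_group_eq: "deck_group E p = BijGroup (topspace E)\<lparr>carrier := carrier (deck_group E p)\<rparr>"
  by (simp add: deck_group_def)

lemma group_deck_group: "group (deck_group E p)"
  using subgroup.subgroup_is_group[OF subgroup_deck_group group_BijGroup] deck_group_eq by metis

lemma deck_group_mult:
  "f \<in> carrier (deck_group E p) \<Longrightarrow> g \<in> carrier (deck_group E p) \<Longrightarrow> x \<in> topspace E \<Longrightarrow>
     (f \<otimes>\<^bsub>deck_group E p\<^esub> g) x = f (g x)"
  by (simp add: deck_group_def BijGroup_def compose_def)

lemma deck_group_one: "\<one>\<^bsub>deck_group E p\<^esub> = (\<lambda>x\<in>topspace E. x)"
  by (simp add: deck_group_def BijGroup_def)

lemma deck_group_bij: "f \<in> carrier (deck_group E p) \<Longrightarrow> bij_betw f (topspace E) (topspace E)"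
  by (simp add: deck_group_carrier Bij_def)

lemma deck_group_maps_to: "f \<in> carrier (deck_group E p) \<Longrightarrow> x \<in> topspace E \<Longrightarrow> f x \<in> topspace E"
  using deck_group_bij bij_betwE by metis

lemma deck_group_extensional:
  assumes "f \<in> carrier (deck_group E p)" "g \<in> carrier (deck_group E q)" "\<And>x. x \<in> topspace E \<Longrightarrow> f x = g x"
  shows "f = g"
  using assms by (intro extensionalityI[of _ "topspace E"]) (auto simp: deck_group_carrier Bij_def)

lemma deck_group_inv:
  assumes f: "f \<in> carrier (deck_group E p)" and x: "x \<in> topspace E"
  shows "f ((inv\<^bsub>deck_group E p\<^esub> f) x) = x" "(inv\<^bsub>deck_group E p\<^esub> f) (f x) = x"
proof -
  interpret group "deck_group E p" by (rule group_deck_group)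
  show "f ((inv\<^bsub>deck_group E p\<^esub> f) x) = x"
    using deck_group_mult[OF f inv_closed[OF f] x] f x by (simp add: deck_group_one)
  show "(inv\<^bsub>deck_group E p\<^esub> f) (f x) = x"
    using deck_group_mult[OF inv_closed[OF f] f x] f x by (simp add: deck_group_one)
qed

section \<open>The covering tower and its limit group\<close>

lemma bond_self [simp]: "bond p n n x = x"
  by (cases n) simp_all

lemma covering_projection_id:
  assumes "\<And>x. x \<in> topspace B \<Longrightarrow> p x = x"
  shows "covering_projection B B p"
proof -
  have h: "homeomorphic_map B B p"
    by (rule homeomorphic_map_eq[of B B id]) (use assms in auto)
  have "evenly_covered B B p (topspace B)"
    unfolding evenly_covered_def
    by (rule exI[of _ "{topspace B}"]) (use h assms in auto)
  then show ?thesis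
    using homeomorphic_imp_continuous_map[OF h] unfolding covering_projection_def by blast
qed

text \<open>A finite covering sequence together with its limit space \<open>Xt\<close>.\<close>

locale covering_tower =
  fixes X :: "nat \<Rightarrow> 'a topology" and p :: "nat \<Rightarrow> 'a \<Rightarrow> 'a" and Xt :: "(nat \<Rightarrow> 'a) topology"
  assumes FinTop: "FinTop X p" and limit: "top_inverse_limit X p Xt"
begin

text \<open>\<open>T\<close> and \<open>Xt\<close> have the same points; the topology of \<open>T\<close>, as a subspace of the product, is the coarser one.\<close>

abbreviation "T \<equiv> inverse_limit X p"

lemma topspace_T: "topspace T = topspace Xt"
  using limit by (simp add: top_inverse_limit_def)

lemma topspace_Xt: "x \<in> topspace Xt \<longleftrightarrow> (\<forall>n. x n \<in> topspace (X n) \<and> p n (x (Suc n)) = x n)"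
  unfolding topspace_T[symmetric] inverse_limit_def by (auto simp: PiE_iff)

lemma coord_mem: "x \<in> topspace Xt \<Longrightarrow> x n \<in> topspace (X n)"
  by (simp add: topspace_Xt)

lemma coord_compat: "x \<in> topspace Xt \<Longrightarrow> p n (x (Suc n)) = x n"
  by (simp add: topspace_Xt)

lemma coord_eq_le:
  assumes "x \<in> topspace Xt" "y \<in> topspace Xt" "x n = y n" "m \<le> n"
  shows "x m = y m"
  using assms(4,3)
proof (induction rule: dec_induct)
  case (step k)
  then show ?case using coord_compat[OF assms(1), of k] coord_compat[OF assms(2), of k] by metis
qed simp

lemma X_props:
  "second_countable (X n)" "locally_compact_space (X n)" "connected_space (X n)" "Hausdorff_space (X n)"
  using FinTop by (auto simp: FinTop_def)

lemma openin_special: "special_set X p V \<Longrightarrow> openin Xt V"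
  using limit unfolding top_inverse_limit_def arbitrary_def union_of_def by auto

lemma special_base:
  assumes "openin Xt W" "x \<in> W"
  obtains V where "special_set X p V" "x \<in> V" "V \<subseteq> W"
proof -
  have "(arbitrary union_of (special_set X p)) W"
    using assms(1) limit by (simp add: top_inverse_limit_def)
  then obtain \<U> where "\<U> \<subseteq> Collect (special_set X p)" "\<Union>\<U> = W"
    unfolding union_of_def by blast
  then show thesis using assms(2) that by blast
qed

lemma covering_of_seq_Xt: "covering_of_seq X p Xt coord"
  using limit unfolding top_inverse_limit_def by (elim conjE)

lemma covering_coord: "covering_projection Xt (X n) (coord n)"
  using covering_of_seq_Xt by (simp add: covering_of_seq_def regular_covering_def)

lemma coord_surj: "coord n ` topspace Xt = topspace (X n)"
  using covering_of_seq_Xt unfolding covering_of_seq_def by (elim allE[of _ n] conjE)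

lemmas continuous_coord = covering_projection_continuous[OF covering_coord]

text \<open>The images of the special sets form a base of connected open sets.\<close>

lemma locally_connected_X: "locally_connected_space (X n)"
  unfolding locally_connected_space
proof (intro allI impI)
  fix W y assume W: "openin (X n) W \<and> y \<in> W"
  then have "y \<in> topspace (X n)" using openin_subset by blast
  then have "y \<in> coord n ` topspace Xt" by (simp only: coord_surj)
  then obtain x where x: "x \<in> topspace Xt" "y = x n" by (rule imageE)
  have "openin Xt {x \<in> topspace Xt. coord n x \<in> W}"
    using openin_continuous_map_preimage[OF continuous_coord] W by blast
  then obtain V where V: "special_set X p V" "x \<in> V" "V \<subseteq> {x \<in> topspace Xt. coord n x \<in> W}"
    by (rule special_base) (use x W in auto)
  then show "\<exists>U. openin (X n) U \<and> connectedin (X n) U \<and> y \<in> U \<and> U \<subseteq> W"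
    using x by (intro exI[of _ "coord n ` V"]) (auto simp: special_set_def)
qed

lemma locally_connected_Xt: "locally_connected_space Xt"
  by (rule covering_locally_connected_space[OF covering_coord locally_connected_X])

lemma completely_metrizable_X: "completely_metrizable_space (X n)"
  by (rule locally_compact_second_countable_imp_completely_metrizable_space) (rule X_props)+

lemma special_homeomorphic:
  assumes V: "special_set X p V"
  shows "homeomorphic_map (subtopology Xt V) (subtopology (X n) (coord n ` V)) (coord n)"
proof -
  have "openin (X n) (coord n ` V)" "inj_on (coord n) V"
    using V by (auto simp: special_set_def)
  then show ?thesis
    using homeomorphic_map_open_subsets_iff[OF continuous_coord covering_projection_open_map[OF covering_coord]
      openin_special[OF V] openin_subset] by blast
qed

lemma bond_coord: "x \<in> topspace Xt \<Longrightarrow> bond p 0 n (x n) = x 0"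
  by (induction n) (simp_all add: coord_compat)

lemma covering_p: "covering_projection (X (Suc n)) (X n) (p n)"
proof -
  have "regular_covering (X (Suc n)) (X n) (bond p n (Suc n))"
    using FinTop lessI unfolding FinTop_def by blast
  moreover have "bond p n (Suc n) = p n" by (rule ext) simp
  ultimately show ?thesis by (simp add: regular_covering_def)
qed

lemmas continuous_p = covering_projection_continuous[OF covering_p]

lemma regular_bond: "n > 0 \<Longrightarrow> regular_covering (X n) (X 0) (bond p 0 n)"
  using FinTop by (simp add: FinTop_def)

lemma covering_bond: "covering_projection (X n) (X 0) (bond p 0 n)"
proof (cases n)
  case 0
  then show ?thesis by (simp add: covering_projection_id)
next
  case (Suc k)
  then show ?thesis using regular_bond[of n] by (simp add: regular_covering_def)
qed

lemma deck_transitive_X: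
  assumes "y \<in> topspace (X n)" "y' \<in> topspace (X n)" "bond p 0 n y = bond p 0 n y'"
  obtains f where "f \<in> carrier (deck_group (X n) (bond p 0 n))" "f y = y'"
proof (cases "n = 0")
  case True
  have "restrict (\<lambda>x. x) (topspace (X n)) \<in> carrier (deck_group (X n) (bond p 0 n))"
    by (rule restrict_deck_group[where g = "\<lambda>x. x"]) auto
  then show thesis using that assms True by simp
next
  case False
  then show thesis
    using regular_covering_deck_transitive[OF regular_bond X_props(3) locally_connected_X completely_metrizable_X X_props(4) assms] that
    by blast
qed

lemma deck_continuous: "f \<in> carrier (deck_group E q) \<Longrightarrow> continuous_map E E f"
  by (simp add: deck_group_carrier homeomorphic_imp_continuous_map)

lemma deck_bond: "f \<in> carrier (deck_group (X n) (bond p 0 n)) \<Longrightarrow> y \<in> topspace (X n) \<Longrightarrow> bond p 0 n (f y) = bond p 0 n y"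
  by (simp add: deck_group_carrier)

lemma deck_eqI:
  assumes "f \<in> carrier (deck_group (X n) (bond p 0 n))" "g \<in> carrier (deck_group (X n) (bond p 0 n))"
    and "y \<in> topspace (X n)" "f y = g y"
  shows "f = g"
proof (rule deck_group_extensional[OF assms(1,2)])
  fix z assume z: "z \<in> topspace (X n)"
  show "f z = g z"
    by (rule covering_lift_unique[OF X_props(3) deck_continuous[OF assms(1)] deck_continuous[OF assms(2)]
          covering_bond _ assms(3,4) z]) (simp add: deck_bond assms)
qed

subsection \<open>The inverse limit is connected\<close>

lemma continuous_T_coord: "continuous_map T (X n) (coord n)"
  unfolding inverse_limit_def
  by (intro continuous_map_from_subtopology continuous_map_product_projection) simp

lemma continuous_into_T:
  assumes "\<And>n. continuous_map Z (X n) (\<lambda>z. f z n)" "\<And>z. z \<in> topspace Z \<Longrightarrow> f z \<in> topspace Xt"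
  shows "continuous_map Z T f"
  unfolding inverse_limit_def continuous_map_in_subtopology continuous_map_componentwise_UNIV
  using assms by (auto simp: topspace_Xt)

lemma continuous_Xt_T: "continuous_map Xt T (\<lambda>x. x)"
  by (rule continuous_into_T) (use continuous_coord in auto)

text \<open>A component of \<open>Xt\<close> is mapped onto every \<open>X n\<close>. It is therefore dense in \<open>T\<close>, where it remains connected.\<close>

lemma connected_T: "connected_space T"
proof (cases "topspace Xt = {}")
  case True
  then show ?thesis
    using topspace_T null_topspace_iff_trivial by (metis connected_space_trivial_topology)
next
  case False
  then obtain x where x: "x \<in> topspace Xt" by blast
  let ?C = "connected_component_of_set Xt x"
  have CX: "?C \<subseteq> topspace Xt" by (rule connected_component_of_subset_topspace)
  have surj: "coord n ` ?C = topspace (X n)" for n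
    by (rule covering_component_surj[OF covering_coord locally_connected_X X_props(3) x])
  have "connectedin T ((\<lambda>x. x) ` ?C)"
    by (rule connectedin_continuous_map_image[OF continuous_Xt_T connectedin_connected_component_of])
  then have con: "connectedin T ?C" by simp
  have "topspace Xt \<subseteq> T closure_of ?C"
  proof
    fix y assume y: "y \<in> topspace Xt"
    show "y \<in> T closure_of ?C"
      unfolding in_closure_of
    proof (intro conjI allI impI)
      show "y \<in> topspace T" using y topspace_T by simp
      fix W assume W: "y \<in> W \<and> openin T W"
      then obtain W' where W': "openin (product_topology X UNIV) W'" "W = W' \<inter> {x. \<forall>n. p n (x (Suc n)) = x n}"
        unfolding inverse_limit_def openin_subtopology by blast
      then have "y \<in> W'" using W by blast
      then obtain U where U: "finite {i \<in> UNIV. U i \<noteq> topspace (X i)}" "y \<in> Pi\<^sub>E UNIV U" "Pi\<^sub>E UNIV U \<subseteq> W'"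
        using W'(1) unfolding openin_product_topology_alt by meson
      obtain n where n: "\<And>i. U i \<noteq> topspace (X i) \<Longrightarrow> i \<le> n"
        using U(1) unfolding finite_nat_set_iff_bounded_le by auto
      have "y n \<in> coord n ` ?C" unfolding surj using coord_mem[OF y] .
      then obtain c where c: "c \<in> ?C" "y n = c n" by (rule imageE)
      have cX: "c \<in> topspace Xt" using c(1) CX by (rule rev_subsetD)
      have "c i \<in> U i" for i
      proof (cases "U i = topspace (X i)")
        case True
        then show ?thesis using coord_mem[OF cX] by simp
      next
        case False
        then have "c i = y i" using coord_eq_le[OF cX y _ n] c(2) by metis
        then show ?thesis using U(2) by (simp add: PiE_iff)
      qed
      then have "c \<in> W'" using U(3) by (auto simp: PiE_iff)
      moreover have "\<forall>n. p n (c (Suc n)) = c n" using coord_compat[OF cX] by blast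
      ultimately have "c \<in> W" using W'(2) by simp
      then show "\<exists>y. y \<in> ?C \<and> y \<in> W" using c(1) by (intro exI[of _ c] conjI)
    qed
  qed
  then have "T closure_of ?C = topspace T"
    using closure_of_subset_topspace[of T ?C] topspace_T by simp
  then have "connectedin T (topspace T)"
    using connectedin_closure_of[OF con] by simp
  then show ?thesis by (simp add: connectedin_topspace)
qed

subsection \<open>The limit group\<close>

abbreviation "G \<equiv> limit_group X p"
abbreviation "J \<equiv> limit_kernel X p"

lemma G_carrier: "g \<in> carrier G \<Longrightarrow> g \<in> carrier (deck_group T (coord 0))"
  by (simp add: limit_group_def)

lemma group_G: "group G"
  unfolding limit_group_def by (rule group_deck_group)

lemma G_maps_to: "g \<in> carrier G \<Longrightarrow> x \<in> topspace Xt \<Longrightarrow> g x \<in> topspace Xt"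
  using deck_group_maps_to[OF G_carrier] topspace_T by simp

lemma G_inv:
  assumes "g \<in> carrier G"
  shows "inv\<^bsub>G\<^esub> g \<in> carrier G" "x \<in> topspace Xt \<Longrightarrow> g ((inv\<^bsub>G\<^esub> g) x) = x" "x \<in> topspace Xt \<Longrightarrow> (inv\<^bsub>G\<^esub> g) (g x) = x"
  using group.inv_closed[OF group_G assms] deck_group_inv[OF G_carrier[OF assms]] topspace_T
  unfolding limit_group_def by simp_all

lemma G_one: "x \<in> topspace Xt \<Longrightarrow> \<one>\<^bsub>G\<^esub> x = x"
  unfolding limit_group_def deck_group_one topspace_T by simp

lemma G_extensional: "g \<in> carrier G \<Longrightarrow> h \<in> carrier G \<Longrightarrow> (\<And>x. x \<in> topspace Xt \<Longrightarrow> g x = h x) \<Longrightarrow> g = h"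
  using deck_group_extensional[OF G_carrier G_carrier] topspace_T by simp

text \<open>If \<open>f\<close> is the deck transformation of \<open>X n\<close> that agrees with \<open>g\<close> over one point of the limit, then
  \<open>x \<mapsto> f (x n)\<close> and \<open>x \<mapsto> (g x) n\<close> lift the same map on the connected space \<open>T\<close>, and hence coincide.\<close>

lemma G_descends:
  assumes g: "g \<in> carrier G"
  obtains f where "f \<in> carrier (deck_group (X n) (bond p 0 n))" "\<And>x. x \<in> topspace Xt \<Longrightarrow> g x n = f (x n)"
proof (cases "topspace Xt = {}")
  case True
  have "restrict (\<lambda>x. x) (topspace (X n)) \<in> carrier (deck_group (X n) (bond p 0 n))"
    by (rule restrict_deck_group[where g = "\<lambda>x. x"]) auto
  then show thesis using that True by blast
next
  case False
  then obtain x0 where x0: "x0 \<in> topspace Xt" by blast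
  have g0: "g x 0 = x 0" if "x \<in> topspace Xt" for x
    using G_carrier[OF g] that topspace_T by (simp add: deck_group_carrier)
  note gX = G_maps_to[OF g]
  have bg: "bond p 0 n (g x n) = bond p 0 n (x n)" if "x \<in> topspace Xt" for x
    using bond_coord[OF that] bond_coord[OF gX[OF that]] g0[OF that] by simp
  obtain f where f: "f \<in> carrier (deck_group (X n) (bond p 0 n))" "f (x0 n) = g x0 n"
    by (rule deck_transitive_X[OF coord_mem[OF x0] coord_mem[OF gX[OF x0]] bg[OF x0, symmetric]])
  have 1: "continuous_map T (X n) (\<lambda>x. f (x n))"
    using continuous_map_compose[OF continuous_T_coord deck_continuous[OF f(1)]] by (simp add: o_def)
  have 2: "continuous_map T (X n) (\<lambda>x. g x n)"
    using continuous_map_compose[OF deck_continuous[OF G_carrier[OF g]] continuous_T_coord] by (simp add: o_def)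
  have "f (x n) = g x n" if x: "x \<in> topspace Xt" for x
  proof (rule covering_lift_unique[OF connected_T 1 2 covering_bond])
    fix z assume "z \<in> topspace T"
    then have z: "z \<in> topspace Xt" by (simp add: topspace_T)
    show "bond p 0 n (f (z n)) = bond p 0 n (g z n)"
      using deck_bond[OF f(1) coord_mem[OF z]] bg[OF z] by simp
  qed (use x0 x f(2) topspace_T in auto)
  then show thesis using that f(1) by simp
qed

text \<open>Since every element descends, the description operator in \<^const>\<open>deck_descent\<close> has a value on it.\<close>

lemma limit_kernel_iff:
  "g \<in> J n \<longleftrightarrow> g \<in> carrier G \<and> (\<forall>x\<in>topspace Xt. g x n = x n)"
proof (cases "g \<in> carrier G")
  case True
  obtain f where f: "f \<in> carrier (deck_group (X n) (bond p 0 n))" "\<And>x. x \<in> topspace Xt \<Longrightarrow> g x n = f (x n)"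
    using G_descends[OF True] by blast
  have "deck_descent T (coord n) (X n) (bond p 0 n) g = f"
    unfolding deck_descent_def
  proof (rule the_equality)
    show "f \<in> carrier (deck_group (X n) (bond p 0 n)) \<and> (\<forall>x\<in>topspace T. f (x n) = g x n)"
      using f topspace_T by simp
    fix f' assume f': "f' \<in> carrier (deck_group (X n) (bond p 0 n)) \<and> (\<forall>x\<in>topspace T. f' (x n) = g x n)"
    show "f' = f"
    proof (rule deck_group_extensional)
      fix y assume "y \<in> topspace (X n)"
      then have "y \<in> coord n ` topspace Xt" by (simp only: coord_surj)
      then obtain x where "x \<in> topspace Xt" "y = x n" by (rule imageE)
      then show "f' y = f y" using f f' topspace_T by simp
    qed (use f f' in auto)
  qed
  then have "g \<in> J n \<longleftrightarrow> f = (\<lambda>x\<in>topspace (X n). x)"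
    using True by (simp add: limit_kernel_def kernel_def deck_group_one)
  also have "\<dots> \<longleftrightarrow> (\<forall>y\<in>topspace (X n). f y = y)"
    using f(1) by (auto simp: deck_group_carrier Bij_def intro!: extensionalityI[of f "topspace (X n)"])
  also have "\<dots> \<longleftrightarrow> (\<forall>y\<in>coord n ` topspace Xt. f y = y)"
    by (simp only: coord_surj)
  also have "\<dots> \<longleftrightarrow> (\<forall>x\<in>topspace Xt. g x n = x n)"
    using f(2) by simp
  finally show ?thesis using True by simp
qed (simp add: limit_kernel_def kernel_def)

lemma J_carrier: "g \<in> J n \<Longrightarrow> g \<in> carrier G"
  by (simp add: limit_kernel_iff)

lemma J_0: "J 0 = carrier G"
  using G_carrier by (auto simp: limit_kernel_iff deck_group_carrier topspace_T)

lemma J_antimono: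
  assumes "n \<le> m" shows "J m \<subseteq> J n"
proof
  fix g assume g: "g \<in> J m"
  have "g x n = x n" if "x \<in> topspace Xt" for x
    using coord_eq_le[OF G_maps_to[OF J_carrier[OF g] that] that _ assms] g that
    by (simp add: limit_kernel_iff)
  then show "g \<in> J n" using g by (simp add: limit_kernel_iff)
qed

lemma J_inv:
  assumes "g \<in> J n" shows "inv\<^bsub>G\<^esub> g \<in> J n"
  unfolding limit_kernel_iff
proof (intro conjI ballI)
  show c: "inv\<^bsub>G\<^esub> g \<in> carrier G" using G_inv(1)[OF J_carrier[OF assms]] .
  fix x assume x: "x \<in> topspace Xt"
  have "g ((inv\<^bsub>G\<^esub> g) x) n = (inv\<^bsub>G\<^esub> g) x n"
    using assms G_maps_to[OF c x] by (simp add: limit_kernel_iff)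
  then show "(inv\<^bsub>G\<^esub> g) x n = x n"
    using G_inv(2)[OF J_carrier[OF assms] x] by simp
qed

lemma J_one: "\<one>\<^bsub>G\<^esub> \<in> J n"
  using group.is_monoid[OF group_G, THEN monoid.one_closed] G_one by (simp add: limit_kernel_iff)

text \<open>The limit group acts freely, because a deck transformation of a connected \<open>X n\<close> is determined by one value.\<close>

lemma G_free:
  assumes g: "g \<in> carrier G" "h \<in> carrier G" and x: "x \<in> topspace Xt" "g x = h x"
  shows "g = h"
proof (rule G_extensional[OF g])
  fix y assume y: "y \<in> topspace Xt"
  show "g y = h y"
  proof
    fix n
    obtain f where f: "f \<in> carrier (deck_group (X n) (bond p 0 n))" "\<And>x. x \<in> topspace Xt \<Longrightarrow> g x n = f (x n)"
      using G_descends[OF g(1)] by blast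
    obtain f' where f': "f' \<in> carrier (deck_group (X n) (bond p 0 n))" "\<And>x. x \<in> topspace Xt \<Longrightarrow> h x n = f' (x n)"
      using G_descends[OF g(2)] by blast
    have "f (x n) = f' (x n)" using f(2)[OF x(1)] f'(2)[OF x(1)] x(2) by simp
    then have "f = f'" by (rule deck_eqI[OF f(1) f'(1) coord_mem[OF x(1)]])
    then show "g y n = h y n" using f(2)[OF y] f'(2)[OF y] by simp
  qed
qed

text \<open>The deck transformations of the stages that send the coordinates of \<open>x\<close> to those of \<open>x'\<close> are compatible
  with the bonding maps by uniqueness of lifts, and together act on the limit.\<close>

lemma J_transitive:
  assumes x: "x \<in> topspace Xt" "x' \<in> topspace Xt" "x n = x' n"
  obtains g where "g \<in> J n" "g x = x'"
proof -
  have x0: "x 0 = x' 0" using coord_eq_le[OF x] by simp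
  have "\<exists>f. f \<in> carrier (deck_group (X m) (bond p 0 m)) \<and> f (x m) = x' m" for m
    using deck_transitive_X[OF coord_mem[OF x(1)] coord_mem[OF x(2)], of m] bond_coord x x0 by metis
  then obtain f where f: "\<And>m. f m \<in> carrier (deck_group (X m) (bond p 0 m))" "\<And>m. f m (x m) = x' m"
    by metis
  let ?h = "\<lambda>m. inv\<^bsub>deck_group (X m) (bond p 0 m)\<^esub> (f m)"
  have h: "?h m \<in> carrier (deck_group (X m) (bond p 0 m))" for m
    using group.inv_closed[OF group_deck_group f(1)] .
  have fc: "p m (f (Suc m) y) = f m (p m y)" if y: "y \<in> topspace (X (Suc m))" for m y
  proof (rule covering_lift_unique[where Z = "X (Suc m)" and E = "X m" and f = "\<lambda>y. p m (f (Suc m) y)"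
        and h = "\<lambda>y. f m (p m y)" and z = y and ?z0.0 = "x (Suc m)", OF X_props(3) _ _ covering_bond])
    show "continuous_map (X (Suc m)) (X m) (\<lambda>y. p m (f (Suc m) y))" "continuous_map (X (Suc m)) (X m) (\<lambda>y. f m (p m y))"
      using continuous_map_compose[OF deck_continuous[OF f(1)] continuous_p] continuous_map_compose[OF continuous_p deck_continuous[OF f(1)]]
      by (auto simp: o_def)
    show "x (Suc m) \<in> topspace (X (Suc m))" using coord_mem[OF x(1)] .
    show "p m (f (Suc m) (x (Suc m))) = f m (p m (x (Suc m)))"
      using f(2) coord_compat[OF x(1)] coord_compat[OF x(2)] by simp
    show "y \<in> topspace (X (Suc m))" by (rule y)
    fix z assume z: "z \<in> topspace (X (Suc m))"
    then have "p m z \<in> topspace (X m)" by (rule covering_projection_maps_to[OF covering_p])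
    then show "bond p 0 m (p m (f (Suc m) z)) = bond p 0 m (f m (p m z))"
      using deck_bond[OF f(1) z] deck_bond[OF f(1), of "p m z" m] by simp
  qed
  have hc: "p m (?h (Suc m) y) = ?h m (p m y)" if y: "y \<in> topspace (X (Suc m))" for m y
  proof -
    let ?u = "?h (Suc m) y"
    have u: "?u \<in> topspace (X (Suc m))" using deck_group_maps_to[OF h y] .
    then have pu: "p m ?u \<in> topspace (X m)" by (rule covering_projection_maps_to[OF covering_p])
    have "p m y = f m (p m ?u)" using fc[OF u] deck_group_inv(1)[OF f(1) y] by simp
    then show ?thesis using deck_group_inv(2)[OF f(1) pu] by simp
  qed
  let ?F = "\<lambda>z m. f m (z m)" and ?H = "\<lambda>z m. ?h m (z m)"
  have FX: "?F z \<in> topspace Xt" "?H z \<in> topspace Xt" if "z \<in> topspace Xt" for z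
    using that fc hc deck_group_maps_to[OF f(1)] deck_group_maps_to[OF h] by (auto simp: topspace_Xt)
  have "restrict ?F (topspace T) \<in> carrier (deck_group T (coord 0))"
  proof (rule restrict_deck_group[where g = ?H])
    show "continuous_map T T ?F"
      using continuous_map_compose[OF continuous_T_coord deck_continuous[OF f(1)]] FX topspace_T
      by (intro continuous_into_T) (auto simp: o_def)
    show "continuous_map T T ?H"
      using continuous_map_compose[OF continuous_T_coord deck_continuous[OF h]] FX topspace_T
      by (intro continuous_into_T) (auto simp: o_def)
    fix z assume "z \<in> topspace T"
    then have z: "z \<in> topspace Xt" by (simp add: topspace_T)
    show "?H (?F z) = z" using deck_group_inv(2)[OF f(1) coord_mem[OF z]] by simp
    show "?F (?H z) = z" using deck_group_inv(1)[OF f(1) coord_mem[OF z]] by simp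
    show "?F z 0 = z 0" using deck_bond[OF f(1) coord_mem[OF z], of 0] by simp
  qed
  then have G: "restrict ?F (topspace Xt) \<in> carrier G"
    by (simp add: limit_group_def topspace_T)
  have "f n (z n) = z n" if z: "z \<in> topspace Xt" for z
  proof -
    have 1: "restrict (\<lambda>x. x) (topspace (X n)) \<in> carrier (deck_group (X n) (bond p 0 n))"
      by (rule restrict_deck_group[where g = "\<lambda>x. x"]) auto
    have "f n = restrict (\<lambda>x. x) (topspace (X n))"
      by (rule deck_eqI[OF f(1) 1 coord_mem[OF x(1)]]) (use f(2)[of n] x(3) coord_mem[OF x(1), of n] in simp)
    then show ?thesis using coord_mem[OF z] by simp
  qed
  then have "restrict ?F (topspace Xt) \<in> J n"
    using G by (simp add: limit_kernel_iff)
  moreover have "restrict ?F (topspace Xt) x = x'"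
    using x(1) f(2) by auto
  ultimately show thesis by (rule that)
qed

text \<open>The group acts on the finer topology too, since it permutes the special sets.\<close>

lemma special_translate:
  assumes V: "special_set X p V" and g: "g \<in> carrier G"
  shows "special_set X p (g ` V)"
proof -
  have VX: "V \<subseteq> topspace Xt" using V topspace_T by (simp add: special_set_def)
  have "openin (X n) (coord n ` g ` V) \<and> connectedin (X n) (coord n ` g ` V) \<and> inj_on (coord n) (g ` V)" for n
  proof -
    obtain f where f: "f \<in> carrier (deck_group (X n) (bond p 0 n))" "\<And>x. x \<in> topspace Xt \<Longrightarrow> g x n = f (x n)"
      using G_descends[OF g] by blast
    have Vn: "openin (X n) (coord n ` V)" "connectedin (X n) (coord n ` V)" "inj_on (coord n) V"
      using V by (auto simp: special_set_def)
    have eq: "coord n ` g ` V = f ` (coord n ` V)"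
      unfolding image_image by (rule image_cong[OF refl]) (use f(2) VX in blast)
    have hf: "homeomorphic_map (X n) (X n) f"
      using f(1) by (simp add: deck_group_carrier)
    have "inj_on (coord n) (g ` V)"
    proof (intro inj_onI, elim imageE)
      fix a b x y assume a: "a n = b n" "a = g x" "x \<in> V" "b = g y" "y \<in> V"
      have "x \<in> topspace Xt" "y \<in> topspace Xt" using a VX by blast+
      then have "f (x n) = f (y n)" "x n \<in> topspace (X n)" "y n \<in> topspace (X n)"
        using a f(2) coord_mem by auto
      then have "x n = y n" using deck_group_bij[OF f(1)] by (simp add: bij_betw_def inj_on_def)
      then have "x = y" using Vn(3) a by (simp add: inj_on_def)
      then show "a = b" using a by simp
    qed
    moreover have "openin (X n) (f ` (coord n ` V))"
      using homeomorphic_imp_open_map[OF hf] Vn(1) by (simp add: open_map_def)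
    moreover have "connectedin (X n) (f ` (coord n ` V))"
      using connectedin_continuous_map_image[OF homeomorphic_imp_continuous_map[OF hf] Vn(2)] .
    ultimately show ?thesis unfolding eq by simp
  qed
  moreover have "coord 0 ` g ` V = coord 0 ` V"
    unfolding image_image
    by (rule image_cong[OF refl]) (use G_carrier[OF g] VX topspace_T in \<open>auto simp: deck_group_carrier\<close>)
  moreover have "g ` V \<subseteq> topspace T"
    using G_maps_to[OF g] VX topspace_T by auto
  ultimately show ?thesis
    using V unfolding special_set_def by simp
qed

lemma G_image_eq:
  assumes g: "g \<in> carrier G" and W: "W \<subseteq> topspace Xt"
  shows "(inv\<^bsub>G\<^esub> g) ` W = {x \<in> topspace Xt. g x \<in> W}"
proof (intro equalityI subsetI)
  fix x assume "x \<in> (inv\<^bsub>G\<^esub> g) ` W"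
  then obtain w where w: "w \<in> W" "x = (inv\<^bsub>G\<^esub> g) w" by (rule imageE)
  then have "w \<in> topspace Xt" using W by blast
  then show "x \<in> {x \<in> topspace Xt. g x \<in> W}"
    using w G_inv(2)[OF g, of w] G_maps_to[OF G_inv(1)[OF g], of w] by simp
next
  fix x assume "x \<in> {x \<in> topspace Xt. g x \<in> W}"
  then show "x \<in> (inv\<^bsub>G\<^esub> g) ` W"
    using G_inv(3)[OF g, of x] by (metis (mono_tags, lifting) image_eqI mem_Collect_eq)
qed

lemma G_continuous:
  assumes g: "g \<in> carrier G"
  shows "continuous_map Xt Xt g"
  unfolding continuous_map_alt
proof (intro conjI ballI allI impI)
  show "g \<in> topspace Xt \<rightarrow> topspace Xt" using G_maps_to[OF g] by simp
  fix W assume W: "openin Xt W"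
  have eq: "g -` W \<inter> topspace Xt = (inv\<^bsub>G\<^esub> g) ` W"
    using G_image_eq[OF g openin_subset[OF W]] by auto
  show "openin Xt (g -` W \<inter> topspace Xt)"
    unfolding eq openin_subopen[of Xt "(inv\<^bsub>G\<^esub> g) ` W"]
  proof (intro ballI, elim imageE)
    fix x w assume w: "x = (inv\<^bsub>G\<^esub> g) w" "w \<in> W"
    obtain V where V: "special_set X p V" "w \<in> V" "V \<subseteq> W"
      by (rule special_base[OF W w(2)])
    have "openin Xt ((inv\<^bsub>G\<^esub> g) ` V)"
      by (rule openin_special[OF special_translate[OF V(1) G_inv(1)[OF g]]])
    then show "\<exists>Ta. openin Xt Ta \<and> x \<in> Ta \<and> Ta \<subseteq> (inv\<^bsub>G\<^esub> g) ` W"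
      using V w by (intro exI[of _ "(inv\<^bsub>G\<^esub> g) ` V"]) auto
  qed
qed

lemma Hausdorff_Xt: "Hausdorff_space Xt"
  unfolding Hausdorff_space_def
proof (intro allI impI)
  fix x y assume xy: "x \<in> topspace Xt \<and> y \<in> topspace Xt \<and> x \<noteq> y"
  then obtain n where n: "x n \<noteq> y n" by blast
  then obtain U V where U: "openin (X n) U" "openin (X n) V" "x n \<in> U" "y n \<in> V" "disjnt U V"
    using X_props(4)[of n] coord_mem xy unfolding Hausdorff_space_def by metis
  have "openin Xt {x \<in> topspace Xt. coord n x \<in> U}" "openin Xt {x \<in> topspace Xt. coord n x \<in> V}"
    using openin_continuous_map_preimage[OF continuous_coord] U(1,2) by blast+
  then show "\<exists>U V. openin Xt U \<and> openin Xt V \<and> x \<in> U \<and> y \<in> V \<and> disjnt U V"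
    using xy U by (intro exI[of _ "{x \<in> topspace Xt. coord n x \<in> U}"] exI[of _ "{x \<in> topspace Xt. coord n x \<in> V}"])
       (auto simp: disjnt_iff)
qed

lemma special_compactin_lift:
  assumes V: "special_set X p V" and K: "compactin (X n) K" "K \<subseteq> coord n ` V"
  shows "compactin Xt {x \<in> V. x n \<in> K}"
proof -
  let ?K = "{x \<in> V. x n \<in> K}"
  have VX: "V \<subseteq> topspace Xt" by (rule openin_subset[OF openin_special[OF V]])
  have "coord n ` ?K = K" using K(2) by blast
  moreover have "compactin (subtopology (X n) (coord n ` V)) K"
    using K by (simp add: compactin_subtopology)
  ultimately have "compactin (subtopology (X n) (coord n ` V)) (coord n ` ?K)" by simp
  moreover have "?K \<subseteq> topspace (subtopology Xt V)" using VX by auto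
  ultimately have "compactin (subtopology Xt V) ?K"
    using homeomorphic_map_compactness[OF special_homeomorphic[OF V, of n]] by blast
  then show ?thesis by (simp add: compactin_subtopology)
qed

lemma locally_compact_Xt: "locally_compact_space Xt"
  unfolding locally_compact_space_def
proof (rule ballI)
  fix x assume x: "x \<in> topspace Xt"
  obtain V where V: "special_set X p V" "x \<in> V" and VX: "V \<subseteq> topspace Xt"
    by (rule special_base[OF openin_topspace x])
  have V0: "openin (X 0) (coord 0 ` V)" "x 0 \<in> coord 0 ` V" using V by (auto simp: special_set_def)
  have "neighbourhood_base_of (\<lambda>C. compactin (X 0) C) (X 0)"
    using locally_compact_space_neighbourhood_base[of "X 0"] X_props(2,4)[of 0] by simp
  then obtain U K where U: "openin (X 0) U" "compactin (X 0) K" "x 0 \<in> U" "U \<subseteq> K" "K \<subseteq> coord 0 ` V"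
    using V0 unfolding neighbourhood_base_of by meson
  have "openin Xt {y \<in> V. coord 0 y \<in> U}"
    by (rule openin_continuous_map_preimage_gen[OF continuous_coord openin_special[OF V(1)] U(1)])
  moreover have "compactin Xt {y \<in> V. y 0 \<in> K}"
    by (rule special_compactin_lift[OF V(1) U(2,5)])
  ultimately show "\<exists>U K. openin Xt U \<and> compactin Xt K \<and> x \<in> U \<and> U \<subseteq> K"
    using V(2) U(3,4) by (intro exI[of _ "{y \<in> V. coord 0 y \<in> U}"] exI[of _ "{y \<in> V. y 0 \<in> K}"]) auto
qed

lemma completely_regular_Xt: "completely_regular_space Xt"
  using locally_compact_Xt Hausdorff_Xt locally_compact_regular_imp_completely_regular_space by blast

end

section \<open>The algebra of essentially bounded functions\<close>

lemma ess_boundedI: "f \<in> borel_measurable M \<Longrightarrow> (AE x in M. norm (f x) \<le> C) \<Longrightarrow> f \<in> ess_bounded M"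
  by (auto simp: ess_bounded_def)

lemma ess_bounded_measurable: "f \<in> ess_bounded M \<Longrightarrow> f \<in> borel_measurable M"
  by (simp add: ess_bounded_def)

lemma ess_bounded_bound:
  assumes "f \<in> ess_bounded M"
  obtains C where "C \<ge> 0" "AE x in M. norm (f x) \<le> C"
proof -
  obtain C where "AE x in M. norm (f x) \<le> C" using assms by (auto simp: ess_bounded_def)
  then have "AE x in M. norm (f x) \<le> max C 0" by (rule AE_mp) (simp add: le_max_iff_disj)
  then show thesis by (intro that[of "max C 0"]) auto
qed

lemma ess_bounded_add:
  assumes "f \<in> ess_bounded M" "g \<in> ess_bounded M"
  shows "(\<lambda>x. f x + g x) \<in> ess_bounded M"
proof -
  obtain C where C: "AE x in M. norm (f x) \<le> C" using ess_bounded_bound[OF assms(1)] by blast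
  obtain D where D: "AE x in M. norm (g x) \<le> D" using ess_bounded_bound[OF assms(2)] by blast
  have "AE x in M. norm (f x + g x) \<le> C + D"
    using C D by eventually_elim (rule norm_triangle_mono)
  with assms[THEN ess_bounded_measurable] show ?thesis
    by (intro ess_boundedI borel_measurable_add)
qed

lemma ess_bounded_mult:
  assumes "f \<in> ess_bounded M" "g \<in> ess_bounded M"
  shows "(\<lambda>x. f x * g x) \<in> ess_bounded M"
proof -
  obtain C where C: "C \<ge> 0" "AE x in M. norm (f x) \<le> C" using ess_bounded_bound[OF assms(1)] by blast
  obtain D where D: "AE x in M. norm (g x) \<le> D" using ess_bounded_bound[OF assms(2)] by blast
  have "AE x in M. norm (f x * g x) \<le> C * D"
    using C(2) D by eventually_elim (simp add: norm_mult mult_mono C(1))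
  with assms[THEN ess_bounded_measurable] show ?thesis
    by (intro ess_boundedI borel_measurable_times)
qed

lemma ess_bounded_const: "(\<lambda>x. c) \<in> ess_bounded M"
  by (rule ess_boundedI[where C = "norm c"]) auto

lemma ess_bounded_scale: "f \<in> ess_bounded M \<Longrightarrow> (\<lambda>x. c * f x) \<in> ess_bounded M"
  by (rule ess_bounded_mult[OF ess_bounded_const])

lemma Linf_class_cong:
  assumes "AE x in M. f x = g x" shows "Linf_class M f = Linf_class M g"
proof -
  have "(AE x in M. h x = f x) \<longleftrightarrow> (AE x in M. h x = g x)" for h
  proof
    assume "AE x in M. h x = f x" then show "AE x in M. h x = g x" using assms by eventually_elim simp
  next
    assume "AE x in M. h x = g x" then show "AE x in M. h x = f x" using assms by eventually_elim simp
  qed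
  then show ?thesis by (simp add: Linf_class_def)
qed

lemma Linf_class_self: "f \<in> ess_bounded M \<Longrightarrow> f \<in> Linf_class M f"
  by (simp add: Linf_class_def)

lemma Linf_class_eq_iff:
  assumes "f \<in> ess_bounded M"
  shows "Linf_class M f = Linf_class M g \<longleftrightarrow> (AE x in M. f x = g x)"
proof
  assume "Linf_class M f = Linf_class M g"
  then have "f \<in> Linf_class M g" using Linf_class_self[OF assms] by simp
  then show "AE x in M. f x = g x" by (simp add: Linf_class_def)
qed (rule Linf_class_cong)

lemma Linf_carrier: "A \<in> carrier (Linf M) \<longleftrightarrow> (\<exists>f\<in>ess_bounded M. A = Linf_class M f)"
  by (auto simp: Linf_def)

lemma Linf_class_UN:
  assumes f: "f \<in> ess_bounded M" and "\<And>f'. f' \<in> Linf_class M f \<Longrightarrow> AE x in M. F f' x = F f x"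
  shows "(\<Union>f'\<in>Linf_class M f. Linf_class M (F f')) = Linf_class M (F f)"
proof -
  have "Linf_class M (F f') = Linf_class M (F f)" if "f' \<in> Linf_class M f" for f'
    using Linf_class_cong assms(2)[OF that] by blast
  then show ?thesis using Linf_class_self[OF f] by blast
qed

lemma Linf_plus:
  assumes "f \<in> ess_bounded M" "g \<in> ess_bounded M"
  shows "plus_of (Linf M) (Linf_class M f) (Linf_class M g) = Linf_class M (\<lambda>x. f x + g x)"
proof -
  have "(\<Union>g'\<in>Linf_class M g. Linf_class M (\<lambda>x. f' x + g' x)) = Linf_class M (\<lambda>x. f' x + g x)" for f'
    by (rule Linf_class_UN[OF assms(2)]) (auto simp: Linf_class_def elim: AE_mp)
  moreover have "(\<Union>f'\<in>Linf_class M f. Linf_class M (\<lambda>x. f' x + g x)) = Linf_class M (\<lambda>x. f x + g x)"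
    by (rule Linf_class_UN[OF assms(1)]) (auto simp: Linf_class_def elim: AE_mp)
  ultimately show ?thesis by (simp add: Linf_def)
qed

lemma Linf_times:
  assumes "f \<in> ess_bounded M" "g \<in> ess_bounded M"
  shows "times_of (Linf M) (Linf_class M f) (Linf_class M g) = Linf_class M (\<lambda>x. f x * g x)"
proof -
  have "(\<Union>g'\<in>Linf_class M g. Linf_class M (\<lambda>x. f' x * g' x)) = Linf_class M (\<lambda>x. f' x * g x)" for f'
    by (rule Linf_class_UN[OF assms(2)]) (auto simp: Linf_class_def elim: AE_mp)
  moreover have "(\<Union>f'\<in>Linf_class M f. Linf_class M (\<lambda>x. f' x * g x)) = Linf_class M (\<lambda>x. f x * g x)"
    by (rule Linf_class_UN[OF assms(1)]) (auto simp: Linf_class_def elim: AE_mp)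
  ultimately show ?thesis by (simp add: Linf_def)
qed

lemma Linf_scale:
  assumes "f \<in> ess_bounded M"
  shows "scale_of (Linf M) c (Linf_class M f) = Linf_class M (\<lambda>x. c * f x)"
proof -
  have "(\<Union>f'\<in>Linf_class M f. Linf_class M (\<lambda>x. c * f' x)) = Linf_class M (\<lambda>x. c * f x)"
    by (rule Linf_class_UN[OF assms]) (auto simp: Linf_class_def elim: AE_mp)
  then show ?thesis by (simp add: Linf_def)
qed

lemma Linf_star:
  assumes "f \<in> ess_bounded M"
  shows "star_of (Linf M) (Linf_class M f) = Linf_class M (\<lambda>x. cnj (f x))"
proof -
  have "(\<Union>f'\<in>Linf_class M f. Linf_class M (\<lambda>x. cnj (f' x))) = Linf_class M (\<lambda>x. cnj (f x))"
    by (rule Linf_class_UN[OF assms]) (auto simp: Linf_class_def elim: AE_mp)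
  then show ?thesis by (simp add: Linf_def)
qed

lemma Linf_norm:
  assumes f: "f \<in> ess_bounded M"
  shows "norm_of (Linf M) (Linf_class M f) = enn2real (esssup M (\<lambda>x. ennreal (norm (f x))))"
proof -
  let ?h = "SOME h. h \<in> Linf_class M f"
  have "?h \<in> Linf_class M f" by (rule someI[of _ f]) (rule Linf_class_self[OF f])
  then have h: "?h \<in> borel_measurable M" "AE x in M. ?h x = f x"
    by (auto simp: Linf_class_def ess_bounded_def)
  have "esssup M (\<lambda>x. ennreal (norm (?h x))) = esssup M (\<lambda>x. ennreal (norm (f x)))"
    using h ess_bounded_measurable[OF f] by (intro esssup_AE_cong) (auto elim: AE_mp)
  then show ?thesis by (simp add: Linf_def)
qed

lemma Linf_norm_le:
  assumes f: "f \<in> ess_bounded M" and "C \<ge> 0" "AE x in M. norm (f x) \<le> C"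
  shows "norm_of (Linf M) (Linf_class M f) \<le> C"
proof -
  have "esssup M (\<lambda>x. ennreal (norm (f x))) \<le> ennreal C"
    using ess_bounded_measurable[OF f] assms(2,3) by (intro esssup_I) (auto elim: AE_mp simp: ennreal_leI)
  then show ?thesis
    unfolding Linf_norm[OF f] using assms(2) by (metis enn2real_ennreal enn2real_mono ennreal_less_top)
qed

lemma Linf_norm_AE:
  assumes f: "f \<in> ess_bounded M"
  shows "AE x in M. norm (f x) \<le> norm_of (Linf M) (Linf_class M f)"
proof -
  obtain C where C: "C \<ge> 0" "AE x in M. norm (f x) \<le> C" using ess_bounded_bound[OF f] by blast
  have "esssup M (\<lambda>x. ennreal (norm (f x))) \<le> ennreal C"
    using ess_bounded_measurable[OF f] C by (intro esssup_I) (auto elim: AE_mp simp: ennreal_leI)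
  then have fin: "esssup M (\<lambda>x. ennreal (norm (f x))) < \<infinity>"
    by (rule le_less_trans) simp
  show ?thesis
    unfolding Linf_norm[OF f]
    using esssup_AE[of "\<lambda>x. ennreal (norm (f x))" M]
  proof eventually_elim
    case (elim x)
    then show ?case using enn2real_mono[OF elim] fin by simp
  qed
qed

section \<open>Continuous functions vanishing at infinity\<close>

lemma continuous_map_metric_iff:
  fixes f :: "'b \<Rightarrow> 'c::metric_space"
  shows "continuous_map Y euclidean f \<longleftrightarrow>
    (\<forall>x\<in>topspace Y. \<forall>\<epsilon>>0. \<exists>U. openin Y U \<and> x \<in> U \<and> (\<forall>y\<in>U. dist (f x) (f y) < \<epsilon>))"
  using Met_TC.continuous_map_to_metric[of Y f] by (simp add: mball_eq_ball)

lemma C0_iff: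
  "f \<in> carrier (C0 Y) \<longleftrightarrow> f \<in> extensional (topspace Y) \<and> continuous_map Y euclidean f \<and>
     (\<forall>\<epsilon>>0. \<exists>K. compactin Y K \<and> (\<forall>x\<in>topspace Y - K. norm (f x) < \<epsilon>))"
proof -
  have "(\<forall>\<epsilon>>0. compactin Y {x \<in> topspace Y. \<epsilon> \<le> norm (f x)}) \<longleftrightarrow>
     (\<forall>\<epsilon>>0. \<exists>K. compactin Y K \<and> (\<forall>x\<in>topspace Y - K. norm (f x) < \<epsilon>))" if c: "continuous_map Y euclidean f"
  proof (intro iffI allI impI)
    fix \<epsilon> :: real assume "\<forall>\<epsilon>>0. compactin Y {x \<in> topspace Y. \<epsilon> \<le> norm (f x)}" "\<epsilon> > 0"
    then show "\<exists>K. compactin Y K \<and> (\<forall>x\<in>topspace Y - K. norm (f x) < \<epsilon>)"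
      by (intro exI[of _ "{x \<in> topspace Y. \<epsilon> \<le> norm (f x)}"]) auto
  next
    fix \<epsilon> :: real assume "\<forall>\<epsilon>>0. \<exists>K. compactin Y K \<and> (\<forall>x\<in>topspace Y - K. norm (f x) < \<epsilon>)" "\<epsilon> > 0"
    then obtain K where K: "compactin Y K" "\<forall>x\<in>topspace Y - K. norm (f x) < \<epsilon>" by blast
    have "closedin Y {x \<in> topspace Y. f x \<in> {z. \<epsilon> \<le> norm z}}"
      by (rule closedin_continuous_map_preimage[OF c])
         (auto intro!: closed_Collect_le continuous_intros)
    then have cl: "closedin Y {x \<in> topspace Y. \<epsilon> \<le> norm (f x)}" by simp
    show "compactin Y {x \<in> topspace Y. \<epsilon> \<le> norm (f x)}"
      by (rule closed_compactin[OF K(1) _ cl]) (use K(2) in force)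
  qed
  then show ?thesis by (auto simp: C0_def)
qed

lemma C0_continuous: "f \<in> carrier (C0 Y) \<Longrightarrow> continuous_map Y euclidean f"
  by (simp add: C0_iff)

lemma C0_vanishes:
  assumes "f \<in> carrier (C0 Y)" "\<epsilon> > 0"
  obtains K where "compactin Y K" "\<And>x. x \<in> topspace Y \<Longrightarrow> x \<notin> K \<Longrightarrow> norm (f x) < \<epsilon>"
  using assms unfolding C0_iff by blast

lemma C0_bounded:
  assumes f: "f \<in> carrier (C0 Y)"
  obtains C where "C \<ge> 0" "\<And>x. x \<in> topspace Y \<Longrightarrow> norm (f x) \<le> C"
proof -
  obtain K where K: "compactin Y K" "\<And>x. x \<in> topspace Y \<Longrightarrow> x \<notin> K \<Longrightarrow> norm (f x) < 1"
    using C0_vanishes[OF f zero_less_one] by blast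
  have "compactin euclidean (f ` K)"
    by (rule image_compactin[OF K(1) C0_continuous[OF f]])
  then have "bounded (f ` K)" by (simp add: compact_imp_bounded)
  then obtain C where C: "\<And>x. x \<in> K \<Longrightarrow> norm (f x) \<le> C" unfolding bounded_iff by blast
  show thesis
  proof (rule that[of "max C 1"])
    fix x assume "x \<in> topspace Y"
    then show "norm (f x) \<le> max C 1"
      using K(2)[of x] C[of x] by (cases "x \<in> K") auto
  qed simp
qed

lemma C0_restrictI:
  assumes "continuous_map Y euclidean f" "\<And>\<epsilon>. \<epsilon> > 0 \<Longrightarrow> \<exists>K. compactin Y K \<and> (\<forall>x\<in>topspace Y - K. norm (f x) < \<epsilon>)"
  shows "restrict f (topspace Y) \<in> carrier (C0 Y)"
  unfolding C0_iff
proof (intro conjI allI impI)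
  show "continuous_map Y euclidean (restrict f (topspace Y))"
    by (rule continuous_map_eq[OF assms(1)]) simp
  show "\<exists>K. compactin Y K \<and> (\<forall>x\<in>topspace Y - K. norm (restrict f (topspace Y) x) < \<epsilon>)" if "\<epsilon> > 0" for \<epsilon>
    using assms(2)[OF that] by auto
qed simp

lemma C0_plus:
  assumes f: "f \<in> carrier (C0 Y)" and g: "g \<in> carrier (C0 Y)"
  shows "(\<lambda>x\<in>topspace Y. f x + g x) \<in> carrier (C0 Y)"
proof (rule C0_restrictI)
  show "continuous_map Y euclidean (\<lambda>x. f x + g x)"
    using C0_continuous[OF f] C0_continuous[OF g] by (rule continuous_map_add)
  fix \<epsilon> :: real assume "\<epsilon> > 0"
  then have e: "\<epsilon>/2 > 0" by simp
  obtain K where K: "compactin Y K" "\<And>x. x \<in> topspace Y \<Longrightarrow> x \<notin> K \<Longrightarrow> norm (f x) < \<epsilon>/2"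
    using C0_vanishes[OF f e] by blast
  obtain L where L: "compactin Y L" "\<And>x. x \<in> topspace Y \<Longrightarrow> x \<notin> L \<Longrightarrow> norm (g x) < \<epsilon>/2"
    using C0_vanishes[OF g e] by blast
  have "norm (f x + g x) < \<epsilon>" if "x \<in> topspace Y - (K \<union> L)" for x
    using norm_triangle_ineq[of "f x" "g x"] K(2)[of x] L(2)[of x] that by auto
  then show "\<exists>K. compactin Y K \<and> (\<forall>x\<in>topspace Y - K. norm (f x + g x) < \<epsilon>)"
    using compactin_Un[OF K(1) L(1)] by blast
qed

lemma C0_mult_bounded:
  assumes f: "f \<in> carrier (C0 Y)" and g: "continuous_map Y euclidean g" "\<And>x. x \<in> topspace Y \<Longrightarrow> norm (g x) \<le> C"
  shows "(\<lambda>x\<in>topspace Y. f x * g x) \<in> carrier (C0 Y)"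
proof (rule C0_restrictI)
  have "continuous_map Y (prod_topology euclidean euclidean) (\<lambda>x. (f x, g x))"
    unfolding continuous_map_pairwise using C0_continuous[OF f] g(1) by (simp add: o_def)
  then have "continuous_map Y euclidean (\<lambda>x. (f x, g x))"
    by simp
  moreover have "continuous_map euclidean euclidean (\<lambda>z. fst z * snd z :: complex)"
    by (auto intro!: continuous_intros)
  ultimately have "continuous_map Y euclidean ((\<lambda>z. fst z * snd z) \<circ> (\<lambda>x. (f x, g x)))"
    by (rule continuous_map_compose)
  then show "continuous_map Y euclidean (\<lambda>x. f x * g x)" by (simp add: o_def)
  fix \<epsilon> :: real assume "\<epsilon> > 0"
  then have e: "\<epsilon>/(\<bar>C\<bar> + 1) > 0" by simp
  obtain K where K: "compactin Y K" "\<And>x. x \<in> topspace Y \<Longrightarrow> x \<notin> K \<Longrightarrow> norm (f x) < \<epsilon>/(\<bar>C\<bar> + 1)"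
    using C0_vanishes[OF f e] by blast
  have "norm (f x * g x) < \<epsilon>" if x: "x \<in> topspace Y - K" for x
  proof -
    have 1: "norm (f x) * (\<bar>C\<bar> + 1) < \<epsilon>" using K(2)[of x] x by (simp add: pos_less_divide_eq)
    have "norm (g x) \<le> \<bar>C\<bar> + 1" using g(2)[of x] x by auto
    then have "norm (f x) * norm (g x) \<le> norm (f x) * (\<bar>C\<bar> + 1)"
      by (rule mult_left_mono) simp
    then show ?thesis using 1 by (simp add: norm_mult)
  qed
  then show "\<exists>K. compactin Y K \<and> (\<forall>x\<in>topspace Y - K. norm (f x * g x) < \<epsilon>)"
    using K(1) by blast
qed

lemma C0_times:
  assumes f: "f \<in> carrier (C0 Y)" and g: "g \<in> carrier (C0 Y)"
  shows "(\<lambda>x\<in>topspace Y. f x * g x) \<in> carrier (C0 Y)"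
  using C0_bounded[OF g] C0_mult_bounded[OF f C0_continuous[OF g]] by metis

lemma C0_scale:
  assumes f: "f \<in> carrier (C0 Y)"
  shows "(\<lambda>x\<in>topspace Y. c * f x) \<in> carrier (C0 Y)"
  using C0_mult_bounded[OF f, of "\<lambda>x. c" "norm c"] by (simp add: mult.commute)

lemma C0_uniform_limit:
  fixes f :: "nat \<Rightarrow> 'b \<Rightarrow> complex"
  assumes f: "\<And>k. f k \<in> carrier (C0 Y)" and e: "e \<longlonglongrightarrow> 0"
    and lim: "\<And>k x. x \<in> topspace Y \<Longrightarrow> norm (h x - f k x) \<le> e k"
  shows "restrict h (topspace Y) \<in> carrier (C0 Y)"
proof (rule C0_restrictI)
  have close: "\<exists>k. \<forall>x\<in>topspace Y. norm (h x - f k x) < \<epsilon>" if eps: "\<epsilon> > 0" for \<epsilon>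
  proof -
    obtain k where "e k < \<epsilon>"
      using order_tendstoD(2)[OF e eps] by (metis eventually_sequentially order_refl)
    then show ?thesis using lim by (meson le_less_trans)
  qed
  show "continuous_map Y euclidean h"
    unfolding continuous_map_metric_iff
  proof (intro ballI allI impI)
    fix x and \<epsilon> :: real assume x: "x \<in> topspace Y" and "\<epsilon> > 0"
    then obtain k where k: "\<forall>x\<in>topspace Y. norm (h x - f k x) < \<epsilon>/3" using close[of "\<epsilon>/3"] by auto
    obtain U where U: "openin Y U" "x \<in> U" "\<forall>y\<in>U. dist (f k x) (f k y) < \<epsilon>/3"
      using C0_continuous[OF f[of k]] x \<open>\<epsilon> > 0\<close> unfolding continuous_map_metric_iff
      by (meson divide_pos_pos zero_less_numeral)
    have "dist (h x) (h y) < \<epsilon>" if "y \<in> U" for y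
    proof -
      have "y \<in> topspace Y" using U(1) that openin_subset by blast
      then have "dist (h x) (f k x) < \<epsilon>/3" "dist (h y) (f k y) < \<epsilon>/3" "dist (f k x) (f k y) < \<epsilon>/3"
        using k x U(3) that by (auto simp: dist_norm)
      then show ?thesis by (smt (verit) dist_commute dist_triangle field_sum_of_halves dist_triangle_third)
    qed
    then show "\<exists>U. openin Y U \<and> x \<in> U \<and> (\<forall>y\<in>U. dist (h x) (h y) < \<epsilon>)" using U(1,2) by blast
  qed
  fix \<epsilon> :: real assume "\<epsilon> > 0"
  then obtain k where k: "\<forall>x\<in>topspace Y. norm (h x - f k x) < \<epsilon>/2" using close[of "\<epsilon>/2"] by auto
  have "\<epsilon>/2 > 0" using \<open>\<epsilon> > 0\<close> by simp
  then obtain K where K: "compactin Y K" "\<And>x. x \<in> topspace Y \<Longrightarrow> x \<notin> K \<Longrightarrow> norm (f k x) < \<epsilon>/2"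
    using C0_vanishes[OF f[of k]] by blast
  have "norm (h x) < \<epsilon>" if "x \<in> topspace Y - K" for x
    using k[rule_format, of x] K(2)[of x] that norm_triangle_ineq[of "h x - f k x" "f k x"] by auto
  then show "\<exists>K. compactin Y K \<and> (\<forall>x\<in>topspace Y - K. norm (h x) < \<epsilon>)" using K(1) by blast
qed

lemma sup_norm_upper:
  assumes "\<And>x. x \<in> topspace Y \<Longrightarrow> norm (f x) \<le> C" and "x \<in> topspace Y"
  shows "norm (f x) \<le> sup_norm Y f"
  unfolding sup_norm_def
proof (rule cSup_upper)
  show "bdd_above (insert 0 ((\<lambda>x. norm (f x)) ` topspace Y))"
    using assms(1) by (auto simp: bdd_above_def intro!: exI[of _ "max 0 C"] le_max_iff_disj[THEN iffD2])
qed (use assms(2) in simp)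

lemma sup_norm_least:
  assumes "C \<ge> 0" "\<And>x. x \<in> topspace Y \<Longrightarrow> norm (f x) \<le> C"
  shows "sup_norm Y f \<le> C"
  unfolding sup_norm_def by (rule cSup_least) (use assms in auto)

section \<open>The lifted measure\<close>

text \<open>A tower whose limit space carries a Radon measure lifted locally from a measure of full support on the base.\<close>

locale measured_tower = covering_tower X p Xt
  for X :: "nat \<Rightarrow> 'a topology" and p :: "nat \<Rightarrow> 'a \<Rightarrow> 'a" and Xt :: "(nat \<Rightarrow> 'a) topology" +
  fixes \<mu>\<^sub>0 :: "'a measure" and \<mu> :: "(nat \<Rightarrow> 'a) measure"
  assumes full0: "full_support (X 0) \<mu>\<^sub>0"
    and radon: "radon_measure Xt \<mu>" and lifted: "locally_lifted Xt (X 0) (coord 0) \<mu>\<^sub>0 \<mu>"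
begin

lemma space_\<mu>: "space \<mu> = topspace Xt"
  using radon by (simp add: radon_measure_def)

lemma sets_\<mu>: "sets \<mu> = sigma_sets (topspace Xt) {U. openin Xt U}"
  using radon by (simp add: radon_measure_def)

lemma openin_sets: "openin Xt U \<Longrightarrow> U \<in> sets \<mu>"
  unfolding sets_\<mu> by (rule sigma_sets.Basic) simp

lemma closedin_sets:
  assumes "closedin Xt C" shows "C \<in> sets \<mu>"
proof -
  have "topspace Xt - C \<in> sets \<mu>" using assms by (intro openin_sets) (simp add: closedin_def)
  then have "space \<mu> - (topspace Xt - C) \<in> sets \<mu>" by (rule sets.compl_sets)
  moreover have "space \<mu> - (topspace Xt - C) = C"
    using closedin_subset[OF assms] by (auto simp: space_\<mu>)
  ultimately show ?thesis by simp
qed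

lemma compactin_sets: "compactin Xt K \<Longrightarrow> K \<in> sets \<mu>"
  by (rule closedin_sets[OF compactin_imp_closedin[OF Hausdorff_Xt]])

lemma compactin_finite: "compactin Xt K \<Longrightarrow> emeasure \<mu> K < \<infinity>"
  using radon by (simp add: radon_measure_def)

lemma inner_regular: "B \<in> sets \<mu> \<Longrightarrow> emeasure \<mu> B = (SUP K \<in> {K. compactin Xt K \<and> K \<subseteq> B}. emeasure \<mu> K)"
  using radon by (simp add: radon_measure_def)

lemma continuous_measurable:
  fixes f :: "(nat \<Rightarrow> 'a) \<Rightarrow> 'c::topological_space"
  assumes "continuous_map Xt euclidean f" shows "f \<in> borel_measurable \<mu>"
proof (rule borel_measurableI)
  fix S :: "'c set" assume "open S"
  then have "openin Xt {x \<in> topspace Xt. f x \<in> S}"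
    using openin_continuous_map_preimage[OF assms] by simp
  moreover have "f -` S \<inter> space \<mu> = {x \<in> topspace Xt. f x \<in> S}"
    by (auto simp: space_\<mu>)
  ultimately show "f -` S \<inter> space \<mu> \<in> sets \<mu>" using openin_sets by simp
qed

lemma G_measurable: "g \<in> carrier G \<Longrightarrow> g \<in> measurable \<mu> \<mu>"
proof (rule measurable_sigma_sets[OF sets_\<mu>])
  assume g: "g \<in> carrier G"
  show "{U. openin Xt U} \<subseteq> Pow (topspace Xt)" using openin_subset by blast
  show "g \<in> space \<mu> \<rightarrow> topspace Xt" using G_maps_to[OF g] by (simp add: space_\<mu>)
  fix W assume "W \<in> {U. openin Xt U}"
  then have "openin Xt {x \<in> topspace Xt. g x \<in> W}"
    using openin_continuous_map_preimage[OF G_continuous[OF g]] by simp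
  moreover have "g -` W \<inter> space \<mu> = {x \<in> topspace Xt. g x \<in> W}"
    by (auto simp: space_\<mu>)
  ultimately show "g -` W \<inter> space \<mu> \<in> sets \<mu>" using openin_sets by simp
qed

text \<open>By inner regularity null sets are detected on compact sets, hence locally.\<close>

lemma locally_null:
  assumes B: "B \<in> sets \<mu>" and loc: "\<And>x. x \<in> topspace Xt \<Longrightarrow> \<exists>V. openin Xt V \<and> x \<in> V \<and> B \<inter> V \<in> null_sets \<mu>"
  shows "B \<in> null_sets \<mu>"
proof -
  have "emeasure \<mu> K = 0" if K: "compactin Xt K" "K \<subseteq> B" for K
  proof -
    have KX: "K \<subseteq> topspace Xt" using K(1) by (rule compactin_subset_topspace)
    have "\<forall>x\<in>K. \<exists>V. openin Xt V \<and> x \<in> V \<and> B \<inter> V \<in> null_sets \<mu>" using loc KX by blast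
    then obtain V where V: "\<And>x. x \<in> K \<Longrightarrow> openin Xt (V x)" "\<And>x. x \<in> K \<Longrightarrow> x \<in> V x" "\<And>x. x \<in> K \<Longrightarrow> B \<inter> V x \<in> null_sets \<mu>"
      by metis
    have "\<exists>\<F>. finite \<F> \<and> \<F> \<subseteq> V ` K \<and> K \<subseteq> \<Union>\<F>"
      using K(1) V(1,2) by (intro compactinD) auto
    then obtain \<F> where F: "finite \<F>" "\<F> \<subseteq> V ` K" "K \<subseteq> \<Union>\<F>" by blast
    have "(\<Union>U\<in>\<F>. B \<inter> U) \<in> null_sets \<mu>"
      using F(1,2) V(3) by (intro null_sets_UN' countable_finite) auto
    moreover have "K \<subseteq> (\<Union>U\<in>\<F>. B \<inter> U)" using F(3) K(2) by blast
    ultimately have "K \<in> null_sets \<mu>"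
      using null_sets_subset compactin_sets[OF K(1)] by blast
    then show ?thesis by (simp add: null_sets_def)
  qed
  then have "emeasure \<mu> B \<le> 0"
    unfolding inner_regular[OF B] by (intro SUP_least) auto
  then show ?thesis using B by (simp add: null_sets_def)
qed

lemma AE_locally:
  assumes B: "{x \<in> space \<mu>. \<not> P x} \<in> sets \<mu>"
    and loc: "\<And>x. x \<in> topspace Xt \<Longrightarrow> \<exists>V. openin Xt V \<and> x \<in> V \<and> (AE y in \<mu>. y \<in> V \<longrightarrow> P y)"
  shows "AE x in \<mu>. P x"
proof -
  have "{x \<in> space \<mu>. \<not> P x} \<in> null_sets \<mu>"
  proof (rule locally_null[OF B])
    fix x assume "x \<in> topspace Xt"
    then obtain V where V: "openin Xt V" "x \<in> V" "AE y in \<mu>. y \<in> V \<longrightarrow> P y" using loc by blast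
    have m: "{x \<in> space \<mu>. \<not> P x} \<inter> V \<in> sets \<mu>" using B openin_sets[OF V(1)] by blast
    have eq: "{y \<in> space \<mu>. \<not> (y \<in> V \<longrightarrow> P y)} = {x \<in> space \<mu>. \<not> P x} \<inter> V" by auto
    have "{x \<in> space \<mu>. \<not> P x} \<inter> V \<in> null_sets \<mu>"
      using V(3) AE_iff_null[of \<mu> "\<lambda>y. y \<in> V \<longrightarrow> P y"] m unfolding eq by simp
    then show "\<exists>V. openin Xt V \<and> x \<in> V \<and> {x \<in> space \<mu>. \<not> P x} \<inter> V \<in> null_sets \<mu>"
      using V by blast
  qed
  then show ?thesis using AE_iff_null[OF B] by simp
qed

lemma special_emeasure:
  assumes V: "special_set X p V" and A: "A \<in> sets \<mu>" "A \<subseteq> V"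
  shows "emeasure \<mu> A = emeasure \<mu>\<^sub>0 (coord 0 ` A)"
  using lifted openin_special[OF V] special_homeomorphic[OF V, of 0] V A
  unfolding locally_lifted_def special_set_def by blast

lemma full_support_Xt:
  assumes "openin Xt U" "U \<noteq> {}" shows "emeasure \<mu> U > 0"
proof -
  obtain x where "x \<in> U" using assms(2) by blast
  then obtain V where V: "special_set X p V" "x \<in> V" "V \<subseteq> U"
    by (rule special_base[OF assms(1)])
  have oV: "openin Xt V" by (rule openin_special[OF V(1)])
  have "openin (X 0) (coord 0 ` V)" "coord 0 ` V \<noteq> {}"
    using V(1,2) by (auto simp: special_set_def)
  then have "emeasure \<mu>\<^sub>0 (coord 0 ` V) > 0" using full0 by (simp add: full_support_def)
  then have "emeasure \<mu> V > 0" using special_emeasure[OF V(1) openin_sets[OF oV]] by simp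
  then show ?thesis
    using emeasure_mono[OF V(3) openin_sets[OF assms(1)]] by (rule less_le_trans)
qed

lemma AE_continuous_le:
  fixes f h :: "(nat \<Rightarrow> 'a) \<Rightarrow> real"
  assumes f: "continuous_map Xt euclidean f" and h: "continuous_map Xt euclidean h" and V: "openin Xt V"
    and AE: "AE x in \<mu>. x \<in> V \<longrightarrow> f x \<le> h x" and x: "x \<in> V"
  shows "f x \<le> h x"
proof (rule ccontr)
  assume n: "\<not> f x \<le> h x"
  let ?D = "{y \<in> V. f y - h y \<in> {0<..}}"
  have "continuous_map Xt euclidean (\<lambda>y. f y - h y)" using f h by (rule continuous_map_diff)
  then have oD: "openin Xt ?D" using V by (rule openin_continuous_map_preimage_gen) simp
  have "{y \<in> space \<mu>. \<not> (y \<in> V \<longrightarrow> f y \<le> h y)} = ?D"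
    using openin_subset[OF V] by (auto simp: space_\<mu>)
  then have "emeasure \<mu> ?D = 0"
    using AE openin_sets[OF oD] AE_iff_measurable[of ?D \<mu> "\<lambda>y. y \<in> V \<longrightarrow> f y \<le> h y"] by simp
  moreover have "?D \<noteq> {}" using x n by auto
  ultimately show False using full_support_Xt[OF oD] by simp
qed

lemma AE_continuous_eq:
  fixes f h :: "(nat \<Rightarrow> 'a) \<Rightarrow> complex"
  assumes f: "continuous_map Xt euclidean f" and h: "continuous_map Xt euclidean h"
    and AE: "AE x in \<mu>. f x = h x" and x: "x \<in> topspace Xt"
  shows "f x = h x"
proof -
  have "continuous_map Xt euclidean (\<lambda>y. norm (f y - h y))"
    using continuous_map_norm[OF continuous_map_diff[OF f h]] .
  then have "norm (f x - h x) \<le> 0"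
    by (rule AE_continuous_le[OF _ _ openin_topspace _ x]) (use AE in \<open>auto elim: AE_mp\<close>)
  then show ?thesis by simp
qed

text \<open>The limit group preserves null sets: it permutes the special sets and commutes with the projection to
  the base, through which the measure of a subset of a special set is computed.\<close>

lemma G_null_sets:
  assumes g: "g \<in> carrier G" and N: "N \<in> null_sets \<mu>"
  shows "{x \<in> topspace Xt. g x \<in> N} \<in> null_sets \<mu>"
proof (rule locally_null)
  let ?B = "{x \<in> topspace Xt. g x \<in> N}"
  have "g -` N \<inter> space \<mu> \<in> sets \<mu>"
    using measurable_sets[OF G_measurable[OF g]] N by blast
  moreover have "g -` N \<inter> space \<mu> = ?B" by (auto simp: space_\<mu>)
  ultimately show B: "?B \<in> sets \<mu>" by simp
  fix x assume x: "x \<in> topspace Xt"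
  obtain V where V: "special_set X p V" "x \<in> V" "V \<subseteq> topspace Xt"
    by (rule special_base[OF openin_topspace x])
  have oV: "openin Xt V" by (rule openin_special[OF V(1)])
  have gV: "special_set X p (g ` V)" by (rule special_translate[OF V(1) g])
  have ogV: "openin Xt (g ` V)" by (rule openin_special[OF gV])
  have Ns: "N \<in> sets \<mu>" using N by blast
  have m: "?B \<inter> V \<in> sets \<mu>" "N \<inter> g ` V \<in> sets \<mu>"
    using B Ns openin_sets[OF oV] openin_sets[OF ogV] by blast+
  have g0: "g y 0 = y 0" if "y \<in> topspace Xt" for y
    using g that J_0 limit_kernel_iff[of g 0] by blast
  have "coord 0 ` (?B \<inter> V) = coord 0 ` (N \<inter> g ` V)"
  proof (intro equalityI subsetI)
    fix z assume "z \<in> coord 0 ` (?B \<inter> V)"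
    then obtain y where y: "y \<in> ?B \<inter> V" "z = y 0" by (rule imageE)
    then have "g y \<in> N \<inter> g ` V" "z = g y 0" using g0[of y] by auto
    then show "z \<in> coord 0 ` (N \<inter> g ` V)" by simp
  next
    fix z assume "z \<in> coord 0 ` (N \<inter> g ` V)"
    then obtain w where w: "w \<in> N \<inter> g ` V" "z = w 0" by (rule imageE)
    then obtain y where y: "y \<in> V" "w = g y" by blast
    then have "y \<in> ?B \<inter> V" "z = y 0" using w V(3) g0[of y] by auto
    then show "z \<in> coord 0 ` (?B \<inter> V)" by simp
  qed
  then have "emeasure \<mu> (?B \<inter> V) = emeasure \<mu> (N \<inter> g ` V)"
    using special_emeasure[OF V(1) m(1)] special_emeasure[OF gV m(2)] by simp
  also have "\<dots> = 0"
    using emeasure_mono[OF Int_lower1 Ns, of "g ` V"] N by (auto simp: null_sets_def)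
  finally have "?B \<inter> V \<in> null_sets \<mu>" using m(1) by (simp add: null_sets_def)
  then show "\<exists>V. openin Xt V \<and> x \<in> V \<and> ?B \<inter> V \<in> null_sets \<mu>"
    using oV V(2) by blast
qed

lemma AE_G:
  assumes g: "g \<in> carrier G" and AE: "AE x in \<mu>. P x"
  shows "AE x in \<mu>. P (g x)"
proof -
  obtain N where N: "{x \<in> space \<mu>. \<not> P x} \<subseteq> N" "N \<in> null_sets \<mu>"
    using AE by (auto simp: eventually_ae_filter)
  show ?thesis
  proof (rule AE_I'[OF G_null_sets[OF g N(2)]])
    show "{x \<in> space \<mu>. \<not> P (g x)} \<subseteq> {x \<in> topspace Xt. g x \<in> N}"
      using N(1) G_maps_to[OF g] by (auto simp: space_\<mu>)
  qed
qed

section \<open>Embedding of the continuous functions\<close>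

lemma C0_ess_bounded:
  assumes f: "f \<in> carrier (C0 Xt)" shows "f \<in> ess_bounded \<mu>"
proof -
  obtain C where C: "C \<ge> 0" "\<And>x. x \<in> topspace Xt \<Longrightarrow> norm (f x) \<le> C" using C0_bounded[OF f] by blast
  then have "AE x in \<mu>. norm (f x) \<le> C" by (intro AE_I2) (simp add: space_\<mu>)
  then show ?thesis using continuous_measurable[OF C0_continuous[OF f]] by (intro ess_boundedI)
qed

lemma Linf_class_restrict: "Linf_class \<mu> (restrict f (topspace Xt)) = Linf_class \<mu> f"
  by (rule Linf_class_cong, rule AE_I2) (simp add: space_\<mu>)

lemma C0_Linf_norm:
  assumes f: "f \<in> carrier (C0 Xt)"
  shows "norm_of (Linf \<mu>) (Linf_class \<mu> f) = sup_norm Xt f"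
proof (rule antisym)
  obtain C where C: "C \<ge> 0" "\<And>x. x \<in> topspace Xt \<Longrightarrow> norm (f x) \<le> C" using C0_bounded[OF f] by blast
  have "sup_norm Xt f \<ge> 0"
    unfolding sup_norm_def
    by (rule cSup_upper) (use C in \<open>auto simp: bdd_above_def intro!: exI[of _ C]\<close>)
  then show "norm_of (Linf \<mu>) (Linf_class \<mu> f) \<le> sup_norm Xt f"
    by (intro Linf_norm_le[OF C0_ess_bounded[OF f]] AE_I2 sup_norm_upper[OF C(2)]) (auto simp: space_\<mu>)
  have n0: "norm_of (Linf \<mu>) (Linf_class \<mu> f) \<ge> 0"
    unfolding Linf_norm[OF C0_ess_bounded[OF f]] by simp
  have "norm (f x) \<le> norm_of (Linf \<mu>) (Linf_class \<mu> f)" if x: "x \<in> topspace Xt" for x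
  proof (rule AE_continuous_le[OF _ _ openin_topspace _ x])
    show "continuous_map Xt euclidean (\<lambda>x. norm (f x))"
      by (rule continuous_map_norm[OF C0_continuous[OF f]])
    show "AE x in \<mu>. x \<in> topspace Xt \<longrightarrow> norm (f x) \<le> norm_of (Linf \<mu>) (Linf_class \<mu> f)"
      using Linf_norm_AE[OF C0_ess_bounded[OF f]] by eventually_elim simp
  qed simp
  then show "sup_norm Xt f \<le> norm_of (Linf \<mu>) (Linf_class \<mu> f)"
    by (rule sup_norm_least[OF n0])
qed

abbreviation "C0_image \<equiv> Linf_class \<mu> ` carrier (C0 Xt)"

lemma C0_image_subalgebra: "is_subalgebra (Linf \<mu>) C0_image"
  unfolding is_subalgebra_def is_linear_subspace_def
proof (intro conjI ballI allI)
  show "C0_image \<subseteq> carrier (Linf \<mu>)"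
    using C0_ess_bounded by (intro image_subsetI) (unfold Linf_carrier, blast)
  have "continuous_map Xt euclidean (\<lambda>x. 0::complex)" by simp
  then have "restrict (\<lambda>x. 0) (topspace Xt) \<in> carrier (C0 Xt)"
    by (rule C0_restrictI) (auto intro: compactin_empty)
  then show "C0_image \<noteq> {}" by blast
next
  fix a b assume "a \<in> C0_image" "b \<in> C0_image"
  then obtain f g where f: "f \<in> carrier (C0 Xt)" "a = Linf_class \<mu> f" and g: "g \<in> carrier (C0 Xt)" "b = Linf_class \<mu> g" by blast
  show "plus_of (Linf \<mu>) a b \<in> C0_image"
    unfolding f g Linf_plus[OF C0_ess_bounded[OF f(1)] C0_ess_bounded[OF g(1)]]
    using C0_plus[OF f(1) g(1)] Linf_class_restrict by (metis image_eqI)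
  show "times_of (Linf \<mu>) a b \<in> C0_image"
    unfolding f g Linf_times[OF C0_ess_bounded[OF f(1)] C0_ess_bounded[OF g(1)]]
    using C0_times[OF f(1) g(1)] Linf_class_restrict by (metis image_eqI)
next
  fix c a assume "a \<in> C0_image"
  then obtain f where f: "f \<in> carrier (C0 Xt)" "a = Linf_class \<mu> f" by blast
  show "scale_of (Linf \<mu>) c a \<in> C0_image"
    unfolding f Linf_scale[OF C0_ess_bounded[OF f(1)]]
    using C0_scale[OF f(1)] Linf_class_restrict by (metis image_eqI)
qed

lemma Linf_diff:
  assumes f: "f \<in> ess_bounded \<mu>" and g: "g \<in> ess_bounded \<mu>"
  shows "plus_of (Linf \<mu>) (Linf_class \<mu> f) (scale_of (Linf \<mu>) (-1) (Linf_class \<mu> g)) = Linf_class \<mu> (\<lambda>x. f x - g x)"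
  unfolding Linf_scale[OF g] Linf_plus[OF f ess_bounded_scale[OF g]] by simp

lemma ess_bounded_diff:
  assumes f: "f \<in> ess_bounded M" and g: "g \<in> ess_bounded M"
  shows "(\<lambda>x. f x - g x) \<in> ess_bounded M"
  using ess_bounded_add[OF f ess_bounded_scale[OF g, of "-1"]] by simp

lemma C0_image_closed: "norm_closure (Linf \<mu>) C0_image \<subseteq> C0_image"
proof
  fix A assume A: "A \<in> norm_closure (Linf \<mu>) C0_image"
  then obtain f where f: "f \<in> ess_bounded \<mu>" "A = Linf_class \<mu> f"
    by (auto simp: norm_closure_def Linf_carrier)
  let ?e = "\<lambda>k::nat. inverse (real (Suc k))"
  have "\<exists>h. h \<in> carrier (C0 Xt) \<and> (AE x in \<mu>. norm (f x - h x) \<le> ?e k)" for k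
  proof -
    have "?e k > 0" by simp
    then obtain B where B: "B \<in> C0_image" "norm_of (Linf \<mu>) (plus_of (Linf \<mu>) A (scale_of (Linf \<mu>) (-1) B)) < ?e k"
      using A unfolding norm_closure_def by blast
    then obtain h where h: "h \<in> carrier (C0 Xt)" "B = Linf_class \<mu> h" by blast
    have hb: "h \<in> ess_bounded \<mu>" by (rule C0_ess_bounded[OF h(1)])
    have "norm_of (Linf \<mu>) (Linf_class \<mu> (\<lambda>x. f x - h x)) < ?e k"
      using B(2) unfolding f(2) h(2) Linf_diff[OF f(1) hb] .
    then have "AE x in \<mu>. norm (f x - h x) \<le> ?e k"
      using Linf_norm_AE[OF ess_bounded_diff[OF f(1) hb]] by (auto elim: AE_mp)
    then show ?thesis using h(1) by blast
  qed
  then obtain h where h: "\<And>k. h k \<in> carrier (C0 Xt)" "\<And>k. AE x in \<mu>. norm (f x - h k x) \<le> ?e k"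
    by metis
  have cauchy: "norm (h k x - h l x) \<le> ?e k + ?e l" if x: "x \<in> topspace Xt" for k l x
  proof (rule AE_continuous_le[OF _ _ openin_topspace _ x])
    show "continuous_map Xt euclidean (\<lambda>x. norm (h k x - h l x))"
      by (intro continuous_map_norm continuous_map_diff C0_continuous h)
    show "AE x in \<mu>. x \<in> topspace Xt \<longrightarrow> norm (h k x - h l x) \<le> ?e k + ?e l"
      using h(2)[of k] h(2)[of l]
    proof eventually_elim
      case (elim x)
      have "norm (h k x - h l x) \<le> norm (f x - h k x) + norm (f x - h l x)"
        using norm_triangle_ineq4[of "f x - h l x" "f x - h k x"] by simp
      then show ?case using elim by linarith
    qed
  qed simp
  have e0: "?e \<longlonglongrightarrow> 0" by (rule LIMSEQ_inverse_real_of_nat)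
  have "\<exists>l. (\<lambda>k. h k x) \<longlonglongrightarrow> l" if x: "x \<in> topspace Xt" for x
  proof -
    have "Cauchy (\<lambda>k. h k x)"
    proof (rule metric_CauchyI)
      fix \<epsilon> :: real assume "\<epsilon> > 0"
      then have "\<forall>\<^sub>F k in sequentially. ?e k < \<epsilon>/2" using order_tendstoD(2)[OF e0, of "\<epsilon>/2"] by simp
      then obtain K where K: "\<And>k. k \<ge> K \<Longrightarrow> ?e k < \<epsilon>/2" unfolding eventually_sequentially by blast
      have "dist (h m x) (h n x) < \<epsilon>" if "m \<ge> K" "n \<ge> K" for m n
        using cauchy[OF x, of m n] K[OF that(1)] K[OF that(2)] by (simp add: dist_norm)
      then show "\<exists>M. \<forall>m\<ge>M. \<forall>n\<ge>M. dist (h m x) (h n x) < \<epsilon>" by blast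
    qed
    then show ?thesis using Cauchy_convergent_iff convergent_def by blast
  qed
  then obtain l where l: "\<And>x. x \<in> topspace Xt \<Longrightarrow> (\<lambda>k. h k x) \<longlonglongrightarrow> l x" by metis
  have lim: "norm (l x - h k x) \<le> ?e k" if x: "x \<in> topspace Xt" for k x
  proof (rule LIMSEQ_le)
    show "(\<lambda>m. norm (h m x - h k x)) \<longlonglongrightarrow> norm (l x - h k x)"
      by (intro tendsto_intros l x)
    show "(\<lambda>m. ?e m + ?e k) \<longlonglongrightarrow> ?e k"
      using tendsto_add[OF e0 tendsto_const[of "?e k"]] by simp
    show "\<exists>N. \<forall>n\<ge>N. norm (h n x - h k x) \<le> ?e n + ?e k" using cauchy[OF x] by blast
  qed
  have lC: "restrict l (topspace Xt) \<in> carrier (C0 Xt)"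
    by (rule C0_uniform_limit[OF h(1) e0 lim])
  have "AE x in \<mu>. \<forall>k. norm (f x - h k x) \<le> ?e k"
    using h(2) by (simp add: AE_all_countable)
  then have "AE x in \<mu>. f x = l x"
  proof (rule AE_mp, intro AE_I2 impI)
    fix x assume x: "x \<in> space \<mu>" "\<forall>k. norm (f x - h k x) \<le> ?e k"
    have "(\<lambda>k. f x - h k x) \<longlonglongrightarrow> 0"
      by (rule Lim_null_comparison[OF _ e0]) (use x(2) in simp)
    then have "(\<lambda>k. h k x) \<longlonglongrightarrow> f x"
      using tendsto_diff[OF tendsto_const[of "f x"]] by fastforce
    then show "f x = l x" using l x(1) LIMSEQ_unique unfolding space_\<mu> by blast
  qed
  then have "A = Linf_class \<mu> (restrict l (topspace Xt))"
    unfolding f(2) Linf_class_restrict by (rule Linf_class_cong)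
  then show "A \<in> C0_image" using lC by blast
qed

lemma norm_closure_mono: "S \<subseteq> S' \<Longrightarrow> norm_closure A S \<subseteq> norm_closure A S'"
  unfolding norm_closure_def by blast

lemma special_function_ess_bounded: "special_function X p \<mu> a \<Longrightarrow> a \<in> ess_bounded \<mu>"
  by (simp add: special_function_def)

lemma linear_hull_sum:
  assumes "finite I" "\<And>i. i \<in> I \<Longrightarrow> special_function X p \<mu> (a i)"
  shows "Linf_class \<mu> (\<lambda>x. \<Sum>i\<in>I. c i * a i x) \<in> is_linear_subspace (Linf \<mu>) hull special_elements X p \<mu>"
  unfolding hull_def
proof (rule InterI, clarify)
  fix S assume S: "is_linear_subspace (Linf \<mu>) S" and sub: "special_elements X p \<mu> \<subseteq> S"
  have "(\<lambda>x. \<Sum>i\<in>I. c i * a i x) \<in> ess_bounded \<mu> \<and> Linf_class \<mu> (\<lambda>x. \<Sum>i\<in>I. c i * a i x) \<in> S"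
    using assms
  proof (induction I rule: finite_induct)
    case empty
    obtain A where A: "A \<in> S" using S unfolding is_linear_subspace_def by blast
    then have "A \<in> carrier (Linf \<mu>)" using S unfolding is_linear_subspace_def by blast
    then obtain f where f: "f \<in> ess_bounded \<mu>" "A = Linf_class \<mu> f" unfolding Linf_carrier by blast
    have "scale_of (Linf \<mu>) 0 A \<in> S" using S A unfolding is_linear_subspace_def by blast
    then show ?case unfolding f(2) Linf_scale[OF f(1)] by (simp add: ess_bounded_const)
  next
    case (insert i I)
    have 1: "a i \<in> ess_bounded \<mu>" using insert.prems special_function_ess_bounded by blast
    have "Linf_class \<mu> (a i) \<in> S"
      using sub insert.prems unfolding special_elements_def by blast
    then have "scale_of (Linf \<mu>) (c i) (Linf_class \<mu> (a i)) \<in> S"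
      using S unfolding is_linear_subspace_def by blast
    then have 2: "Linf_class \<mu> (\<lambda>x. c i * a i x) \<in> S" unfolding Linf_scale[OF 1] .
    have IH: "(\<lambda>x. \<Sum>i\<in>I. c i * a i x) \<in> ess_bounded \<mu>" "Linf_class \<mu> (\<lambda>x. \<Sum>i\<in>I. c i * a i x) \<in> S"
      using insert by blast+
    have "plus_of (Linf \<mu>) (Linf_class \<mu> (\<lambda>x. c i * a i x)) (Linf_class \<mu> (\<lambda>x. \<Sum>i\<in>I. c i * a i x)) \<in> S"
      using S 2 IH(2) unfolding is_linear_subspace_def by blast
    then show ?case
      unfolding Linf_plus[OF ess_bounded_scale[OF 1] IH(1)]
      using ess_bounded_add[OF ess_bounded_scale[OF 1] IH(1)] insert.hyps by simp
  qed
  then show "Linf_class \<mu> (\<lambda>x. \<Sum>i\<in>I. c i * a i x) \<in> S" by blast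
qed

text \<open>The isomorphism, given that the special elements are classes of functions in \<open>C\<^sub>0(Xt)\<close> and that the
  functions in their linear hull approximate all of \<open>C\<^sub>0(Xt)\<close> uniformly.\<close>

theorem C0_isomorphism:
  assumes sub: "special_elements X p \<mu> \<subseteq> C0_image"
    and dense: "\<And>f \<epsilon>. f \<in> carrier (C0 Xt) \<Longrightarrow> \<epsilon> > 0 \<Longrightarrow> \<exists>h \<in> ess_bounded \<mu>.
        Linf_class \<mu> h \<in> is_linear_subspace (Linf \<mu>) hull special_elements X p \<mu> \<and>
        (\<forall>x\<in>topspace Xt. norm (f x - h x) \<le> \<epsilon>)"
  shows "cstar_isomorphism (C0 Xt) (nc_inverse_limit X p \<mu>) (Linf_class \<mu>)"
proof -
  let ?L = "is_linear_subspace (Linf \<mu>) hull special_elements X p \<mu>"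
  let ?H = "is_subalgebra (Linf \<mu>) hull ?L"
  have "?L \<subseteq> C0_image"
    using sub C0_image_subalgebra by (intro hull_minimal) (auto simp: is_subalgebra_def)
  then have "?H \<subseteq> C0_image"
    using C0_image_subalgebra by (rule hull_minimal)
  then have 1: "norm_closure (Linf \<mu>) ?H \<subseteq> C0_image"
    using norm_closure_mono C0_image_closed by blast
  have "C0_image \<subseteq> norm_closure (Linf \<mu>) ?H"
  proof (rule image_subsetI)
    fix f assume f: "f \<in> carrier (C0 Xt)"
    have fb: "f \<in> ess_bounded \<mu>" by (rule C0_ess_bounded[OF f])
    show "Linf_class \<mu> f \<in> norm_closure (Linf \<mu>) ?H"
      unfolding norm_closure_def
    proof (intro CollectI conjI allI impI)
      show "Linf_class \<mu> f \<in> carrier (Linf \<mu>)" using fb by (auto simp: Linf_carrier)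
      fix \<epsilon> :: real assume "\<epsilon> > 0"
      then obtain h where h: "h \<in> ess_bounded \<mu>" "Linf_class \<mu> h \<in> ?L" "\<forall>x\<in>topspace Xt. norm (f x - h x) \<le> \<epsilon>/2"
        using dense[OF f, of "\<epsilon>/2"] by auto
      have "AE x in \<mu>. norm (f x - h x) \<le> \<epsilon>/2"
        using h(3) by (intro AE_I2) (simp add: space_\<mu>)
      then have "norm_of (Linf \<mu>) (Linf_class \<mu> (\<lambda>x. f x - h x)) \<le> \<epsilon>/2"
        using \<open>\<epsilon> > 0\<close> by (intro Linf_norm_le[OF ess_bounded_diff[OF fb h(1)]]) auto
      then have "norm_of (Linf \<mu>) (plus_of (Linf \<mu>) (Linf_class \<mu> f) (scale_of (Linf \<mu>) (-1) (Linf_class \<mu> h))) < \<epsilon>"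
        unfolding Linf_diff[OF fb h(1)] using \<open>\<epsilon> > 0\<close> by linarith
      moreover have "Linf_class \<mu> h \<in> ?H" using h(2) by (rule hull_inc)
      ultimately show "\<exists>y\<in>?H. norm_of (Linf \<mu>) (plus_of (Linf \<mu>) (Linf_class \<mu> f) (scale_of (Linf \<mu>) (-1) y)) < \<epsilon>"
        by blast
    qed
  qed
  with 1 have car: "carrier (nc_inverse_limit X p \<mu>) = C0_image"
    by (simp add: nc_inverse_limit_def)
  have ops: "plus_of (nc_inverse_limit X p \<mu>) = plus_of (Linf \<mu>)" "times_of (nc_inverse_limit X p \<mu>) = times_of (Linf \<mu>)"
    "scale_of (nc_inverse_limit X p \<mu>) = scale_of (Linf \<mu>)" "star_of (nc_inverse_limit X p \<mu>) = star_of (Linf \<mu>)"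
    "norm_of (nc_inverse_limit X p \<mu>) = norm_of (Linf \<mu>)"
    by (simp_all add: nc_inverse_limit_def)
  have C0_ops: "plus_of (C0 Xt) = (\<lambda>f g. \<lambda>x\<in>topspace Xt. f x + g x)" "times_of (C0 Xt) = (\<lambda>f g. \<lambda>x\<in>topspace Xt. f x * g x)"
    "scale_of (C0 Xt) = (\<lambda>c f. \<lambda>x\<in>topspace Xt. c * f x)" "star_of (C0 Xt) = (\<lambda>f. \<lambda>x\<in>topspace Xt. cnj (f x))"
    "norm_of (C0 Xt) = sup_norm Xt"
    by (simp_all add: C0_def)
  have inj: "inj_on (Linf_class \<mu>) (carrier (C0 Xt))"
  proof (rule inj_onI)
    fix f g assume f: "f \<in> carrier (C0 Xt)" and g: "g \<in> carrier (C0 Xt)" and eq: "Linf_class \<mu> f = Linf_class \<mu> g"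
    have ae: "AE x in \<mu>. f x = g x"
      using eq unfolding Linf_class_eq_iff[OF C0_ess_bounded[OF f]] .
    show "f = g"
    proof (rule extensionalityI)
      show "f \<in> extensional (topspace Xt)" "g \<in> extensional (topspace Xt)" using f g by (auto simp: C0_iff)
      show "f x = g x" if "x \<in> topspace Xt" for x
        by (rule AE_continuous_eq[OF C0_continuous[OF f] C0_continuous[OF g] ae that])
    qed
  qed
  show ?thesis
    unfolding cstar_isomorphism_def car ops C0_ops Linf_class_restrict
    using inj C0_ess_bounded C0_Linf_norm
    by (simp add: bij_betw_def Linf_plus Linf_times Linf_scale Linf_star)
qed

end

section \<open>Special functions supported in special sets\<close>

context measured_tower
begin

text \<open>Inner regularity carries over to finite measures with a density: the set where \<open>f\<close> lies between
  \<open>1 / (k + 1)\<close> and \<open>k + 1\<close> has finite measure and, for large \<open>k\<close>, carries most of the integral.\<close>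

lemma integrable_concentrated_on_compact:
  assumes f: "integrable \<mu> f" and pos: "\<And>x. f x \<ge> (0::real)" and "\<epsilon> > 0"
  obtains K where "compactin Xt K" "(\<integral>x. f x * indicator (- K) x \<partial>\<mu>) < \<epsilon>"
proof -
  define A where "A k = {x \<in> space \<mu>. inverse (real (Suc k)) \<le> f x \<and> f x \<le> real (Suc k)}" for k
  have fm: "f \<in> borel_measurable \<mu>" using f by (rule borel_measurable_integrable)
  have Am: "A k \<in> sets \<mu>" for k unfolding A_def using fm by measurable
  have "(\<lambda>k. \<integral>x. f x * indicator (- A k) x \<partial>\<mu>) \<longlonglongrightarrow> (\<integral>x. 0 \<partial>\<mu>)"
  proof (rule integral_dominated_convergence[where w = f])
    show "(\<lambda>x. f x * indicator (- A k) x) \<in> borel_measurable \<mu>" for k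
      using fm Am[of k] by (intro borel_measurable_times borel_measurable_indicator') (auto simp: Compl_eq_Diff_UNIV intro: sets.Diff)
    show "AE x in \<mu>. (\<lambda>k. f x * indicator (- A k) x) \<longlonglongrightarrow> 0"
    proof (rule AE_I2)
      fix x assume x: "x \<in> space \<mu>"
      show "(\<lambda>k. f x * indicator (- A k) x) \<longlonglongrightarrow> 0"
      proof (cases "f x = 0")
        case False
        then have fx: "f x > 0" using pos[of x] by simp
        obtain m where m: "inverse (real (Suc m)) < f x" using reals_Archimedean[OF fx] by blast
        obtain n where n: "f x \<le> real n" using real_arch_simple by blast
        have "x \<in> A k" if "k \<ge> max m n" for k
        proof -
          have "inverse (real (Suc k)) \<le> inverse (real (Suc m))" using that by (intro le_imp_inverse_le) auto
          then have "inverse (real (Suc k)) \<le> f x" using m by linarith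
          moreover have "f x \<le> real (Suc k)" using n that by linarith
          ultimately show ?thesis using x unfolding A_def by blast
        qed
        then have "\<forall>\<^sub>F k in sequentially. f x * indicator (- A k) x = 0"
          by (intro eventually_sequentiallyI[of "max m n"]) simp
        then show ?thesis by (rule tendsto_eventually)
      qed simp
    qed
    show "AE x in \<mu>. norm (f x * indicator (- A k) x) \<le> f x" for k
      using pos by (intro AE_I2) (auto simp: indicator_def)
  qed (use f in auto)
  then have "\<forall>\<^sub>F k in sequentially. (\<integral>x. f x * indicator (- A k) x \<partial>\<mu>) < \<epsilon>/2"
    using order_tendstoD(2)[of _ "0::real" sequentially "\<epsilon>/2"] \<open>\<epsilon> > 0\<close> by simp
  then obtain k where k: "(\<integral>x. f x * indicator (- A k) x \<partial>\<mu>) < \<epsilon>/2"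
    unfolding eventually_sequentially by blast
  have "emeasure \<mu> (A k) \<le> emeasure \<mu> {x \<in> space \<mu>. inverse (real (Suc k)) \<le> f x}"
    unfolding A_def using fm by (intro emeasure_mono) auto
  also have "\<dots> \<le> ennreal (1 / inverse (real (Suc k)) * (\<integral>x. f x \<partial>\<mu>))"
    by (rule integral_Markov_inequality[OF f]) (use pos in auto)
  also have "\<dots> < \<infinity>" by simp
  finally have fin: "emeasure \<mu> (A k) < \<infinity>" .
  \<comment> \<open>On this set \<open>f\<close> is at most \<open>k + 1\<close>, so removing a set of measure \<open>\<eta>\<close> costs at most \<open>\<epsilon>/4\<close>.\<close>
  define \<eta> where "\<eta> = \<epsilon> / (2 * real (Suc k)) / 2"
  have "\<eta> > 0" using \<open>\<epsilon> > 0\<close> by (simp add: \<eta>_def)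
  have "\<exists>K. compactin Xt K \<and> K \<subseteq> A k \<and> measure \<mu> (A k) - \<eta> \<le> measure \<mu> K"
  proof (cases "measure \<mu> (A k) - \<eta> \<le> 0")
    case True
    then show ?thesis by (intro exI[of _ "{}"]) simp
  next
    case False
    have "ennreal (measure \<mu> (A k) - \<eta>) < emeasure \<mu> (A k)"
      unfolding emeasure_eq_ennreal_measure[OF less_imp_neq[OF fin, unfolded infinity_ennreal_def]]
      using False \<open>\<eta> > 0\<close> by (intro ennreal_lessI) auto
    then obtain K where K: "compactin Xt K" "K \<subseteq> A k" "ennreal (measure \<mu> (A k) - \<eta>) < emeasure \<mu> K"
      unfolding inner_regular[OF Am] less_SUP_iff by blast
    have "emeasure \<mu> K = ennreal (measure \<mu> K)"
      using compactin_finite[OF K(1)] by (intro emeasure_eq_ennreal_measure) auto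
    then have "measure \<mu> (A k) - \<eta> \<le> measure \<mu> K"
      using K(3) False by (simp add: ennreal_less_iff)
    then show ?thesis using K by blast
  qed
  then obtain K where K: "compactin Xt K" "K \<subseteq> A k" "measure \<mu> (A k) - \<eta> \<le> measure \<mu> K" by blast
  have Km: "K \<in> sets \<mu>" by (rule compactin_sets[OF K(1)])
  have "measure \<mu> (A k - K) = measure \<mu> (A k) - measure \<mu> K"
    using fin by (intro measure_Diff Am Km K(2)) auto
  then have small: "measure \<mu> (A k - K) \<le> \<eta>" using K(3) by linarith
  have AKm: "A k - K \<in> sets \<mu>" using Am Km by blast
  have AKfin: "emeasure \<mu> (A k - K) < \<infinity>"
    by (rule le_less_trans[OF emeasure_mono[OF Diff_subset Am] fin])
  have i1: "integrable \<mu> (\<lambda>x. f x * indicator (- A k) x)"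
    by (rule Bochner_Integration.integrable_bound[OF f])
       (use fm Am[of k] pos in \<open>auto simp: indicator_def intro!: borel_measurable_times\<close>)
  have i2: "integrable \<mu> (\<lambda>x. real (Suc k) * indicator (A k - K) x)"
    using AKm AKfin by (intro integrable_mult_right integrable_real_indicator)
  have "(\<integral>x. f x * indicator (- K) x \<partial>\<mu>) \<le> (\<integral>x. f x * indicator (- A k) x + real (Suc k) * indicator (A k - K) x \<partial>\<mu>)"
  proof (rule integral_mono'[OF Bochner_Integration.integrable_add[OF i1 i2]])
    fix x assume x: "x \<in> space \<mu>"
    show "f x * indicator (- K) x \<le> f x * indicator (- A k) x + real (Suc k) * indicator (A k - K) x"
      using x pos[of x] by (auto simp: indicator_def A_def)
    show "0 \<le> f x * indicator (- A k) x + real (Suc k) * indicator (A k - K) x"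
      using pos[of x] by (auto simp: indicator_def)
  qed
  also have "\<dots> = (\<integral>x. f x * indicator (- A k) x \<partial>\<mu>) + (\<integral>x. real (Suc k) * indicator (A k - K) x \<partial>\<mu>)"
    by (rule Bochner_Integration.integral_add[OF i1 i2])
  also have "(\<integral>x. real (Suc k) * indicator (A k - K) x \<partial>\<mu>) = real (Suc k) * measure \<mu> (A k - K)"
    using AKm by simp
  also have "\<dots> \<le> real (Suc k) * \<eta>" using small by (intro mult_left_mono) auto
  also have "\<dots> = \<epsilon>/4" by (simp add: \<eta>_def field_simps)
  finally have "(\<integral>x. f x * indicator (- K) x \<partial>\<mu>) < \<epsilon>" using k \<open>\<epsilon> > 0\<close> by linarith
  then show thesis using that K(1) by blast
qed

text \<open>A criterion for strong convergence. Since the index set may be uncountable, dominated convergence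
  does not apply to the net of partial sums; inner regularity reduces the matter to compact sets.\<close>

lemma strongly_sums_compactI:
  assumes bound: "\<And>F x. finite F \<Longrightarrow> F \<subseteq> I \<Longrightarrow> x \<in> topspace Xt \<Longrightarrow> norm ((\<Sum>g\<in>F. u g x) - s x) \<le> C"
    and eq: "\<And>K. compactin Xt K \<Longrightarrow> \<exists>F0. finite F0 \<and> F0 \<subseteq> I \<and> 
       (\<forall>F. finite F \<and> F0 \<subseteq> F \<and> F \<subseteq> I \<longrightarrow> (\<forall>x\<in>K. (\<Sum>g\<in>F. u g x) = s x))"
  shows "strongly_sums \<mu> u I s"
  unfolding strongly_sums_def
proof (intro allI impI)
  fix \<xi> :: "(nat \<Rightarrow> 'a) \<Rightarrow> complex" assume "\<xi> \<in> borel_measurable \<mu> \<and> integrable \<mu> (\<lambda>x. (norm (\<xi> x))\<^sup>2)"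
  then have i: "integrable \<mu> (\<lambda>x. (norm (\<xi> x))\<^sup>2)" and \<xi>m: "\<xi> \<in> borel_measurable \<mu>" by auto
  let ?D = "\<lambda>F x. (\<Sum>g\<in>F. u g x) * \<xi> x - s x * \<xi> x"
  show "((\<lambda>F. \<integral>x. (norm (?D F x))\<^sup>2 \<partial>\<mu>) \<longlongrightarrow> 0) (finite_subsets_at_top I)"
  proof (rule tendstoI)
    fix \<epsilon> :: real assume "\<epsilon> > 0"
    then have e: "\<epsilon> / (C\<^sup>2 + 1) > 0" by (simp add: add_nonneg_pos)
    obtain K where K: "compactin Xt K" "(\<integral>x. (norm (\<xi> x))\<^sup>2 * indicator (- K) x \<partial>\<mu>) < \<epsilon> / (C\<^sup>2 + 1)"
      using integrable_concentrated_on_compact[OF i _ e] by auto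
    let ?I = "\<integral>x. (norm (\<xi> x))\<^sup>2 * indicator (- K) x \<partial>\<mu>"
    obtain F0 where F0: "finite F0" "F0 \<subseteq> I" "\<forall>F. finite F \<and> F0 \<subseteq> F \<and> F \<subseteq> I \<longrightarrow> (\<forall>x\<in>K. (\<Sum>g\<in>F. u g x) = s x)"
      using eq[OF K(1)] by (elim exE conjE)
    have iK: "integrable \<mu> (\<lambda>x. (norm (\<xi> x))\<^sup>2 * indicator (- K) x)"
      by (rule Bochner_Integration.integrable_bound[OF i])
         (use \<xi>m compactin_sets[OF K(1)] in \<open>auto simp: indicator_def intro!: borel_measurable_times\<close>)
    have "dist (\<integral>x. (norm (?D F x))\<^sup>2 \<partial>\<mu>) 0 < \<epsilon>" if F: "finite F" "F0 \<subseteq> F" "F \<subseteq> I" for F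
    proof -
      have "(\<integral>x. (norm (?D F x))\<^sup>2 \<partial>\<mu>) \<le> (\<integral>x. C\<^sup>2 * ((norm (\<xi> x))\<^sup>2 * indicator (- K) x) \<partial>\<mu>)"
      proof (rule integral_mono')
        show "integrable \<mu> (\<lambda>x. C\<^sup>2 * ((norm (\<xi> x))\<^sup>2 * indicator (- K) x))"
          by (rule integrable_mult_right[OF iK])
        fix x assume x: "x \<in> space \<mu>"
        have D: "norm (?D F x) = norm ((\<Sum>g\<in>F. u g x) - s x) * norm (\<xi> x)"
          by (simp add: left_diff_distrib[symmetric] norm_mult)
        show "(norm (?D F x))\<^sup>2 \<le> C\<^sup>2 * ((norm (\<xi> x))\<^sup>2 * indicator (- K) x)"
        proof (cases "x \<in> K")
          case True
          then show ?thesis using F0(3)[rule_format, of F x] F by simp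
        next
          case False
          have "(norm ((\<Sum>g\<in>F. u g x) - s x))\<^sup>2 \<le> C\<^sup>2"
            using bound[OF F(1,3)] x by (intro power_mono) (auto simp: space_\<mu>)
          then show ?thesis
            using False unfolding D power_mult_distrib by (simp add: mult_right_mono)
        qed
      qed simp
      also have "\<dots> = C\<^sup>2 * ?I" by simp
      also have "\<dots> \<le> (C\<^sup>2 + 1) * ?I" by (intro mult_right_mono) (auto intro!: integral_nonneg_AE)
      also have "\<dots> < \<epsilon>"
        using K(2) by (simp add: pos_less_divide_eq add_nonneg_pos mult.commute)
      finally have "(\<integral>x. (norm (?D F x))\<^sup>2 \<partial>\<mu>) < \<epsilon>" .
      moreover have "(\<integral>x. (norm (?D F x))\<^sup>2 \<partial>\<mu>) \<ge> 0" by (intro integral_nonneg_AE) simp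
      ultimately show ?thesis by (simp add: dist_real_def)
    qed
    then show "\<forall>\<^sub>F F in finite_subsets_at_top I. dist (\<integral>x. (norm (?D F x))\<^sup>2 \<partial>\<mu>) 0 < \<epsilon>"
      unfolding eventually_finite_subsets_at_top using F0(1,2) by blast
  qed
qed

text \<open>The function on \<open>X n\<close> corresponding to \<open>r\<close> on the image of \<open>V\<close>, extended by \<open>0\<close>. It is used for special
  sets \<open>V\<close>, on which the coordinate is injective, and functions \<open>r\<close> supported in \<open>V\<close>.\<close>

definition descend :: "(nat \<Rightarrow> 'a) set \<Rightarrow> ((nat \<Rightarrow> 'a) \<Rightarrow> real) \<Rightarrow> nat \<Rightarrow> 'a \<Rightarrow> complex" where
  "descend V r n = (\<lambda>y\<in>topspace (X n). if y \<in> coord n ` V then of_real (r (inv_into V (coord n) y)) else 0)"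

lemma descend_coord:
  assumes "special_set X p V" "x \<in> V"
  shows "descend V r n (x n) = of_real (r x)"
proof -
  have "inj_on (coord n) V" using assms(1) by (simp add: special_set_def)
  moreover have "x \<in> topspace Xt" using assms openin_subset[OF openin_special] by blast
  ultimately show ?thesis using assms(2) inv_into_f_f[of "coord n" V x] coord_mem by (simp add: descend_def)
qed

context
  fixes V K and r :: "(nat \<Rightarrow> 'a) \<Rightarrow> real"
  assumes V: "special_set X p V" and K: "compactin Xt K" "K \<subseteq> V"
    and r: "continuous_map Xt euclidean r" "\<And>x. r x \<ge> 0" "\<And>x. x \<in> topspace Xt - K \<Longrightarrow> r x = 0"
begin

lemma V_subset: "V \<subseteq> topspace Xt"
  by (rule openin_subset[OF openin_special[OF V]])

lemma descend_outside:
  assumes "y \<in> topspace (X n) - coord n ` K" shows "descend V r n y = 0"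
proof (cases "y \<in> coord n ` V")
  case True
  then obtain x where x: "x \<in> V" "y = x n" by (rule imageE)
  then have "x \<in> topspace Xt - K" using assms V_subset by blast
  then show ?thesis using descend_coord[OF V x(1)] r(3) x(2) by simp
qed (use assms in \<open>simp add: descend_def\<close>)

lemma compactin_coord_K: "compactin (X n) (coord n ` K)"
  by (rule image_compactin[OF K(1) continuous_coord])

lemma descend_C0: "descend V r n \<in> carrier (C0 (X n))"
proof -
  have "continuous_map (X n) euclidean (descend V r n)"
    unfolding continuous_map_metric_iff
  proof (intro ballI allI impI)
    fix y and \<epsilon> :: real assume y: "y \<in> topspace (X n)" and "\<epsilon> > 0"
    show "\<exists>U. openin (X n) U \<and> y \<in> U \<and> (\<forall>z\<in>U. dist (descend V r n y) (descend V r n z) < \<epsilon>)"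
    proof (cases "y \<in> coord n ` V")
      case True
      then obtain x where x: "x \<in> V" "y = x n" by (rule imageE)
      then have "x \<in> topspace Xt" using V_subset by blast
      then obtain U where U: "openin Xt U" "x \<in> U" "\<forall>z\<in>U. dist (r x) (r z) < \<epsilon>"
        using r(1) \<open>\<epsilon> > 0\<close> unfolding continuous_map_metric_iff by blast
      have "openin Xt (U \<inter> V)" using U(1) openin_special[OF V] by (rule openin_Int)
      then have "openin (X n) (coord n ` (U \<inter> V))"
        using covering_projection_open_map[OF covering_coord] by (simp add: open_map_def)
      moreover have "dist (descend V r n y) (descend V r n z) < \<epsilon>" if z: "z \<in> coord n ` (U \<inter> V)" for z
      proof -
        obtain w where w: "w \<in> U \<inter> V" "z = w n" using z by (rule imageE)
        have "dist (descend V r n y) (descend V r n z) = dist (r x) (r w)"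
          using descend_coord[OF V x(1)] descend_coord[OF V, of w] w x(2)
          by (simp add: dist_norm norm_of_real flip: of_real_diff)
        then show ?thesis using U(3) w(1) by simp
      qed
      ultimately show ?thesis using x U(2) by (intro exI[of _ "coord n ` (U \<inter> V)"]) blast
    next
      case False
      have "closedin (X n) (coord n ` K)"
        by (rule compactin_imp_closedin[OF X_props(4) compactin_coord_K])
      then have "openin (X n) (topspace (X n) - coord n ` K)" by (rule openin_diff[OF openin_topspace])
      moreover have "y \<in> topspace (X n) - coord n ` K" using False y K(2) by blast
      ultimately show ?thesis
        using descend_outside \<open>\<epsilon> > 0\<close> by (intro exI[of _ "topspace (X n) - coord n ` K"]) simp
    qed
  qed
  then show ?thesis
    unfolding C0_iff
    by (intro conjI allI impI exI[of _ "coord n ` K"] compactin_coord_K ballI)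
       (simp_all add: descend_outside, simp add: descend_def)
qed

text \<open>At each point at most one translate is different from \<open>0\<close>, because the group acts freely and the
  coordinate is injective on \<open>V\<close>; where the sum should not vanish there is one by transitivity.\<close>

lemma descend_strongly_sums:
  "strongly_sums \<mu> (\<lambda>g. group_act X p g (\<lambda>x. of_real (r x))) (J n) (descend V r n \<circ> coord n)"
proof -
  let ?u = "\<lambda>g. group_act X p g (\<lambda>x. of_real (r x))" and ?s = "descend V r n \<circ> coord n"
  have u0: "?u g x = 0" if "g \<in> J n" "x \<in> topspace Xt" "(inv\<^bsub>G\<^esub> g) x \<notin> V" for g x
    using r(3)[of "(inv\<^bsub>G\<^esub> g) x"] G_maps_to[OF G_inv(1)[OF J_carrier[OF that(1)]] that(2)] that(3) K(2)
    by (auto simp: group_act_def)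
  have us: "?u g x = ?s x" if "g \<in> J n" "x \<in> topspace Xt" "(inv\<^bsub>G\<^esub> g) x \<in> V" for g x
  proof -
    have "(inv\<^bsub>G\<^esub> g) x n = x n" using J_inv[OF that(1)] that(2) by (simp add: limit_kernel_iff)
    then show ?thesis using descend_coord[OF V that(3), of r n] by (simp add: group_act_def)
  qed
  have uniq: "g = h" if gh: "g \<in> J n" "h \<in> J n" and x: "x \<in> topspace Xt" "(inv\<^bsub>G\<^esub> g) x \<in> V" "(inv\<^bsub>G\<^esub> h) x \<in> V" for g h x
  proof -
    have "(inv\<^bsub>G\<^esub> g) x n = (inv\<^bsub>G\<^esub> h) x n"
      using J_inv[OF gh(1)] J_inv[OF gh(2)] x(1) by (simp add: limit_kernel_iff)
    then have "(inv\<^bsub>G\<^esub> g) x = (inv\<^bsub>G\<^esub> h) x"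
      using V x(2,3) unfolding special_set_def inj_on_def by blast
    then have "inv\<^bsub>G\<^esub> g = inv\<^bsub>G\<^esub> h"
      using G_free G_inv(1) J_carrier gh x(1) by metis
    then show ?thesis using group.inv_inv[OF group_G] J_carrier gh by metis
  qed
  have sum: "(\<Sum>g\<in>F. ?u g x) = (if \<exists>g\<in>F. (inv\<^bsub>G\<^esub> g) x \<in> V then ?s x else 0)"
    if F: "finite F" "F \<subseteq> J n" and x: "x \<in> topspace Xt" for F x
  proof (cases "\<exists>g\<in>F. (inv\<^bsub>G\<^esub> g) x \<in> V")
    case True
    then obtain g where g: "g \<in> F" "(inv\<^bsub>G\<^esub> g) x \<in> V" by blast
    have "(\<Sum>h\<in>F - {g}. ?u h x) = 0"
    proof (rule sum.neutral, rule ballI)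
      fix h assume h: "h \<in> F - {g}"
      then have "(inv\<^bsub>G\<^esub> h) x \<notin> V" using uniq[of g h x] g x F(2) by blast
      then show "?u h x = 0" using u0[of h x] h F(2) x by blast
    qed
    then have "(\<Sum>h\<in>F. ?u h x) = ?u g x" using sum.remove[OF F(1) g(1), of "\<lambda>h. ?u h x"] by simp
    then show ?thesis using us[of g x] g F(2) x True by auto
  next
    case False
    have "(\<Sum>h\<in>F. ?u h x) = 0"
      by (rule sum.neutral) (use u0 False F(2) x in blast)
    then show ?thesis using False by simp
  qed
  have hit: "\<exists>g\<in>J n. x \<in> g ` V" if x: "x \<in> topspace Xt" "x n \<in> coord n ` V" for x
  proof -
    obtain v where v: "v \<in> V" "x n = v n" using x(2) by (rule imageE)
    obtain g where "g \<in> J n" "g v = x"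
      using J_transitive[of v x n] v x(1) V_subset by (metis subsetD)
    then show ?thesis using v(1) by blast
  qed
  obtain C where C: "C \<ge> 0" "\<And>y. y \<in> topspace (X n) \<Longrightarrow> norm (descend V r n y) \<le> C"
    using C0_bounded[OF descend_C0] by blast
  show ?thesis
  proof (rule strongly_sums_compactI[where C = C])
    fix F x assume F: "finite F" "F \<subseteq> J n" and x: "x \<in> topspace Xt"
    show "norm ((\<Sum>g\<in>F. ?u g x) - ?s x) \<le> C"
      unfolding sum[OF F x] using C(1) C(2)[OF coord_mem[OF x]] by auto
  next
    fix L assume L: "compactin Xt L"
    let ?L = "L \<inter> {x \<in> topspace Xt. x n \<in> coord n ` K}"
    have "closedin Xt {x \<in> topspace Xt. x n \<in> coord n ` K}"
      using closedin_continuous_map_preimage[OF continuous_coord compactin_imp_closedin[OF X_props(4) compactin_coord_K]] .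
    then have cL: "compactin Xt ?L" using L by (intro compact_Int_closedin) 
    have "\<exists>\<F>. finite \<F> \<and> \<F> \<subseteq> (\<lambda>g. g ` V) ` J n \<and> ?L \<subseteq> \<Union>\<F>"
    proof (rule compactinD[OF cL])
      show "openin Xt U" if "U \<in> (\<lambda>g. g ` V) ` J n" for U
        using that openin_special[OF special_translate[OF V J_carrier]] by blast
      show "?L \<subseteq> \<Union>((\<lambda>g. g ` V) ` J n)"
        using hit K(2) by blast
    qed
    then obtain F0 where F0: "finite F0" "F0 \<subseteq> J n" "?L \<subseteq> (\<Union>g\<in>F0. g ` V)"
      by (metis (no_types, lifting) finite_subset_image)
    have "(\<Sum>g\<in>F. ?u g x) = ?s x" if F: "finite F" "F0 \<subseteq> F" "F \<subseteq> J n" and x: "x \<in> L" for F x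
    proof -
      have xX: "x \<in> topspace Xt" using L x compactin_subset_topspace by blast
      show ?thesis
      proof (cases "x n \<in> coord n ` K")
        case True
        then have "x \<in> ?L" using x xX by simp
        then obtain g v where g: "g \<in> F0" "v \<in> V" "x = g v" using F0(3) by blast
        then have "(inv\<^bsub>G\<^esub> g) x = v"
          using G_inv(3)[of g v] J_carrier F0(2) V_subset by blast
        then have "\<exists>g\<in>F. (inv\<^bsub>G\<^esub> g) x \<in> V" using g F(2) by blast
        then show ?thesis unfolding sum[OF F(1,3) xX] by simp
      next
        case False
        then have "?s x = 0" using descend_outside coord_mem[OF xX] by simp
        then show ?thesis unfolding sum[OF F(1,3) xX] by simp
      qed
    qed
    then show "\<exists>F0. finite F0 \<and> F0 \<subseteq> J n \<and> (\<forall>F. finite F \<and> F0 \<subseteq> F \<and> F \<subseteq> J n \<longrightarrow> (\<forall>x\<in>L. (\<Sum>g\<in>F. ?u g x) = ?s x))"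
      using F0(1,2) by blast
  qed
qed

end

text \<open>Both conditions on a special function hold, the second one because \<open>a\<^sub>n\<^sup>2 = b\<^sub>n\<close>.\<close>

lemma special_function_bump:
  assumes V: "special_set X p V" and K: "compactin Xt K" "K \<subseteq> V"
    and r: "continuous_map Xt euclidean r" "\<And>x. r x \<ge> (0::real)" "\<And>x. x \<in> topspace Xt - K \<Longrightarrow> r x = 0"
  shows "special_function X p \<mu> (\<lambda>x. of_real (r x))"
proof -
  let ?r2 = "\<lambda>x. (r x)\<^sup>2"
  have r2: "continuous_map Xt euclidean ?r2" "\<And>x. ?r2 x \<ge> 0" "\<And>x. x \<in> topspace Xt - K \<Longrightarrow> ?r2 x = 0"
    using continuous_map_real_pow[OF r(1)] r(3) by auto
  have cr: "continuous_map Xt euclidean (\<lambda>x. complex_of_real (r x))"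
    using continuous_map_compose[OF r(1), of euclidean complex_of_real] by (simp add: o_def continuous_on_of_real_id)
  have rC: "restrict (\<lambda>x. complex_of_real (r x)) (topspace Xt) \<in> carrier (C0 Xt)"
    by (rule C0_restrictI[OF cr]) (use K r(3) in auto)
  obtain C where C: "C \<ge> 0" "\<And>x. x \<in> topspace Xt \<Longrightarrow> norm (restrict (\<lambda>x. complex_of_real (r x)) (topspace Xt) x) \<le> C"
    using C0_bounded[OF rC] by blast
  have eb: "(\<lambda>x. complex_of_real (r x)) \<in> ess_bounded \<mu>"
    by (rule ess_boundedI[OF continuous_measurable[OF cr]], rule AE_I2) (use C(2) in \<open>auto simp: space_\<mu>\<close>)
  have dd: "(descend V r n y)\<^sup>2 - descend V ?r2 n y = 0" if "y \<in> topspace (X n)" for n y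
    using that by (simp add: descend_def)
  have "sup_norm (X n) (\<lambda>x. (descend V r n x)\<^sup>2 - descend V ?r2 n x) < \<epsilon>" if "\<epsilon> > 0" for \<epsilon> n
    using sup_norm_least[of 0 "X n" "\<lambda>x. (descend V r n x)\<^sup>2 - descend V ?r2 n x"] that by (simp add: dd)
  moreover have "strongly_sums \<mu> (\<lambda>g. group_act X p g (\<lambda>x. (complex_of_real (r x))\<^sup>2)) (J n) (descend V ?r2 n \<circ> coord n)" for n
    using descend_strongly_sums[OF V K r2] by simp
  ultimately show ?thesis
    unfolding special_function_def
    using eb r(2) descend_C0[OF V K r] descend_C0[OF V K r2] descend_strongly_sums[OF V K r]
    by (intro conjI exI[of _ "descend V r"] exI[of _ "descend V ?r2"]) auto
qed

lemma bump_exists: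
  assumes x: "x \<in> topspace Xt"
  obtains V K \<phi> where "special_set X p V" "compactin Xt K" "K \<subseteq> V" "continuous_map Xt euclidean \<phi>"
    "\<And>y. y \<in> topspace Xt \<Longrightarrow> \<phi> y \<ge> (0::real)" "\<And>y. y \<in> topspace Xt - K \<Longrightarrow> \<phi> y = 0" "\<phi> x = 1"
proof -
  obtain V where V: "special_set X p V" "x \<in> V" "V \<subseteq> topspace Xt"
    by (rule special_base[OF openin_topspace x])
  have "neighbourhood_base_of (\<lambda>C. compactin Xt C) Xt"
    using locally_compact_space_neighbourhood_base[of Xt] locally_compact_Xt Hausdorff_Xt by simp
  then obtain U K where U: "openin Xt U" "compactin Xt K" "x \<in> U" "U \<subseteq> K" "K \<subseteq> V"
    using V(2) openin_special[OF V(1)] unfolding neighbourhood_base_of by meson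
  have "closedin Xt (topspace Xt - U)" "x \<in> topspace Xt - (topspace Xt - U)"
    using U(1,3) x by auto
  then obtain f where f: "continuous_map Xt (top_of_set {0..1}) f" "f x = 0" "f ` (topspace Xt - U) \<subseteq> {1::real}"
    using completely_regular_Xt unfolding completely_regular_space_def by metis
  have fc: "continuous_map Xt euclidean f" "\<And>y. y \<in> topspace Xt \<Longrightarrow> f y \<in> {0..1}"
    using f(1) by (auto simp: continuous_map_in_subtopology Pi_iff)
  have "continuous_map Xt euclidean (\<lambda>y. 1 - f y)"
    using fc(1) by (intro continuous_map_diff) auto
  then show thesis
    by (rule that[OF V(1) U(2,5)]) (use f(2,3) fc(2) U(4) in force)+
qed

text \<open>The element \<open>f\<close> is multiplied by a partition of unity on the compact set where it is not small, and each
  product is split into the positive and negative parts of its real and imaginary parts.\<close>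

lemma special_span_dense:
  assumes f: "f \<in> carrier (C0 Xt)" and \<epsilon>: "\<epsilon> > 0"
  shows "\<exists>h \<in> ess_bounded \<mu>.
        Linf_class \<mu> h \<in> is_linear_subspace (Linf \<mu>) hull special_elements X p \<mu> \<and>
        (\<forall>x\<in>topspace Xt. norm (f x - h x) \<le> \<epsilon>)"
proof -
  obtain K where K: "compactin Xt K" "\<And>x. x \<in> topspace Xt \<Longrightarrow> x \<notin> K \<Longrightarrow> norm (f x) < \<epsilon>"
    using C0_vanishes[OF f \<epsilon>] by blast
  have KX: "K \<subseteq> topspace Xt" by (rule compactin_subset_topspace[OF K(1)])
  define bump where "bump x V L \<phi> \<longleftrightarrow> special_set X p V \<and> compactin Xt L \<and> L \<subseteq> V \<and> continuous_map Xt euclidean \<phi> \<and>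
      (\<forall>y\<in>topspace Xt. \<phi> y \<ge> (0::real)) \<and> (\<forall>y\<in>topspace Xt - L. \<phi> y = 0) \<and> \<phi> x = 1" for x V L \<phi>
  have "\<exists>V L \<phi>. bump x V L \<phi>" if "x \<in> topspace Xt" for x
    by (rule bump_exists[OF that]) (unfold bump_def, blast)
  then obtain V L \<phi> where "\<And>x. x \<in> topspace Xt \<Longrightarrow> bump x (V x) (L x) (\<phi> x)"
    by metis
  then have B: "\<And>x. x \<in> topspace Xt \<Longrightarrow> special_set X p (V x)"
    "\<And>x. x \<in> topspace Xt \<Longrightarrow> compactin Xt (L x)" "\<And>x. x \<in> topspace Xt \<Longrightarrow> L x \<subseteq> V x"
    "\<And>x. x \<in> topspace Xt \<Longrightarrow> continuous_map Xt euclidean (\<phi> x)"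
    "\<And>x y. x \<in> topspace Xt \<Longrightarrow> y \<in> topspace Xt \<Longrightarrow> \<phi> x y \<ge> (0::real)" 
    "\<And>x y. x \<in> topspace Xt \<Longrightarrow> y \<in> topspace Xt - L x \<Longrightarrow> \<phi> x y = 0" "\<And>x. x \<in> topspace Xt \<Longrightarrow> \<phi> x x = 1"
    unfolding bump_def by simp_all
  let ?O = "\<lambda>x. {y \<in> topspace Xt. \<phi> x y \<in> {1/2<..}}"
  have "\<exists>\<F>. finite \<F> \<and> \<F> \<subseteq> ?O ` K \<and> K \<subseteq> \<Union>\<F>"
  proof (rule compactinD[OF K(1)])
    show "openin Xt U" if U: "U \<in> ?O ` K" for U
    proof -
      obtain x where x: "x \<in> K" "U = ?O x" using U by (rule imageE)
      show ?thesis unfolding x(2)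
        by (rule openin_continuous_map_preimage[OF B(4)]) (use x KX in auto)
    qed
    show "K \<subseteq> \<Union>(?O ` K)" using B(7) KX by force
  qed
  then obtain F where F: "finite F" "F \<subseteq> K" "K \<subseteq> (\<Union>x\<in>F. ?O x)"
    by (metis (no_types, lifting) finite_subset_image)
  have FX: "x \<in> topspace Xt" if "x \<in> F" for x using that F(2) KX by blast
  define S where "S y = (\<Sum>x\<in>F. \<phi> x y)" for y
  have S0: "S y \<ge> 0" if "y \<in> topspace Xt" for y
    unfolding S_def using B(5) FX that by (intro sum_nonneg) auto
  have SK: "S y \<ge> 1/2" if y: "y \<in> K" for y
  proof -
    have "y \<in> (\<Union>x\<in>F. ?O x)" using F(3) y by (rule subsetD)
    then obtain x where x: "x \<in> F" "\<phi> x y > 1/2" by auto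
    have "\<phi> x y \<le> S y"
      unfolding S_def using F(1) x(1) B(5) FX KX y by (intro member_le_sum) auto
    then show ?thesis using x(2) by linarith
  qed
  have Sc: "continuous_map Xt euclidean S"
    unfolding S_def using F(1) B(4) FX by (intro continuous_map_sum) auto
  \<comment> \<open>The bound \<open>1/2\<close> avoids division by \<open>0\<close> and is inactive on \<open>K\<close>, where the \<open>\<psi> x\<close> add up to \<open>1\<close>.\<close>
  define \<psi> where "\<psi> x y = (if y \<in> topspace Xt then \<phi> x y / max (1/2) (S y) else 0)" for x y
  have \<psi>c: "continuous_map Xt euclidean (\<psi> x)" if "x \<in> F" for x
  proof -
    have "continuous_map Xt euclidean (\<lambda>y. max (1/2) (S y))"
      using Sc by (intro continuous_map_real_max) auto
    then have "continuous_map Xt euclidean (\<lambda>y. \<phi> x y / max (1/2) (S y))"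
      using B(4)[OF FX[OF that]] by (intro continuous_map_real_divide) auto
    then show ?thesis by (rule continuous_map_eq) (simp add: \<psi>_def)
  qed
  have \<psi>0: "\<psi> x y \<ge> 0" if "x \<in> F" for x y
    using B(5)[OF FX[OF that]] by (auto simp: \<psi>_def)
  have \<psi>L: "\<psi> x y = 0" if "x \<in> F" "y \<in> topspace Xt - L x" for x y
    using B(6)[OF FX[OF that(1)] that(2)] by (simp add: \<psi>_def)
  have \<psi>S: "(\<Sum>x\<in>F. \<psi> x y) = S y / max (1/2) (S y)" if "y \<in> topspace Xt" for y
    using that by (simp add: \<psi>_def S_def sum_divide_distrib)
  define q :: "nat \<Rightarrow> complex \<Rightarrow> real" where
    "q j z = (if j = 0 then max 0 (Re z) else if j = 1 then max 0 (- Re z) else if j = 2 then max 0 (Im z) else max 0 (- Im z))" for j z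
  define c :: "nat \<Rightarrow> complex" where "c j = (if j = 0 then 1 else if j = 1 then -1 else if j = 2 then \<i> else -\<i>)" for j
  have split: "(\<Sum>j<4. c j * of_real (q j z)) = z" for z
    by (simp add: numeral_eq_Suc q_def c_def complex_eq_iff max_def)
  have q0: "q j z \<ge> 0" for j z by (simp add: q_def)
  have qc: "continuous_on UNIV (q j)" for j
    unfolding q_def by (cases "j = 0"; cases "j = 1"; cases "j = 2") (auto intro!: continuous_intros)
  have fq: "continuous_map Xt euclidean (\<lambda>y. q j (f y))" for j
    using continuous_map_compose[OF C0_continuous[OF f], of euclidean "q j"] qc by (simp add: o_def)
  let ?r = "\<lambda>(x, j) y. if y \<in> topspace Xt then q j (f y) * \<psi> x y else 0"
  have sp: "special_function X p \<mu> (\<lambda>y. of_real (?r i y))" if i: "i \<in> F \<times> {..<4}" for i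
  proof -
    obtain x j where xj: "i = (x, j)" "x \<in> F" using i by blast
    have "continuous_map Xt euclidean (\<lambda>y. q j (f y) * \<psi> x y)"
      using fq \<psi>c[OF xj(2)] by (rule continuous_map_real_mult)
    then have "continuous_map Xt euclidean (?r i)"
      by (rule continuous_map_eq) (simp add: xj)
    then show ?thesis
      by (rule special_function_bump[OF B(1)[OF FX[OF xj(2)]] B(2)[OF FX[OF xj(2)]] B(3)[OF FX[OF xj(2)]]])
         (use q0 \<psi>0 \<psi>L xj in auto)
  qed
  let ?h = "\<lambda>y. \<Sum>i\<in>F \<times> {..<4}. c (snd i) * of_real (?r i y)"
  have fin: "finite (F \<times> {..<4::nat})" using F(1) by simp
  have heq: "?h y = f y * of_real (S y / max (1/2) (S y))" if y: "y \<in> topspace Xt" for y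
  proof -
    have "?h y = (\<Sum>x\<in>F. \<Sum>j<4. c j * of_real (q j (f y) * \<psi> x y))"
      using y by (simp add: sum.cartesian_product split_def)
    also have "\<dots> = (\<Sum>x\<in>F. (\<Sum>j<4. c j * of_real (q j (f y))) * of_real (\<psi> x y))"
      by (simp add: sum_distrib_right mult.assoc)
    also have "\<dots> = f y * of_real (\<Sum>x\<in>F. \<psi> x y)"
      by (simp only: split sum_distrib_left of_real_sum)
    finally show ?thesis unfolding \<psi>S[OF y] .
  qed
  have hull: "Linf_class \<mu> ?h \<in> is_linear_subspace (Linf \<mu>) hull special_elements X p \<mu>"
    using linear_hull_sum[OF fin sp, where c = "\<lambda>i. c (snd i)"] by simp
  have eb: "?h \<in> ess_bounded \<mu>"
  proof -
    have "(\<lambda>y. \<Sum>i\<in>I. c (snd i) * of_real (?r i y)) \<in> ess_bounded \<mu>" if "finite I" "I \<subseteq> F \<times> {..<4}" for I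
      using that
    proof (induction I rule: finite_induct)
      case (insert i I)
      then have "(\<lambda>y. of_real (?r i y)) \<in> ess_bounded \<mu>"
        using special_function_ess_bounded[OF sp] by blast
      from ess_bounded_add[OF ess_bounded_scale[OF this, of "c (snd i)"]] insert show ?case by simp
    qed (simp add: ess_bounded_const)
    then show ?thesis using fin by blast
  qed
  have close: "norm (f y - ?h y) \<le> \<epsilon>" if y: "y \<in> topspace Xt" for y
  proof (cases "y \<in> K")
    case True
    then show ?thesis unfolding heq[OF y] using SK[OF True] \<epsilon> by simp
  next
    case False
    let ?t = "S y / max (1/2) (S y)"
    have t: "0 \<le> ?t" "?t \<le> 1" using S0[OF y] by (auto simp: divide_le_eq)
    have "f y - ?h y = f y * of_real (1 - ?t)" unfolding heq[OF y] by (simp add: algebra_simps)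
    then have "norm (f y - ?h y) = norm (f y) * (1 - ?t)" using t by (simp only: norm_mult norm_of_real)
    also have "\<dots> \<le> norm (f y)" using t by (intro mult_left_le) auto
    finally show ?thesis using K(2)[OF y False] by linarith
  qed
  show ?thesis using eb hull close by (intro bexI[of _ ?h]) auto
qed

end

section \<open>Pointwise summation of strongly convergent sums\<close>

lemma has_sum_exhaustion:
  fixes t :: "'i \<Rightarrow> real"
  assumes pos: "\<And>i. i \<in> C \<Longrightarrow> t i \<ge> 0" and H: "\<And>k. finite (H k)" "\<And>k. H k \<subseteq> C" "incseq H" "C \<subseteq> (\<Union>k::nat. H k)"
    and lim: "(\<lambda>k. \<Sum>i\<in>H k. t i) \<longlonglongrightarrow> l"
  shows "(t has_sum l) C"
  unfolding has_sum_def
proof (rule tendstoI)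
  fix \<epsilon> :: real assume "\<epsilon> > 0"
  have mono: "(\<Sum>i\<in>F. t i) \<le> (\<Sum>i\<in>F'. t i)" if "finite F'" "F \<subseteq> F'" "F' \<subseteq> C" for F F'
    using that pos by (intro sum_mono2) auto
  have "incseq (\<lambda>k. \<Sum>i\<in>H k. t i)"
    using H by (intro incseq_SucI mono) (auto simp: incseq_Suc_iff)
  then have le: "(\<Sum>i\<in>H k. t i) \<le> l" for k
    using lim by (rule incseq_le)
  have fin: "\<exists>k. F \<subseteq> H k" if "finite F" "F \<subseteq> C" for F
    using that
  proof (induction F rule: finite_induct)
    case (insert i F)
    then obtain k where k: "F \<subseteq> H k" by blast
    obtain k' where k': "i \<in> H k'" using insert H(4) by blast
    have "insert i F \<subseteq> H (max k k')"
      using k k' incseqD[OF H(3), of k "max k k'"] incseqD[OF H(3), of k' "max k k'"] by auto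
    then show ?case ..
  qed simp
  have "\<forall>\<^sub>F k in sequentially. (\<Sum>i\<in>H k. t i) > l - \<epsilon>"
    using order_tendstoD(1)[OF lim] \<open>\<epsilon> > 0\<close> by simp
  then obtain k where k: "(\<Sum>i\<in>H k. t i) > l - \<epsilon>"
    unfolding eventually_sequentially by blast
  have "dist (\<Sum>i\<in>F. t i) l < \<epsilon>" if F: "finite F" "H k \<subseteq> F" "F \<subseteq> C" for F
  proof -
    obtain k' where "F \<subseteq> H k'" using fin F by blast
    then have "(\<Sum>i\<in>F. t i) \<le> l" using mono[of "H k'" F] H le[of k'] by (meson order_trans)
    moreover have "(\<Sum>i\<in>F. t i) > l - \<epsilon>" using mono[OF F(1,2,3)] k by linarith
    ultimately show ?thesis by (simp add: dist_real_def)
  qed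
  then show "\<forall>\<^sub>F F in finite_subsets_at_top C. dist (sum t F) l < \<epsilon>"
    unfolding eventually_finite_subsets_at_top using H(1,2) by (intro exI[of _ "H k"]) simp
qed

lemma nonneg_Reals_eq_norm: "z \<in> \<real>\<^sub>\<ge>\<^sub>0 \<Longrightarrow> z = complex_of_real (norm z)"
  by (elim nonneg_Reals_cases) simp

text \<open>On a set of finite measure a strong sum of positive functions, over whatever index set, is given
  almost everywhere by a countable sum, and enlarging the countable index set does not matter.\<close>

lemma strongly_sums_has_sum:
  fixes u :: "'i \<Rightarrow> 'b \<Rightarrow> complex"
  assumes ss: "strongly_sums M u I s" and u: "\<And>g. g \<in> I \<Longrightarrow> u g \<in> ess_bounded M"
    and pos: "\<And>g. g \<in> I \<Longrightarrow> AE x in M. u g x \<in> \<real>\<^sub>\<ge>\<^sub>0" and s: "s \<in> ess_bounded M"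
    and W: "W \<in> sets M" "emeasure M W < \<infinity>"
  shows "\<exists>C. countable C \<and> C \<subseteq> I \<and> (\<forall>C'. countable C' \<and> C \<subseteq> C' \<and> C' \<subseteq> I \<longrightarrow>
      (AE x in M. x \<in> W \<longrightarrow> s x \<in> \<real>\<^sub>\<ge>\<^sub>0 \<and> ((\<lambda>g. norm (u g x)) has_sum norm (s x)) C'))"
proof -
  let ?\<xi> = "indicator W :: 'b \<Rightarrow> complex"
  have "(\<lambda>x. (norm (?\<xi> x))\<^sup>2) = (indicator W :: 'b \<Rightarrow> real)"
    by (rule ext) (simp add: indicator_def)
  moreover have "integrable M (indicator W :: 'b \<Rightarrow> real)"
    using W by (rule integrable_real_indicator)
  ultimately have \<xi>: "?\<xi> \<in> borel_measurable M \<and> integrable M (\<lambda>x. (norm (?\<xi> x))\<^sup>2)"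
    using W(1) by simp
  \<comment> \<open>The \<open>L\<^sup>2\<close> error of a finite partial sum, tested on the indicator of \<open>W\<close>.\<close>
  define D where "D F x = (norm ((\<Sum>g\<in>F. u g x) * ?\<xi> x - s x * ?\<xi> x))\<^sup>2" for F x
  have D: "D F x = (norm ((\<Sum>g\<in>F. u g x) - s x))\<^sup>2 * indicator W x" for F x
    by (simp add: D_def indicator_def)
  have tend: "((\<lambda>F. \<integral>x. D F x \<partial>M) \<longlongrightarrow> 0) (finite_subsets_at_top I)"
    using ss[unfolded strongly_sums_def, rule_format, OF \<xi>] by (simp only: D_def)
  have "\<exists>F. finite F \<and> F \<subseteq> I \<and> (\<forall>Y. finite Y \<and> F \<subseteq> Y \<and> Y \<subseteq> I \<longrightarrow> (\<integral>x. D Y x \<partial>M) < inverse (real (Suc k)))" for k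
    using order_tendstoD(2)[OF tend, of "inverse (real (Suc k))"]
    unfolding eventually_finite_subsets_at_top by simp
  then obtain F where F: "\<And>k. finite (F k)" "\<And>k. F k \<subseteq> I"
    "\<And>k Y. finite Y \<Longrightarrow> F k \<subseteq> Y \<Longrightarrow> Y \<subseteq> I \<Longrightarrow> (\<integral>x. D Y x \<partial>M) < inverse (real (Suc k))"
    by metis
  have eb: "(\<lambda>x. \<Sum>g\<in>Y. u g x) \<in> ess_bounded M" if "finite Y" "Y \<subseteq> I" for Y
    using that
  proof (induction Y rule: finite_induct)
    case (insert g Y)
    then show ?case using ess_bounded_add[OF u[of g]] by simp
  qed (simp add: ess_bounded_const)
  have Dint: "integrable M (D Y)" if Y: "finite Y" "Y \<subseteq> I" for Y
  proof -
    have e: "(\<lambda>x. (\<Sum>g\<in>Y. u g x) - s x) \<in> ess_bounded M"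
      using ess_bounded_add[OF eb[OF Y] ess_bounded_scale[OF s, of "-1"]] by simp
    obtain c where c: "c \<ge> 0" "AE x in M. norm ((\<Sum>g\<in>Y. u g x) - s x) \<le> c"
      using ess_bounded_bound[OF e] by blast
    show ?thesis
    proof (rule Bochner_Integration.integrable_bound)
      show "integrable M (\<lambda>x. c\<^sup>2 * indicator W x :: real)"
        using W by (intro integrable_mult_right integrable_real_indicator)
      have "(\<lambda>x. (norm ((\<Sum>g\<in>Y. u g x) - s x))\<^sup>2 * indicator W x) \<in> borel_measurable M"
        using measurable_compose[OF ess_bounded_measurable[OF e] borel_measurable_norm] W(1)
        by (intro borel_measurable_times borel_measurable_power borel_measurable_indicator)
      then show "D Y \<in> borel_measurable M" by (simp only: D cong: measurable_cong)
      show "AE x in M. norm (D Y x) \<le> norm (c\<^sup>2 * indicator W x :: real)"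
        using c(2)
      proof eventually_elim
        case (elim x)
        then have "(norm ((\<Sum>g\<in>Y. u g x) - s x))\<^sup>2 \<le> c\<^sup>2" by (rule power_mono) simp
        then show ?case by (simp add: D indicator_def)
      qed
    qed
  qed
  define C where "C = (\<Union>k. F k)"
  have C: "countable C" "C \<subseteq> I"
    using F(1,2) by (auto simp: C_def countable_finite)
  have "AE x in M. x \<in> W \<longrightarrow> s x \<in> \<real>\<^sub>\<ge>\<^sub>0 \<and> ((\<lambda>g. norm (u g x)) has_sum norm (s x)) C'"
    if C': "countable C'" "C \<subseteq> C'" "C' \<subseteq> I" for C'
  proof -
    define H where "H k = (\<Union>j\<le>k. F j) \<union> {c \<in> C'. to_nat_on C' c \<le> k}" for k
    have "inj_on (to_nat_on C') C'" using C'(1) by (rule inj_on_to_nat_on)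
    then have fin: "finite {c \<in> C'. to_nat_on C' c \<le> k}" for k
      by (rule inj_on_finite[OF inj_on_subset, of _ _ _ "{..k}"]) auto
    have FC: "F j \<subseteq> C'" for j using C'(2) by (auto simp: C_def)
    have HC: "H k \<subseteq> C'" for k using FC by (auto simp: H_def)
    have H: "finite (H k)" "H k \<subseteq> C'" "F k \<subseteq> H k" "H k \<subseteq> I" for k
    proof -
      show "finite (H k)" using fin F(1) by (simp add: H_def)
      show "F k \<subseteq> H k" by (auto simp: H_def)
    qed (use HC C'(3) in blast)+
    have Hinc: "incseq H"
      unfolding H_def by (intro incseq_SucI) (auto intro: le_SucI)
    have Hcov: "C' \<subseteq> (\<Union>k. H k)"
      by (auto simp: H_def)
    have "(\<lambda>k. \<integral>x. norm (D (H k) x) \<partial>M) \<longlonglongrightarrow> 0"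
    proof (rule tendsto_sandwich[OF _ _ tendsto_const LIMSEQ_inverse_real_of_nat])
      show "\<forall>\<^sub>F k in sequentially. 0 \<le> (\<integral>x. norm (D (H k) x) \<partial>M)" by (intro always_eventually allI integral_nonneg_AE) simp
      have "norm (D Y x) = D Y x" for Y x by (simp add: D)
      then show "\<forall>\<^sub>F k in sequentially. (\<integral>x. norm (D (H k) x) \<partial>M) \<le> inverse (real (Suc k))"
        using F(3)[OF H(1) H(3) H(4)] by (intro always_eventually allI) (simp add: less_imp_le)
    qed
    \<comment> \<open>A subsequence converges almost everywhere, which suffices for increasing partial sums.\<close>
    then obtain r :: "nat \<Rightarrow> nat" where r: "strict_mono r" "AE x in M. (\<lambda>k. D (H (r k)) x) \<longlonglongrightarrow> 0"
      using tendsto_L1_AE_subseq[of M "\<lambda>k. D (H k)"] Dint[OF H(1) H(4)] by blast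
    have "AE x in M. \<forall>g\<in>C'. u g x \<in> \<real>\<^sub>\<ge>\<^sub>0"
      unfolding AE_ball_countable[OF C'(1)] using pos C'(3) by blast
    then show ?thesis
      using r(2)
    proof eventually_elim
      case (elim x)
      show ?case
      proof
        assume x: "x \<in> W"
        have "(\<lambda>k. sqrt (D (H (r k)) x)) \<longlonglongrightarrow> sqrt 0"
          using elim(2) by (rule tendsto_real_sqrt)
        then have "(\<lambda>k. (\<Sum>g\<in>H (r k). u g x) - s x) \<longlonglongrightarrow> 0"
          using x by (simp add: D tendsto_norm_zero_iff)
        then have lim: "(\<lambda>k. \<Sum>g\<in>H (r k). u g x) \<longlonglongrightarrow> s x"
          by (rule LIM_zero_cancel)
        have eq: "(\<Sum>g\<in>H k. u g x) = of_real (\<Sum>g\<in>H k. norm (u g x))" for k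
          unfolding of_real_sum using elim(1) H(2)
          by (intro sum.cong refl nonneg_Reals_eq_norm) blast
        have nn: "(\<Sum>g\<in>H k. u g x) \<in> \<real>\<^sub>\<ge>\<^sub>0" for k
          unfolding eq nonneg_Reals_of_real_iff by (intro sum_nonneg) simp
        have "s x \<in> \<real>\<^sub>\<ge>\<^sub>0"
          using closed_sequentially[OF closed_nonneg_Reals_complex nn lim] .
        moreover have "norm (\<Sum>g\<in>H k. u g x) = (\<Sum>g\<in>H k. norm (u g x))" for k
          unfolding eq norm_of_real by (simp add: sum_nonneg)
        then have "(\<lambda>k. \<Sum>g\<in>H (r k). norm (u g x)) \<longlonglongrightarrow> norm (s x)"
          using tendsto_norm[OF lim] by simp
        then have "((\<lambda>g. norm (u g x)) has_sum norm (s x)) C'"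
        proof (rule has_sum_exhaustion[where H = "\<lambda>k. H (r k)", rotated -1])
          show "incseq (\<lambda>k. H (r k))"
            using Hinc r(1) by (auto simp: incseq_def strict_mono_less_eq)
          show "C' \<subseteq> (\<Union>k. H (r k))"
          proof
            fix c assume "c \<in> C'"
            then obtain k where "c \<in> H k" using Hcov by blast
            then have "c \<in> H (r k)" using incseqD[OF Hinc seq_suble[OF r(1)]] by blast
            then show "c \<in> (\<Union>k. H (r k))" by blast
          qed
        qed (use H in auto)
        ultimately show "s x \<in> \<real>\<^sub>\<ge>\<^sub>0 \<and> ((\<lambda>g. norm (u g x)) has_sum norm (s x)) C'" ..
      qed
    qed
  qed
  then show ?thesis using C by blast
qed

text \<open>The sum of the squares is at most the square of the sum, separately over \<open>A'\<close> and over its complement.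
  So the difference between \<open>S\<^sup>2\<close> and the sum \<open>B\<close> of all squares dominates the mixed products.\<close>

lemma has_sum_defect:
  fixes t :: "'i \<Rightarrow> real"
  assumes pos: "\<And>i. i \<in> A \<Longrightarrow> t i \<ge> 0" and sub: "A' \<subseteq> A"
    and S: "(t has_sum S) A" and S': "(t has_sum S') A'" and B: "((\<lambda>i. (t i)\<^sup>2) has_sum B) A"
  shows "2 * S' * (S - S') \<le> S\<^sup>2 - B"
proof -
  have S'': "(t has_sum (S - S')) (A - A')" by (rule has_sum_Diff[OF S S' sub])
  have sq: "(\<Sum>i\<in>F. (t i)\<^sup>2) \<le> T\<^sup>2" if F: "finite F" "F \<subseteq> A''" and T: "(t has_sum T) A''" and A'': "A'' \<subseteq> A" for F T A''
  proof -
    have p: "t i \<ge> 0" if "i \<in> F" for i using that pos F A'' by blast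
    have "(\<Sum>i\<in>F. (t i)\<^sup>2) \<le> (\<Sum>i\<in>F. t i)\<^sup>2" using F(1) p
    proof (induction F rule: finite_induct)
      case (insert i F)
      have "0 \<le> 2 * t i * sum t F" using insert.prems by (intro mult_nonneg_nonneg sum_nonneg) auto
      then show ?case using insert by (simp add: power2_sum)
    qed simp
    also have "\<dots> \<le> T\<^sup>2"
      using finite_sum_le_has_sum[OF T F] pos A'' p by (intro power_mono sum_nonneg) auto
    finally show ?thesis .
  qed
  have "B \<le> S'\<^sup>2 + (S - S')\<^sup>2"
  proof (rule has_sum_le_finite_sums[OF B])
    fix F assume F: "finite F" "F \<subseteq> A"
    have "(\<Sum>i\<in>F. (t i)\<^sup>2) = (\<Sum>i\<in>F \<inter> A'. (t i)\<^sup>2) + (\<Sum>i\<in>F - A'. (t i)\<^sup>2)"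
      by (rule sum.Int_Diff[OF F(1)])
    also have "\<dots> \<le> S'\<^sup>2 + (S - S')\<^sup>2"
      using F sub by (intro add_mono sq[OF _ _ S'] sq[OF _ _ S'']) auto
    finally show "(\<Sum>i\<in>F. (t i)\<^sup>2) \<le> S'\<^sup>2 + (S - S')\<^sup>2" .
  qed
  then show "2 * S' * (S - S') \<le> S\<^sup>2 - B" by (simp add: power2_eq_square algebra_simps)
qed

lemma has_sum_tails:
  fixes t :: "'i \<Rightarrow> real" and A :: "nat \<Rightarrow> 'i set"
  assumes pos: "\<And>i. i \<in> A 0 \<Longrightarrow> t i \<ge> 0" and A: "decseq A" "(\<Inter>n. A n) = {e}"
    and S: "\<And>n. (t has_sum S n) (A n)"
  shows "S \<longlonglongrightarrow> t e"
proof (rule LIMSEQ_I)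
  fix \<epsilon> :: real assume "\<epsilon> > 0"
  have sub: "A n \<subseteq> A 0" for n using decseqD[OF A(1)] by simp
  have e: "e \<in> A n" for n using A(2) by blast
  have posn: "t i \<ge> 0" if "i \<in> A n" for i n using pos sub that by blast
  have "\<forall>\<^sub>F F in finite_subsets_at_top (A 0). sum t F > S 0 - \<epsilon>"
    using order_tendstoD(1)[OF S[of 0, unfolded has_sum_def]] \<open>\<epsilon> > 0\<close> by simp
  then obtain F where F: "finite F" "F \<subseteq> A 0" "\<And>Y. finite Y \<Longrightarrow> F \<subseteq> Y \<Longrightarrow> Y \<subseteq> A 0 \<Longrightarrow> sum t Y > S 0 - \<epsilon>"
    unfolding eventually_finite_subsets_at_top by metis
  have "\<exists>N. \<forall>n\<ge>N. F' \<inter> A n \<subseteq> {e}" if "finite F'" for F'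
    using that
  proof (induction F' rule: finite_induct)
    case (insert i F')
    then obtain N where N: "\<forall>n\<ge>N. F' \<inter> A n \<subseteq> {e}" by blast
    show ?case
    proof (cases "i = e")
      case True
      then show ?thesis using N by (intro exI[of _ N]) blast
    next
      case False
      then obtain n where n: "i \<notin> A n" using A(2) by blast
      have "insert i F' \<inter> A m \<subseteq> {e}" if "m \<ge> max N n" for m
        using N n decseqD[OF A(1), of n m] that by auto
      then show ?thesis by blast
    qed
  qed simp
  then obtain N where N: "\<And>n. n \<ge> N \<Longrightarrow> F \<inter> A n \<subseteq> {e}" using F(1) by blast
  have "norm (S n - t e) < \<epsilon>" if n: "n \<ge> N" for n
  proof -
    let ?F = "insert e F"
    have F1: "sum t ?F > S 0 - \<epsilon>" by (rule F(3)) (use F(1,2) e in auto)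
    have "S n \<le> t e + (S 0 - sum t ?F)"
    proof (rule has_sum_le_finite_sums[OF S])
      fix Y assume Y: "finite Y" "Y \<subseteq> A n"
      have YA: "Y \<subseteq> A 0" using Y(2) sub by blast
      have "sum t (Y - {e}) + sum t ?F = sum t ((Y - {e}) \<union> ?F)"
        using N[OF n] Y F(1) by (intro sum.union_disjoint[symmetric]) auto
      also have "\<dots> \<le> S 0"
        using Y(1) YA F(1,2) e[of 0] pos by (intro finite_sum_le_has_sum[OF S[of 0]]) auto
      finally have 1: "sum t (Y - {e}) \<le> S 0 - sum t ?F" by linarith
      have "sum t Y \<le> sum t (insert e Y)"
        using Y(1) posn[OF e] by (intro sum_mono2) auto
      also have "\<dots> = t e + sum t (Y - {e})" using Y(1) by (rule sum.insert_remove)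
      finally show "sum t Y \<le> t e + (S 0 - sum t ?F)" using 1 by linarith
    qed
    moreover have "sum t {e} \<le> S n"
      using e posn by (intro finite_sum_le_has_sum[OF S]) auto
    ultimately show ?thesis using F1 by (simp add: abs_less_iff)
  qed
  then show "\<exists>N. \<forall>n\<ge>N. norm (S n - t e) < \<epsilon>" by blast
qed

section \<open>Special elements are continuous functions vanishing at infinity\<close>

text \<open>The common situation: a special function \<open>a\<close> with its sums \<open>\<alpha> n\<close> and \<open>\<beta> n\<close>.\<close>

locale special_tower = measured_tower X p Xt \<mu>\<^sub>0 \<mu>
  for X :: "nat \<Rightarrow> 'a topology" and p and Xt and \<mu>\<^sub>0 :: "'a measure" and \<mu> +
  fixes a :: "(nat \<Rightarrow> 'a) \<Rightarrow> complex" and \<alpha> \<beta> :: "nat \<Rightarrow> 'a \<Rightarrow> complex"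
  assumes a_ess: "a \<in> ess_bounded \<mu>" and a_pos: "AE x in \<mu>. a x \<in> \<real>\<^sub>\<ge>\<^sub>0"
    and \<alpha>C0: "\<And>n. \<alpha> n \<in> carrier (C0 (X n))" and \<beta>C0: "\<And>n. \<beta> n \<in> carrier (C0 (X n))"
    and \<alpha>_sums: "\<And>n. strongly_sums \<mu> (\<lambda>g. group_act X p g a) (J n) (\<alpha> n \<circ> coord n)"
    and \<beta>_sums: "\<And>n. strongly_sums \<mu> (\<lambda>g. group_act X p g (\<lambda>x. (a x)\<^sup>2)) (J n) (\<beta> n \<circ> coord n)"
    and small: "\<And>\<epsilon>. \<epsilon> > 0 \<Longrightarrow> \<exists>N. \<forall>n\<ge>N. sup_norm (X n) (\<lambda>x. (\<alpha> n x)\<^sup>2 - \<beta> n x) < \<epsilon>"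
begin

lemma pullback_continuous: "f \<in> carrier (C0 (X n)) \<Longrightarrow> continuous_map Xt euclidean (f \<circ> coord n)"
  by (rule continuous_map_compose[OF continuous_coord C0_continuous])

lemma pullback_ess_bounded:
  assumes f: "f \<in> carrier (C0 (X n))" shows "f \<circ> coord n \<in> ess_bounded \<mu>"
proof -
  obtain C where C: "C \<ge> 0" "\<And>y. y \<in> topspace (X n) \<Longrightarrow> norm (f y) \<le> C" using C0_bounded[OF f] by blast
  have "AE x in \<mu>. norm ((f \<circ> coord n) x) \<le> C"
    by (rule AE_I2) (use C(2) coord_mem in \<open>auto simp: space_\<mu>\<close>)
  then show ?thesis
    by (rule ess_boundedI[OF continuous_measurable[OF pullback_continuous[OF f]]])
qed

lemma group_act_ess_bounded:
  assumes g: "g \<in> carrier G" and b: "b \<in> ess_bounded \<mu>"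
  shows "group_act X p g b \<in> ess_bounded \<mu>"
proof -
  obtain C where C: "AE x in \<mu>. norm (b x) \<le> C" using ess_bounded_bound[OF b] by blast
  have "AE x in \<mu>. norm (group_act X p g b x) \<le> C"
    using AE_G[OF G_inv(1)[OF g] C] by (simp add: group_act_def)
  moreover have "group_act X p g b \<in> borel_measurable \<mu>"
    unfolding group_act_def
    by (rule measurable_compose[OF G_measurable[OF G_inv(1)[OF g]] ess_bounded_measurable[OF b]])
  ultimately show ?thesis by (intro ess_boundedI)
qed

lemma group_act_pos:
  assumes g: "g \<in> carrier G" and b: "AE x in \<mu>. b x \<in> \<real>\<^sub>\<ge>\<^sub>0"
  shows "AE x in \<mu>. group_act X p g b x \<in> \<real>\<^sub>\<ge>\<^sub>0"
  using AE_G[OF G_inv(1)[OF g] b] by (simp add: group_act_def)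

lemma a2: "(\<lambda>x. (a x)\<^sup>2) \<in> ess_bounded \<mu>" "AE x in \<mu>. (a x)\<^sup>2 \<in> \<real>\<^sub>\<ge>\<^sub>0"
proof -
  show "(\<lambda>x. (a x)\<^sup>2) \<in> ess_bounded \<mu>"
    using ess_bounded_mult[OF a_ess a_ess] by (simp add: power2_eq_square)
  show "AE x in \<mu>. (a x)\<^sup>2 \<in> \<real>\<^sub>\<ge>\<^sub>0"
    using a_pos by eventually_elim (simp add: power2_eq_square nonneg_Reals_mult_I)
qed

text \<open>The terms of the sums, and the sums themselves pulled back to the limit space. All of these are nonnegative
  almost everywhere, so the norm loses nothing; it makes them real-valued and nonnegative everywhere.\<close>

definition "t x g = norm (a ((inv\<^bsub>G\<^esub> g) x))"
definition "A n x = norm (\<alpha> n (x n))"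
definition "B n x = norm (\<beta> n (x n))"

lemma t_nonneg: "t x g \<ge> 0" by (simp add: t_def)

lemma A_continuous: "continuous_map Xt euclidean (A n)"
  using continuous_map_norm[OF pullback_continuous[OF \<alpha>C0[of n]]] by (simp add: A_def[abs_def] o_def)

lemma A_nonneg: "A n x \<ge> 0" by (simp add: A_def)

text \<open>Near every point, the sums over all the kernels are computed almost everywhere by one countable
  set of group elements, which may be assumed to contain given ones.\<close>

lemma local_sums:
  assumes W: "W \<in> sets \<mu>" "emeasure \<mu> W < \<infinity>" and D: "countable D" "D \<subseteq> carrier G"
  obtains C where "D \<subseteq> C" "C \<subseteq> carrier G"
    "AE x in \<mu>. x \<in> W \<longrightarrow> (\<forall>n. \<alpha> n (x n) \<in> \<real>\<^sub>\<ge>\<^sub>0 \<and> \<beta> n (x n) \<in> \<real>\<^sub>\<ge>\<^sub>0 \<and>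
       (t x has_sum A n x) (C \<inter> J n) \<and> ((\<lambda>g. (t x g)\<^sup>2) has_sum B n x) (C \<inter> J n))"
proof -
  define Q where "Q b s n C \<longleftrightarrow> countable C \<and> C \<subseteq> J n \<and> (\<forall>C'. countable C' \<and> C \<subseteq> C' \<and> C' \<subseteq> J n \<longrightarrow>
      (AE x in \<mu>. x \<in> W \<longrightarrow> (s \<circ> coord n) x \<in> \<real>\<^sub>\<ge>\<^sub>0 \<and> ((\<lambda>g. norm (group_act X p g b x)) has_sum norm ((s \<circ> coord n) x)) C'))"
    for b and s :: "'a \<Rightarrow> complex" and n C
  have "\<exists>C. Q a (\<alpha> n) n C" for n
    unfolding Q_def
    by (rule strongly_sums_has_sum[OF \<alpha>_sums _ _ pullback_ess_bounded[OF \<alpha>C0] W])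
       (erule group_act_ess_bounded[OF J_carrier a_ess] group_act_pos[OF J_carrier a_pos])+
  then obtain C1 where C1: "\<And>n. Q a (\<alpha> n) n (C1 n)" by metis
  have "\<exists>C. Q (\<lambda>x. (a x)\<^sup>2) (\<beta> n) n C" for n
    unfolding Q_def
    by (rule strongly_sums_has_sum[OF \<beta>_sums _ _ pullback_ess_bounded[OF \<beta>C0] W])
       (erule group_act_ess_bounded[OF J_carrier a2(1)] group_act_pos[OF J_carrier a2(2)])+
  then obtain C2 where C2: "\<And>n. Q (\<lambda>x. (a x)\<^sup>2) (\<beta> n) n (C2 n)" by metis
  note C1' = C1[unfolded Q_def, THEN conjunct1] C1[unfolded Q_def, THEN conjunct2, THEN conjunct1]
    C1[unfolded Q_def, THEN conjunct2, THEN conjunct2, rule_format, OF conjI[OF _ conjI]]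
  note C2' = C2[unfolded Q_def, THEN conjunct1] C2[unfolded Q_def, THEN conjunct2, THEN conjunct1]
    C2[unfolded Q_def, THEN conjunct2, THEN conjunct2, rule_format, OF conjI[OF _ conjI]]
  define C where "C = D \<union> (\<Union>n. C1 n \<union> C2 n)"
  have Cc: "countable C" using D(1) C1'(1) C2'(1) by (simp add: C_def)
  have CG: "C \<subseteq> carrier G"
    unfolding C_def using D(2) C1'(2) C2'(2) J_carrier by blast
  have sub: "countable (C \<inter> J n)" "C1 n \<subseteq> C \<inter> J n" "C2 n \<subseteq> C \<inter> J n" "C \<inter> J n \<subseteq> J n" for n
    using Cc C1'(2) C2'(2) by (auto simp: C_def)
  have nt: "norm (group_act X p g a x) = t x g" "norm (group_act X p g (\<lambda>x. (a x)\<^sup>2) x) = (t x g)\<^sup>2" for g x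
    by (simp_all add: group_act_def t_def norm_power)
  have "AE x in \<mu>. x \<in> W \<longrightarrow> (\<alpha> n (x n) \<in> \<real>\<^sub>\<ge>\<^sub>0 \<and> \<beta> n (x n) \<in> \<real>\<^sub>\<ge>\<^sub>0 \<and>
       (t x has_sum A n x) (C \<inter> J n) \<and> ((\<lambda>g. (t x g)\<^sup>2) has_sum B n x) (C \<inter> J n))" for n
    using C1'(3)[OF sub(1,2,4), of n] C2'(3)[OF sub(1,3,4), of n]
    by eventually_elim (simp add: nt A_def B_def)
  then have "AE x in \<mu>. \<forall>n. x \<in> W \<longrightarrow> (\<alpha> n (x n) \<in> \<real>\<^sub>\<ge>\<^sub>0 \<and> \<beta> n (x n) \<in> \<real>\<^sub>\<ge>\<^sub>0 \<and>
       (t x has_sum A n x) (C \<inter> J n) \<and> ((\<lambda>g. (t x g)\<^sup>2) has_sum B n x) (C \<inter> J n))"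
    unfolding AE_all_countable by (rule allI)
  then have "AE x in \<mu>. x \<in> W \<longrightarrow> (\<forall>n. \<alpha> n (x n) \<in> \<real>\<^sub>\<ge>\<^sub>0 \<and> \<beta> n (x n) \<in> \<real>\<^sub>\<ge>\<^sub>0 \<and>
       (t x has_sum A n x) (C \<inter> J n) \<and> ((\<lambda>g. (t x g)\<^sup>2) has_sum B n x) (C \<inter> J n))"
    by eventually_elim (intro impI allI, simp only: simp_thms)
  moreover have "D \<subseteq> C" by (simp add: C_def)
  ultimately show thesis by (intro that[of C] CG)
qed

lemma finite_measure_nbhd:
  assumes "x \<in> topspace Xt"
  obtains W where "openin Xt W" "x \<in> W" "W \<in> sets \<mu>" "emeasure \<mu> W < \<infinity>"
proof -
  obtain U K where U: "openin Xt U" "compactin Xt K" "x \<in> U" "U \<subseteq> K"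
    using locally_compact_Xt assms unfolding locally_compact_space_def by blast
  have "emeasure \<mu> U < \<infinity>"
    by (rule le_less_trans[OF emeasure_mono[OF U(4) compactin_sets[OF U(2)]] compactin_finite[OF U(2)]])
  then show thesis using that[of U] U openin_sets by blast
qed

lemma sums_mono:
  assumes "n \<le> m" "x \<in> topspace Xt"
  shows "A m x \<le> A n x"
proof -
  obtain W where W: "openin Xt W" "x \<in> W" "W \<in> sets \<mu>" "emeasure \<mu> W < \<infinity>"
    by (rule finite_measure_nbhd[OF assms(2)])
  obtain C where C: "C \<subseteq> carrier G" 
    "AE x in \<mu>. x \<in> W \<longrightarrow> (\<forall>n. \<alpha> n (x n) \<in> \<real>\<^sub>\<ge>\<^sub>0 \<and> \<beta> n (x n) \<in> \<real>\<^sub>\<ge>\<^sub>0 \<and>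
       (t x has_sum A n x) (C \<inter> J n) \<and> ((\<lambda>g. (t x g)\<^sup>2) has_sum B n x) (C \<inter> J n))"
    by (rule local_sums[OF W(3,4) countable_empty empty_subsetI])
  have "AE x in \<mu>. x \<in> W \<longrightarrow> A m x \<le> A n x"
    using C(2)
  proof eventually_elim
    case (elim x)
    show ?case
    proof
      assume "x \<in> W"
      then have h: "(t x has_sum A k x) (C \<inter> J k)" for k using elim by blast
      have "C \<inter> J m \<subseteq> C \<inter> J n" using J_antimono[OF assms(1)] by blast
      then show "A m x \<le> A n x"
        by (rule has_sum_mono2[OF h h]) (rule t_nonneg)
    qed
  qed
  then show ?thesis
    using AE_continuous_le[OF A_continuous A_continuous W(1) _ W(2)] by blast
qed

text \<open>For \<open>n\<close> large and \<open>m \<ge> n\<close> each value of \<open>A m\<close> is close to \<open>0\<close> or close to that of \<open>A n\<close>.\<close>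

lemma sums_defect:
  assumes "e > 0"
  obtains N where "\<And>n m x. N \<le> n \<Longrightarrow> n \<le> m \<Longrightarrow> x \<in> topspace Xt \<Longrightarrow> A m x * (A n x - A m x) \<le> e"
proof -
  obtain N where N: "\<And>n. n \<ge> N \<Longrightarrow> sup_norm (X n) (\<lambda>x. (\<alpha> n x)\<^sup>2 - \<beta> n x) < 2 * e"
    using small[of "2 * e"] assms by auto
  have "A m x * (A n x - A m x) \<le> e" if n: "N \<le> n" "n \<le> m" and x: "x \<in> topspace Xt" for n m x
  proof -
    obtain c where c: "c \<ge> 0" "\<And>y. y \<in> topspace (X n) \<Longrightarrow> norm (\<alpha> n y) \<le> c" using C0_bounded[OF \<alpha>C0] by blast
    obtain d where d: "d \<ge> 0" "\<And>y. y \<in> topspace (X n) \<Longrightarrow> norm (\<beta> n y) \<le> d" using C0_bounded[OF \<beta>C0] by blast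
    have "norm ((\<alpha> n y)\<^sup>2 - \<beta> n y) \<le> c\<^sup>2 + d" if "y \<in> topspace (X n)" for y
      using norm_triangle_ineq4[of "(\<alpha> n y)\<^sup>2" "\<beta> n y"] power_mono[OF c(2)[OF that], of 2] d(2)[OF that]
      by (simp add: norm_power)
    then have up: "norm ((\<alpha> n y)\<^sup>2 - \<beta> n y) \<le> 2 * e" if "y \<in> topspace (X n)" for y
      using sup_norm_upper[of "X n" "\<lambda>x. (\<alpha> n x)\<^sup>2 - \<beta> n x" "c\<^sup>2 + d" y] N[OF n(1)] that by fastforce
    obtain W where W: "openin Xt W" "x \<in> W" "W \<in> sets \<mu>" "emeasure \<mu> W < \<infinity>"
      by (rule finite_measure_nbhd[OF x])
    obtain C where C: "C \<subseteq> carrier G" 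
      "AE x in \<mu>. x \<in> W \<longrightarrow> (\<forall>n. \<alpha> n (x n) \<in> \<real>\<^sub>\<ge>\<^sub>0 \<and> \<beta> n (x n) \<in> \<real>\<^sub>\<ge>\<^sub>0 \<and>
         (t x has_sum A n x) (C \<inter> J n) \<and> ((\<lambda>g. (t x g)\<^sup>2) has_sum B n x) (C \<inter> J n))"
      by (rule local_sums[OF W(3,4) countable_empty empty_subsetI])
    have "AE x in \<mu>. x \<in> W \<longrightarrow> A m x * (A n x - A m x) \<le> e"
      using C(2)
    proof eventually_elim
      case (elim x)
      show ?case
      proof
        assume xW: "x \<in> W"
        then have xX: "x \<in> topspace Xt" using W(1) openin_subset by blast
        have h: "(t x has_sum A k x) (C \<inter> J k)" "((\<lambda>g. (t x g)\<^sup>2) has_sum B k x) (C \<inter> J k)" for k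
          using elim xW by blast+
        have "C \<inter> J m \<subseteq> C \<inter> J n" using J_antimono[OF n(2)] by blast
        then have "2 * A m x * (A n x - A m x) \<le> (A n x)\<^sup>2 - B n x"
          by (rule has_sum_defect[OF t_nonneg _ h(1) h(1) h(2)])
        also have "\<dots> \<le> norm (complex_of_real ((A n x)\<^sup>2 - B n x))" unfolding norm_of_real by (rule abs_ge_self)
        also have "complex_of_real ((A n x)\<^sup>2 - B n x) = (\<alpha> n (x n))\<^sup>2 - \<beta> n (x n)"
        proof -
          have "\<alpha> n (x n) = of_real (A n x)" "\<beta> n (x n) = of_real (B n x)"
            unfolding A_def B_def using elim xW by (blast intro: nonneg_Reals_eq_norm)+
          then show ?thesis by simp
        qed
        also have "norm \<dots> \<le> 2 * e" by (rule up[OF coord_mem[OF xX]])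
        finally show "A m x * (A n x - A m x) \<le> e" by simp
      qed
    qed
    moreover have "continuous_map Xt euclidean (\<lambda>x. A m x * (A n x - A m x))"
      by (intro continuous_map_real_mult continuous_map_diff A_continuous)
    moreover have "continuous_map Xt euclidean (\<lambda>x. e)" by simp
    ultimately show ?thesis
      using AE_continuous_le[where f = "\<lambda>x. A m x * (A n x - A m x)" and h = "\<lambda>x. e" and V = W and x = x] W(1,2) by blast
  qed
  then show thesis using that by blast
qed

text \<open>The pointwise limit of the sums.\<close>

definition "L x = lim (\<lambda>n. A n x)"

lemma L_tendsto:
  assumes "x \<in> topspace Xt" shows "(\<lambda>n. A n x) \<longlonglongrightarrow> L x"
proof -
  have "decseq (\<lambda>n. A n x)" using sums_mono assms by (auto simp: decseq_def)
  then obtain l where "(\<lambda>n. A n x) \<longlonglongrightarrow> l" using A_nonneg decseq_convergent[of "\<lambda>n. A n x" 0] by blast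
  then show ?thesis unfolding L_def by (simp add: limI)
qed

lemma L_bounds:
  assumes "x \<in> topspace Xt" shows "0 \<le> L x" "L x \<le> A n x"
proof -
  show "0 \<le> L x" by (rule LIMSEQ_le_const[OF L_tendsto[OF assms]]) (use A_nonneg in auto)
  have "decseq (\<lambda>n. A n x)" using sums_mono assms by (auto simp: decseq_def)
  then show "L x \<le> A n x" using L_tendsto[OF assms] by (rule decseq_ge)
qed

lemma L_defect:
  assumes "e > 0"
  obtains N where "\<And>n x. N \<le> n \<Longrightarrow> x \<in> topspace Xt \<Longrightarrow> L x * (A n x - L x) \<le> e"
proof -
  obtain N where N: "\<And>n m x. N \<le> n \<Longrightarrow> n \<le> m \<Longrightarrow> x \<in> topspace Xt \<Longrightarrow> A m x * (A n x - A m x) \<le> e"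
    using sums_defect[OF assms] by metis
  have "L x * (A n x - L x) \<le> e" if "N \<le> n" "x \<in> topspace Xt" for n x
  proof (rule LIMSEQ_le_const2)
    show "(\<lambda>m. A m x * (A n x - A m x)) \<longlonglongrightarrow> L x * (A n x - L x)"
      by (intro tendsto_intros L_tendsto that)
    show "\<exists>M. \<forall>m\<ge>M. A m x * (A n x - A m x) \<le> e" using N that by blast
  qed
  then show thesis using that by blast
qed

lemma connected_intermediate:
  fixes f :: "(nat \<Rightarrow> 'a) \<Rightarrow> real"
  assumes f: "continuous_map Xt euclidean f" and U: "connectedin Xt U" "x \<in> U" "y \<in> U" and c: "f y \<le> c" "c \<le> f x"
  obtains z where "z \<in> U" "f z = c"
proof -
  have "connectedin euclideanreal (f ` U)" by (rule connectedin_continuous_map_image[OF f U(1)])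
  then have "connected (f ` U)" by simp
  then have "c \<in> f ` U" using U c unfolding connected_iff_interval by blast
  then show thesis using that by blast
qed

text \<open>Upper semicontinuity is clear for a decreasing limit. For the lower estimate at a point where \<open>L\<close> is not
  small, a connected neighbourhood is taken on which some \<open>A n\<close> is nearly as large as \<open>L x\<close>. There no later
  \<open>A m\<close> can drop to \<open>L x - \<eta>/2\<close>, since it would take that intermediate value.\<close>

lemma L_continuous: "continuous_map Xt euclidean L"
  unfolding continuous_map_metric_iff
proof (intro ballI allI impI)
  fix x and \<eta> :: real assume x: "x \<in> topspace Xt" and \<eta>: "\<eta> > 0"
  have opn: "\<exists>U. openin Xt U \<and> x \<in> U \<and> (\<forall>y\<in>U. A n y \<in> S)" if "open S" "A n x \<in> S" for n S
    using openin_continuous_map_preimage[OF A_continuous, of S n] that x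
    by (intro exI[of _ "{y \<in> topspace Xt. A n y \<in> S}"]) simp
  obtain m where "A m x < L x + \<eta>"
    using order_tendstoD(2)[OF L_tendsto[OF x], of "L x + \<eta>"] \<eta>
    unfolding eventually_sequentially by auto
  then obtain U1 where U1: "openin Xt U1" "x \<in> U1" "\<And>y. y \<in> U1 \<Longrightarrow> A m y < L x + \<eta>"
    using opn[of "{..<L x + \<eta>}" m] by auto
  have upper: "L y < L x + \<eta>" if y: "y \<in> U1" for y
  proof -
    have "y \<in> topspace Xt" using openin_subset[OF U1(1)] y by blast
    then show ?thesis using L_bounds(2)[of y m] U1(3)[OF y] by simp
  qed
  have "\<exists>U2. openin Xt U2 \<and> x \<in> U2 \<and> (\<forall>y\<in>U2. L x - \<eta> < L y)"
  proof (cases "L x < \<eta>")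
    case True
    have "L x - \<eta> < L y" if "y \<in> topspace Xt" for y using L_bounds(1)[OF that] True by simp
    then show ?thesis using x by blast
  next
    case False
    have e: "\<eta>\<^sup>2/16 > 0" using \<eta> by simp
    obtain N where N: "\<And>n m x. N \<le> n \<Longrightarrow> n \<le> m \<Longrightarrow> x \<in> topspace Xt \<Longrightarrow> A m x * (A n x - A m x) \<le> \<eta>\<^sup>2/16"
      using sums_defect[OF e] by metis
    have "A N x > L x - \<eta>/4" using L_bounds(2)[OF x, of N] \<eta> by simp
    then obtain U where U: "openin Xt U" "x \<in> U" "\<And>y. y \<in> U \<Longrightarrow> A N y > L x - \<eta>/4"
      using opn[of "{L x - \<eta>/4<..}" N] by auto
    obtain U' where U': "openin Xt U'" "connectedin Xt U'" "x \<in> U'" "U' \<subseteq> U"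
      using locally_connected_Xt U(1,2) unfolding locally_connected_space by meson
    have "L x - \<eta>/2 \<le> A m y" if y: "y \<in> U'" and m: "m \<ge> N" for y m
    proof (rule ccontr)
      assume "\<not> L x - \<eta>/2 \<le> A m y"
      then have c: "A m y \<le> L x - \<eta>/2" "L x - \<eta>/2 \<le> A m x" using L_bounds(2)[OF x, of m] \<eta> by auto
      obtain z where z: "z \<in> U'" "A m z = L x - \<eta>/2"
        by (rule connected_intermediate[OF A_continuous U'(2,3) y c])
      then have zX: "z \<in> topspace Xt" using openin_subset[OF U'(1)] by blast
      have "\<eta>/2 * (\<eta>/4) \<le> A m z * (A N z - A m z)"
        using z(2) U(3)[of z] z(1) U'(4) False \<eta> by (intro mult_mono) auto
      also have "\<dots> \<le> \<eta>\<^sup>2/16" by (rule N[OF order_refl m zX])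
      finally show False using \<eta> by (simp add: power2_eq_square)
    qed
    then have "L x - \<eta>/2 \<le> L y" if y: "y \<in> U'" for y
      using LIMSEQ_le_const[OF L_tendsto[of y], of "L x - \<eta>/2"] openin_subset[OF U'(1)] y by blast
    then have "\<forall>y\<in>U'. L x - \<eta> < L y" using \<eta> by force
    then show ?thesis using U' by blast
  qed
  then obtain U2 where U2: "openin Xt U2" "x \<in> U2" "\<And>y. y \<in> U2 \<Longrightarrow> L x - \<eta> < L y" by blast
  show "\<exists>U. openin Xt U \<and> x \<in> U \<and> (\<forall>y\<in>U. dist (L x) (L y) < \<eta>)"
  proof (intro exI[of _ "U1 \<inter> U2"] conjI ballI)
    fix y assume "y \<in> U1 \<inter> U2"
    then have "L x - \<eta> < L y" "L y < L x + \<eta>" using U2(3) upper by blast+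
    then show "dist (L x) (L y) < \<eta>" by (simp add: dist_real_def abs_less_iff)
  qed (use U1 U2 in auto)
qed

lemma J_Inter:
  assumes "\<And>n. g \<in> J n" shows "g = \<one>\<^bsub>G\<^esub>"
proof (rule G_extensional)
  show "g \<in> carrier G" using assms J_carrier by blast
  show "\<one>\<^bsub>G\<^esub> \<in> carrier G" using J_one J_carrier by blast
  fix x assume x: "x \<in> topspace Xt"
  have "g x n = x n" for n using assms[of n] x by (simp add: limit_kernel_iff)
  then show "g x = \<one>\<^bsub>G\<^esub> x" using G_one[OF x] by auto
qed

lemma t_one: "x \<in> topspace Xt \<Longrightarrow> t x \<one>\<^bsub>G\<^esub> = norm (a x)"
  using G_inv(2)[of "\<one>\<^bsub>G\<^esub>" x] monoid.inv_one[OF group.is_monoid[OF group_G]] G_one by (simp add: t_def)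

text \<open>The tails \<open>C \<inter> J n\<close> shrink to the identity, whose term is \<open>a\<close> itself.\<close>

lemma a_eq_L: "AE x in \<mu>. a x = of_real (L x)"
proof (rule AE_locally)
  have "(\<lambda>x. complex_of_real (L x)) \<in> borel_measurable \<mu>"
    by (rule measurable_compose[OF continuous_measurable[OF L_continuous] borel_measurable_of_real])
  then have "(\<lambda>x. a x - of_real (L x)) \<in> borel_measurable \<mu>"
    by (rule borel_measurable_diff[OF ess_bounded_measurable[OF a_ess]])
  then have "(\<lambda>x. a x - of_real (L x)) -` (- {0}) \<inter> space \<mu> \<in> sets \<mu>"
    by (rule measurable_sets) simp
  moreover have "(\<lambda>x. a x - of_real (L x)) -` (- {0}) \<inter> space \<mu> = {x \<in> space \<mu>. a x \<noteq> of_real (L x)}"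
    by auto
  ultimately show "{x \<in> space \<mu>. a x \<noteq> of_real (L x)} \<in> sets \<mu>" by simp
  fix x assume x: "x \<in> topspace Xt"
  obtain W where W: "openin Xt W" "x \<in> W" "W \<in> sets \<mu>" "emeasure \<mu> W < \<infinity>"
    by (rule finite_measure_nbhd[OF x])
  have D: "countable {\<one>\<^bsub>G\<^esub>}" "{\<one>\<^bsub>G\<^esub>} \<subseteq> carrier G" using J_one J_carrier by auto
  obtain C where C: "{\<one>\<^bsub>G\<^esub>} \<subseteq> C" "C \<subseteq> carrier G" 
      "AE x in \<mu>. x \<in> W \<longrightarrow> (\<forall>n. \<alpha> n (x n) \<in> \<real>\<^sub>\<ge>\<^sub>0 \<and> \<beta> n (x n) \<in> \<real>\<^sub>\<ge>\<^sub>0 \<and>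
         (t x has_sum A n x) (C \<inter> J n) \<and> ((\<lambda>g. (t x g)\<^sup>2) has_sum B n x) (C \<inter> J n))"
    by (rule local_sums[OF W(3,4) D])
  have "AE y in \<mu>. y \<in> W \<longrightarrow> a y = of_real (L y)"
    using C(3) a_pos
  proof eventually_elim
    case (elim y)
    show ?case
    proof
      assume yW: "y \<in> W"
      then have y: "y \<in> topspace Xt" using openin_subset[OF W(1)] by blast
      have "(\<lambda>n. A n y) \<longlonglongrightarrow> t y \<one>\<^bsub>G\<^esub>"
      proof (rule has_sum_tails[where t = "t y" and S = "\<lambda>n. A n y" and A = "\<lambda>n. C \<inter> J n" and e = "\<one>\<^bsub>G\<^esub>"])
        show "decseq (\<lambda>n. C \<inter> J n)" using J_antimono by (auto simp: decseq_def)
        show "(\<Inter>n. C \<inter> J n) = {\<one>\<^bsub>G\<^esub>}" using J_Inter C(1) J_one by auto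
        show "(t y has_sum A n y) (C \<inter> J n)" for n using elim yW by blast
      qed (rule t_nonneg)
      then have "L y = norm (a y)" using LIMSEQ_unique[OF L_tendsto[OF y]] t_one[OF y] by simp
      then show "a y = of_real (L y)" using nonneg_Reals_eq_norm[OF elim(2)] by simp
    qed
  qed
  then show "\<exists>V. openin Xt V \<and> x \<in> V \<and> (AE y in \<mu>. y \<in> V \<longrightarrow> a y = of_real (L y))" using W by blast
qed

text \<open>The right-hand side is a sum of nonnegative terms, two of which are those on the left.\<close>

lemma L_translate:
  assumes g: "g \<in> J n" "g \<noteq> \<one>\<^bsub>G\<^esub>" and x: "x \<in> topspace Xt"
  shows "L x + L (g x) \<le> A n x"
proof -
  let ?h = "inv\<^bsub>G\<^esub> g"
  have hJ: "?h \<in> J n" by (rule J_inv[OF g(1)])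
  have gG: "g \<in> carrier G" using g(1) by (rule J_carrier)
  have inv: "inv\<^bsub>G\<^esub> ?h = g" using group.inv_inv[OF group_G gG] .
  have h1: "?h \<noteq> \<one>\<^bsub>G\<^esub>" using inv g(2) monoid.inv_one[OF group.is_monoid[OF group_G]] by metis
  obtain W where W: "openin Xt W" "x \<in> W" "W \<in> sets \<mu>" "emeasure \<mu> W < \<infinity>"
    by (rule finite_measure_nbhd[OF x])
  have D: "countable {\<one>\<^bsub>G\<^esub>, ?h}" "{\<one>\<^bsub>G\<^esub>, ?h} \<subseteq> carrier G" using J_one J_carrier hJ by auto
  obtain C where C: "{\<one>\<^bsub>G\<^esub>, ?h} \<subseteq> C" "C \<subseteq> carrier G" 
      "AE x in \<mu>. x \<in> W \<longrightarrow> (\<forall>n. \<alpha> n (x n) \<in> \<real>\<^sub>\<ge>\<^sub>0 \<and> \<beta> n (x n) \<in> \<real>\<^sub>\<ge>\<^sub>0 \<and>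
         (t x has_sum A n x) (C \<inter> J n) \<and> ((\<lambda>g. (t x g)\<^sup>2) has_sum B n x) (C \<inter> J n))"
    by (rule local_sums[OF W(3,4) D])
  have "AE y in \<mu>. y \<in> W \<longrightarrow> L y + L (g y) \<le> A n y"
    using C(3) a_eq_L AE_G[OF gG a_eq_L]
  proof eventually_elim
    case (elim y)
    show ?case
    proof
      assume yW: "y \<in> W"
      then have y: "y \<in> topspace Xt" using openin_subset[OF W(1)] by blast
      have "(t y has_sum A n y) (C \<inter> J n)" using elim(1) yW by blast
      then have "sum (t y) {\<one>\<^bsub>G\<^esub>, ?h} \<le> A n y"
        by (rule finite_sum_le_has_sum) (use C(1) hJ J_one t_nonneg in auto)
      moreover have "t y ?h = L (g y)"
        using elim(3) L_bounds(1)[OF G_maps_to[OF gG y]] by (simp add: t_def inv)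
      moreover have "t y \<one>\<^bsub>G\<^esub> = L y"
        using elim(2) L_bounds(1)[OF y] t_one[OF y] by simp
      ultimately show "L y + L (g y) \<le> A n y" using h1 by simp
    qed
  qed
  moreover have "continuous_map Xt euclidean (\<lambda>y. L y + L (g y))"
    using L_continuous continuous_map_compose[OF G_continuous[OF gG] L_continuous]
    by (intro continuous_map_add) (simp_all add: o_def)
  ultimately show ?thesis
    using AE_continuous_le[where f = "\<lambda>y. L y + L (g y)" and h = "A n" and V = W and x = x] W(1,2) A_continuous by blast
qed

text \<open>The set where \<open>L\<close> is large projects injectively, and properly, to some \<open>X n\<close>.\<close>

lemma L_vanishes:
  assumes \<eta>: "\<eta> > 0"
  shows "compactin Xt {x \<in> topspace Xt. \<eta> \<le> L x}"
proof -
  let ?D = "{x \<in> topspace Xt. \<eta> \<le> L x}"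
  have e: "\<eta>\<^sup>2/16 > 0" using \<eta> by simp
  obtain n where n: "\<And>x. x \<in> topspace Xt \<Longrightarrow> L x * (A n x - L x) \<le> \<eta>\<^sup>2/16"
    using L_defect[OF e] by (metis order_refl)
  have clD: "closedin Xt ?D"
    using closedin_continuous_map_preimage[OF L_continuous, of "{\<eta>..}"] by simp
  let ?K = "{y \<in> topspace (X n). \<eta> \<le> norm (\<alpha> n y)}"
  have K: "compactin (X n) ?K"
    using \<alpha>C0[of n] \<eta> by (simp add: C0_def)
  define R where "R y U C \<longleftrightarrow> openin (X n) U \<and> y \<in> U \<and> compactin Xt C \<and> (\<forall>x\<in>?D. x n \<in> U \<longrightarrow> x \<in> C)" for y U C
  have loc: "\<exists>U C. R y U C" if y: "y \<in> ?K" for y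
  proof -
    have "continuous_map (X n) euclidean (\<lambda>z. norm (\<alpha> n z))"
      by (rule continuous_map_norm[OF C0_continuous[OF \<alpha>C0]])
    then have "openin (X n) {z \<in> topspace (X n). norm (\<alpha> n z) \<in> {3*\<eta>/4<..}}"
      by (rule openin_continuous_map_preimage) simp
    moreover have "y \<in> {z \<in> topspace (X n). norm (\<alpha> n z) \<in> {3*\<eta>/4<..}}" using y \<eta> by simp
    ultimately obtain W \<V> where W: "openin (X n) W" "connectedin (X n) W" "y \<in> W" "W \<subseteq> {z \<in> topspace (X n). norm (\<alpha> n z) \<in> {3*\<eta>/4<..}}"
      "\<forall>V\<in>\<V>. openin Xt V \<and> inj_on (coord n) V \<and> coord n ` V = W \<and> connectedin Xt V"
      "pairwise disjnt \<V>" "\<Union>\<V> = {x \<in> topspace Xt. coord n x \<in> W}"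
      by (rule covering_sheets[OF covering_coord locally_connected_X])
    have AW: "A n x > 3*\<eta>/4" if "x n \<in> W" for x
      using W(4) that by (auto simp: A_def)
    \<comment> \<open>A sheet that meets the set carries large values of \<open>L\<close> throughout, \<dots>\<close>
    have big: "L z \<ge> \<eta>/2" if V: "V \<in> \<V>" and x: "x \<in> V" "x \<in> ?D" and z: "z \<in> V" for V x z
    proof (rule ccontr)
      assume "\<not> L z \<ge> \<eta>/2"
      then have c: "L z \<le> \<eta>/2" "\<eta>/2 \<le> L x" using x(2) \<eta> by auto
      have con: "connectedin Xt V" using W(5) V by blast
      obtain w where w: "w \<in> V" "L w = \<eta>/2"
        by (rule connected_intermediate[OF L_continuous con x(1) z c])
      have "w \<in> \<Union>\<V>" using w(1) V by blast
      then have wX: "w \<in> topspace Xt" "w n \<in> W" unfolding W(7) by auto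
      have "\<eta>/2 * (\<eta>/4) \<le> L w * (A n w - L w)"
        using w(2) AW[of w] wX(2) \<eta> by (intro mult_mono) auto
      also have "\<dots> \<le> \<eta>\<^sup>2/16" by (rule n[OF wX(1)])
      finally show False using \<eta> by (simp add: power2_eq_square)
    qed
    \<comment> \<open>\<dots> and by transitivity two such sheets would give two large terms in one sum.\<close>
    have one: "V = V'" if V: "V \<in> \<V>" "V' \<in> \<V>" and x: "x \<in> V" "x \<in> ?D" "x' \<in> V'" "x' \<in> ?D" for V V' x x'
    proof (rule ccontr)
      assume ne: "V \<noteq> V'"
      have "y \<in> coord n ` V" "y \<in> coord n ` V'" using W(3,5) V by auto
      then obtain z z' where z: "z \<in> V" "y = z n" and z': "z' \<in> V'" "y = z' n" by blast
      have "z \<in> \<Union>\<V>" "z' \<in> \<Union>\<V>" using z(1) z'(1) V by blast+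
      then have zX: "z \<in> topspace Xt" "z n \<in> W" "z' \<in> topspace Xt" unfolding W(7) by auto
      have zn: "z n = z' n" using z(2) z'(2) by simp
      obtain g where g: "g \<in> J n" "g z = z'"
        by (rule J_transitive[OF zX(1,3) zn])
      have "z \<noteq> z'" using W(6) V ne z(1) z'(1) unfolding pairwise_def disjnt_def by blast
      then have "g \<noteq> \<one>\<^bsub>G\<^esub>" using g(2) G_one[OF zX(1)] by auto
      then have "L z + L z' \<le> A n z" using L_translate[OF g(1) _ zX(1)] g(2) by simp
      moreover have "L z \<ge> \<eta>/2" "L z' \<ge> \<eta>/2" using big[OF V(1) x(1,2) z(1)] big[OF V(2) x(3,4) z'(1)] .
      ultimately have "\<eta>/2 * (\<eta>/2) \<le> L z * (A n z - L z)"
        using \<eta> by (intro mult_mono) auto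
      also have "\<dots> \<le> \<eta>\<^sup>2/16" by (rule n[OF zX(1)])
      finally show False using \<eta> by (simp add: power2_eq_square)
    qed
    have "neighbourhood_base_of (\<lambda>C. compactin (X n) C) (X n)"
      using locally_compact_space_neighbourhood_base[of "X n"] X_props(2,4)[of n] by simp
    then obtain U C where U: "openin (X n) U" "compactin (X n) C" "y \<in> U" "U \<subseteq> C" "C \<subseteq> W"
      using W(1,3) unfolding neighbourhood_base_of by meson
    show ?thesis
    proof (cases "\<exists>V\<in>\<V>. V \<inter> ?D \<noteq> {}")
      case True
      then obtain V x0 where V: "V \<in> \<V>" "x0 \<in> V" "x0 \<in> ?D" by blast
      have Vp: "openin Xt V" "inj_on (coord n) V" "coord n ` V = W" using W(5) V(1) by auto
      have hm: "homeomorphic_map (subtopology Xt V) (subtopology (X n) W) (coord n)"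
        using homeomorphic_map_open_subsets_iff[OF continuous_coord covering_projection_open_map[OF covering_coord]
            Vp(1) openin_subset[OF W(1)]] Vp(2,3) by simp
      let ?C = "{x \<in> V. x n \<in> C}"
      have "coord n ` ?C = C" using Vp(3) U(5) by blast
      moreover have "compactin (subtopology (X n) W) C" using U(2,5) by (simp add: compactin_subtopology)
      ultimately have "compactin (subtopology (X n) W) (coord n ` ?C)" by simp
      moreover have "?C \<subseteq> topspace (subtopology Xt V)" using openin_subset[OF Vp(1)] by auto
      ultimately have "compactin (subtopology Xt V) ?C"
        using homeomorphic_map_compactness[OF hm] by blast
      then have cC: "compactin Xt ?C" by (simp add: compactin_subtopology)
      have "x \<in> ?C" if x: "x \<in> ?D" "x n \<in> U" for x
      proof -
        have "x \<in> \<Union>\<V>" unfolding W(7) using x U(4,5) by blast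
        then obtain V' where V': "V' \<in> \<V>" "x \<in> V'" by blast
        have "V = V'" by (rule one[OF V(1) V'(1) V(2,3) V'(2) x(1)])
        then show ?thesis using V'(2) x(2) U(4) by blast
      qed
      then have "R y U ?C" unfolding R_def using U(1,3) cC by blast
      then show ?thesis by blast
    next
      case False
      have "\<not> x n \<in> U" if x: "x \<in> ?D" for x
      proof
        assume "x n \<in> U"
        then have "x \<in> \<Union>\<V>" unfolding W(7) using x U(4,5) by blast
        then show False using False x by blast
      qed
      then have "R y U {}" unfolding R_def using U(1,3) by simp
      then show ?thesis by blast
    qed
  qed
  obtain U C where UC0: "\<And>y. y \<in> ?K \<Longrightarrow> R y (U y) (C y)"
    using loc by metis
  have UC: "\<And>y. y \<in> ?K \<Longrightarrow> openin (X n) (U y)" "\<And>y. y \<in> ?K \<Longrightarrow> y \<in> U y"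
    "\<And>y. y \<in> ?K \<Longrightarrow> compactin Xt (C y)" "\<And>y x. y \<in> ?K \<Longrightarrow> x \<in> ?D \<Longrightarrow> x n \<in> U y \<Longrightarrow> x \<in> C y"
    using UC0 unfolding R_def by blast+
  have "\<exists>\<F>. finite \<F> \<and> \<F> \<subseteq> U ` ?K \<and> ?K \<subseteq> \<Union>\<F>"
    using UC(1,2) by (intro compactinD[OF K]) auto
  then obtain F where F: "finite F" "F \<subseteq> ?K" "?K \<subseteq> (\<Union>y\<in>F. U y)"
    by (metis (no_types, lifting) finite_subset_image)
  have "compactin Xt (\<Union>y\<in>F. C y)"
    using F(1,2) UC(3) by (intro compactin_Union) auto
  moreover have "?D \<subseteq> (\<Union>y\<in>F. C y)"
  proof
    fix x assume x: "x \<in> ?D"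
    then have "x n \<in> ?K" using L_bounds(2)[of x n] coord_mem[of x n] by (auto simp: A_def)
    then obtain y where y: "y \<in> F" "x n \<in> U y" using F(3) by blast
    then have "x \<in> C y" using UC(4)[of y x] F(2) x by blast
    then show "x \<in> (\<Union>y\<in>F. C y)" using y(1) by blast
  qed
  ultimately show ?thesis using clD closed_compactin by blast
qed

lemma special_in_image: "Linf_class \<mu> a \<in> Linf_class \<mu> ` carrier (C0 Xt)"
proof -
  have c: "continuous_map Xt euclidean (\<lambda>x. complex_of_real (L x))"
    using continuous_map_compose[OF L_continuous, of euclidean complex_of_real] by (simp add: o_def continuous_on_of_real_id)
  have "restrict (\<lambda>x. complex_of_real (L x)) (topspace Xt) \<in> carrier (C0 Xt)"
  proof (rule C0_restrictI[OF c])
    fix \<epsilon> :: real assume "\<epsilon> > 0"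
    then show "\<exists>K. compactin Xt K \<and> (\<forall>x\<in>topspace Xt - K. norm (complex_of_real (L x)) < \<epsilon>)"
      using L_vanishes L_bounds(1) by (intro exI[of _ "{x \<in> topspace Xt. \<epsilon> \<le> L x}"]) auto
  qed
  moreover have "Linf_class \<mu> a = Linf_class \<mu> (restrict (\<lambda>x. complex_of_real (L x)) (topspace Xt))"
    unfolding Linf_class_restrict by (rule Linf_class_cong[OF a_eq_L])
  ultimately show ?thesis by blast
qed

end

lemma (in measured_tower) special_elements_subset: "special_elements X p \<mu> \<subseteq> C0_image"
proof -
  have "Linf_class \<mu> a \<in> C0_image" if sp: "special_function X p \<mu> a" for a
  proof -
    obtain \<alpha> \<beta> where ab: "\<forall>n. \<alpha> n \<in> carrier (C0 (X n)) \<and> \<beta> n \<in> carrier (C0 (X n)) \<and>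
             strongly_sums \<mu> (\<lambda>g. group_act X p g a) (limit_kernel X p n) (\<alpha> n \<circ> coord n) \<and>
             strongly_sums \<mu> (\<lambda>g. group_act X p g (\<lambda>x. (a x)\<^sup>2)) (limit_kernel X p n) (\<beta> n \<circ> coord n)"
        "\<forall>\<epsilon>>0. \<exists>N. \<forall>n\<ge>N. sup_norm (X n) (\<lambda>x. (\<alpha> n x)\<^sup>2 - \<beta> n x) < \<epsilon>"
      using sp unfolding special_function_def by blast
    interpret special_tower X p Xt \<mu>\<^sub>0 \<mu> a \<alpha> \<beta>
      by unfold_locales (use sp ab in \<open>auto simp: special_function_def\<close>)
    show ?thesis by (rule special_in_image)
  qed
  then show ?thesis unfolding special_elements_def by blast
qed

theorem theorem4p10:
  fixes X :: "nat \<Rightarrow> 'a topology" and p :: "nat \<Rightarrow> 'a \<Rightarrow> 'a"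
    and Xt :: "(nat \<Rightarrow> 'a) topology"
    and \<mu>\<^sub>0 :: "'a measure" and \<mu> :: "(nat \<Rightarrow> 'a) measure"
  assumes "FinTop X p"
    and "top_inverse_limit X p Xt"
    and "radon_measure (X 0) \<mu>\<^sub>0" and "full_support (X 0) \<mu>\<^sub>0"
    and "radon_measure Xt \<mu>" and "locally_lifted Xt (X 0) (coord 0) \<mu>\<^sub>0 \<mu>"
  shows "cstar_isomorphism (C0 Xt) (nc_inverse_limit X p \<mu>) (Linf_class \<mu>)"
proof -
  interpret measured_tower X p Xt \<mu>\<^sub>0 \<mu>
    by unfold_locales (fact assms)+
  show ?thesis
    by (rule C0_isomorphism[OF special_elements_subset special_span_dense])
qed

end
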